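(* For a periodic trajectory $p$ on the double pentagon surface corresponding to the core curve of a cylinder (i.e. bouncing off of the midpoint of an edge), two possibilities arise: (1) The preimage of $p$ on the necklace is the union of five periodic trajectories, which each project one-to-one to $p$. In this case, the billiard trajectory has the same length as $p$, and only reflection symmetry. (2) The preimage of $p$ on the necklace is a single periodic trajectory, whose length is five times that of $p$. In this case, the billiard trajectory also has length five times that of $p$, and it has both reflection and rotation symmetries.
   Context: Let $Q$ be a regular pentagon centered at the origin with a horizontal side; it is the billiard table. The double pentagon is the translation surface obtained from $Q$ and $-Q$ by gluing each side of $Q$ by translation to the parallel side of $-Q$. A cylinder is a maximal family of parallel periodic trajectories; its core curve is the central one, which passes through midpoints of edges. The necklace is the translation surface which is the unfolding of the billiard table $Q$: letting $D$ be the dihedral group of order 10 generated by the linear reflections $s_e$ in the directions of the sides $e$ of $Q$, it is made of the ten pentagons $gQ$, $g\in D$ (each equal to $Q$ or $-Q$), with side $ge$ of the copy $gQ$ glued by translation to the parallel side of the copy $gs_eQ$. It is a 5-fold cover of the double pentagon, and folding ($gx\mapsto x$) maps necklace trajectories to billiard trajectories in $Q$; the billiard trajectory corresponding to $p$ is the folding of a (connected) lift of $p$ to the necklace. Reflection (respectively rotation) symmetry refers to invariance of the billiard trajectory under reflection in a symmetry axis of $Q$ (respectively under rotation by $2\pi/5$ about the center of $Q$). *)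

theory Defs
  imports "HOL-Analysis.Analysis"
begin

section \<open>Translation surfaces glued from convex polygons\<close>

text \<open>
  The disjoint union of the polygons is represented by pairs of a label and a complex number.
  A point of the surface is an equivalence class of such pairs under the equivalence relation
  generated by the gluing.
\<close>

record 'i glued_polygons =
  labels :: "'i set"
  polygon :: "'i \<Rightarrow> complex set"
  glue :: "'i \<times> complex \<Rightarrow> 'i \<times> complex \<Rightarrow> bool"

definition surface_point :: "'i glued_polygons \<Rightarrow> 'i \<times> complex \<Rightarrow> ('i \<times> complex) set" where
  "surface_point S x = {y. equivclp (glue S) x y}"

definition surface :: "'i glued_polygons \<Rightarrow> ('i \<times> complex) set set" where
  "surface S = {surface_point S (i, z) | i z. i \<in> labels S \<and> z \<in> polygon S i}"

text \<open>
  \<open>glued_by_translation A B z w\<close>: the translation that takes the segment \<open>A\<close> to the segment \<open>B\<close>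
  exists and takes the point \<open>z\<close> of \<open>A\<close> to \<open>w\<close>.
\<close>

definition glued_by_translation :: "complex set \<Rightarrow> complex set \<Rightarrow> complex \<Rightarrow> complex \<Rightarrow> bool" where
  "glued_by_translation A B z w \<longleftrightarrow> (\<exists>c. B = (+) c ` A \<and> z \<in> A \<and> w = c + z)"

text \<open>
  \<open>straight_on S v I \<gamma>\<close>, for an open interval \<open>I\<close>: on \<open>I\<close>, \<open>\<gamma>\<close> moves along the surface by the
  translation flow in direction \<open>v\<close> and does not meet a vertex. At each time there is a short
  straight piece of \<open>\<gamma>\<close> inside one polygon after that time (\<open>\<sigma> = 1\<close>) and another one before it
  (\<open>\<sigma> = -1\<close>). Where \<open>\<gamma>\<close> crosses a glued side, these two pieces lie in different polygons.
\<close>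

definition straight_on ::
    "'i glued_polygons \<Rightarrow> complex \<Rightarrow> real set \<Rightarrow> (real \<Rightarrow> ('i \<times> complex) set) \<Rightarrow> bool" where
  "straight_on S v I \<gamma> \<longleftrightarrow>
     (\<forall>t\<in>I. \<forall>\<sigma>\<in>{1, -1}. \<exists>i\<in>labels S. \<exists>z. \<exists>\<epsilon>>0. \<forall>s\<in>{0..\<epsilon>}.
        z + of_real (\<sigma> * s) * v \<in> polygon S i \<and>
        \<not> (z + of_real (\<sigma> * s) * v) extreme_point_of polygon S i \<and>
        \<gamma> (t + \<sigma> * s) = surface_point S (i, z + of_real (\<sigma> * s) * v))"

text \<open>Trajectories have unit speed, so time is arc length.\<close>

definition trajectory :: "'i glued_polygons \<Rightarrow> complex \<Rightarrow> (real \<Rightarrow> ('i \<times> complex) set) \<Rightarrow> bool" where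
  "trajectory S v \<gamma> \<longleftrightarrow> norm v = 1 \<and> straight_on S v UNIV \<gamma>"

definition periodic_trajectory ::
    "'i glued_polygons \<Rightarrow> complex \<Rightarrow> (real \<Rightarrow> ('i \<times> complex) set) \<Rightarrow> bool" where
  "periodic_trajectory S v \<gamma> \<longleftrightarrow> trajectory S v \<gamma> \<and> (\<exists>T>0. \<forall>t. \<gamma> (t + T) = \<gamma> t)"

definition trajectory_length :: "(real \<Rightarrow> ('i \<times> complex) set) \<Rightarrow> real" where
  "trajectory_length \<gamma> = Inf {T. 0 < T \<and> (\<forall>t. \<gamma> (t + T) = \<gamma> t)}"

text \<open>
  A family of parallel periodic trajectories \<open>F s\<close>, \<open>a < s < b\<close>, parametrised by the transverse
  distance \<open>s\<close>: for fixed \<open>t\<close>, the point \<open>F s t\<close> moves straight in the direction orthogonal to \<open>v\<close>.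
\<close>

definition parallel_family ::
    "'i glued_polygons \<Rightarrow> complex \<Rightarrow> real \<Rightarrow> real \<Rightarrow> (real \<Rightarrow> real \<Rightarrow> ('i \<times> complex) set) \<Rightarrow> bool" where
  "parallel_family S v a b F \<longleftrightarrow>
     a < b \<and>
     (\<forall>s\<in>{a<..<b}. periodic_trajectory S v (F s)) \<and>
     (\<forall>t. straight_on S (\<i> * v) {a<..<b} (\<lambda>s. F s t))"

definition cylinder ::
    "'i glued_polygons \<Rightarrow> complex \<Rightarrow> real \<Rightarrow> real \<Rightarrow> (real \<Rightarrow> real \<Rightarrow> ('i \<times> complex) set) \<Rightarrow> bool" where
  "cylinder S v a b F \<longleftrightarrow>
     parallel_family S v a b F \<and>
     (\<forall>a' b' F'. parallel_family S v a' b' F' \<and> a' \<le> a \<and> b \<le> b' \<and> (\<forall>s\<in>{a<..<b}. F' s = F s)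
        \<longrightarrow> a' = a \<and> b' = b)"

definition core_curve :: "'i glued_polygons \<Rightarrow> (real \<Rightarrow> ('i \<times> complex) set) \<Rightarrow> bool" where
  "core_curve S p \<longleftrightarrow> (\<exists>v a b F. cylinder S v a b F \<and> p = F ((a + b) / 2))"


section \<open>The pentagon, the double pentagon and the necklace\<close>

text \<open>
  \<open>r \<noteq> 0\<close> is the signed circumradius: the pentagon points up for \<open>r > 0\<close> and down for \<open>r < 0\<close>.
  Side \<open>2\<close> (from \<open>vertex r 2\<close> to \<open>vertex r 3\<close>) is horizontal.
\<close>

definition vertex :: "real \<Rightarrow> nat \<Rightarrow> complex" where
  "vertex r k = of_real r * \<i> * cis (2 * pi * real k / 5)"

definition pentagon :: "real \<Rightarrow> complex set" where
  "pentagon r = convex hull (vertex r ` {..<5})"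

definition side :: "real \<Rightarrow> nat \<Rightarrow> complex set" where
  "side r k = closed_segment (vertex r k) (vertex r (Suc k))"

text \<open>The reflection in the line through the origin spanned by \<open>u \<noteq> 0\<close>.\<close>

definition line_reflection :: "complex \<Rightarrow> complex \<Rightarrow> complex" where
  "line_reflection u z = u / cnj u * cnj z"

definition side_reflection :: "real \<Rightarrow> nat \<Rightarrow> complex \<Rightarrow> complex" where
  "side_reflection r k = line_reflection (vertex r (Suc k) - vertex r k)"

text \<open>The generators are involutions, so closure under composition yields the generated group.\<close>

inductive_set dihedral :: "real \<Rightarrow> (complex \<Rightarrow> complex) set" for r :: real where
  id: "id \<in> dihedral r"
| comp: "g \<in> dihedral r \<Longrightarrow> k < 5 \<Longrightarrow> g \<circ> side_reflection r k \<in> dihedral r"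

text \<open>The two polygons of the double pentagon are their own labels.\<close>

definition double_pentagon :: "real \<Rightarrow> complex set glued_polygons" where
  "double_pentagon r =
     \<lparr> labels = {pentagon r, uminus ` pentagon r},
       polygon = (\<lambda>P. P),
       glue = (\<lambda>(P, z) (P', w). P = pentagon r \<and> P' = uminus ` pentagon r \<and>
                 (\<exists>k<5. \<exists>l<5. glued_by_translation (side r k) (uminus ` side r l) z w)) \<rparr>"

definition necklace :: "real \<Rightarrow> (complex \<Rightarrow> complex) glued_polygons" where
  "necklace r =
     \<lparr> labels = dihedral r,
       polygon = (\<lambda>g. g ` pentagon r),
       glue = (\<lambda>(g, z) (h, w). g \<in> dihedral r \<and>
                 (\<exists>k<5. \<exists>l<5. h = g \<circ> side_reflection r k \<and>
                    glued_by_translation (g ` side r k) (h ` side r l) z w)) \<rparr>"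

text \<open>
  The covering sends the copy \<open>g Q\<close> identically to whichever of \<open>Q\<close>, \<open>-Q\<close> equals \<open>g Q\<close>; it maps
  equivalence classes onto equivalence classes.
\<close>

definition covering ::
    "real \<Rightarrow> ((complex \<Rightarrow> complex) \<times> complex) set \<Rightarrow> (complex set \<times> complex) set" where
  "covering r c = (\<lambda>(g, z). (g ` pentagon r, z)) ` c"

text \<open>All representatives of a point of the necklace fold to the same point of the pentagon.\<close>

definition fold_point :: "((complex \<Rightarrow> complex) \<times> complex) set \<Rightarrow> complex" where
  "fold_point c = the_elem ((\<lambda>(g, z). inv g z) ` c)"

definition necklace_preimage ::
    "real \<Rightarrow> (real \<Rightarrow> (complex set \<times> complex) set) \<Rightarrow> ((complex \<Rightarrow> complex) \<times> complex) set set" where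
  "necklace_preimage r p = {y \<in> surface (necklace r). covering r y \<in> range p}"


section \<open>Billiard trajectories\<close>

definition billiard_trajectory_of ::
    "real \<Rightarrow> (real \<Rightarrow> (complex set \<times> complex) set) \<Rightarrow> (real \<Rightarrow> complex) \<Rightarrow> bool" where
  "billiard_trajectory_of r p x \<longleftrightarrow>
     (\<exists>v q. trajectory (necklace r) v q \<and> (\<forall>t. covering r (q t) = p t) \<and> x = fold_point \<circ> q)"

text \<open>
  A billiard path that repeats after an odd number of bounces is traversed twice, as its lift to
  the necklace closes up only then. This concerns only trajectories parallel to a side, such as
  the pentagon and the pentagram through the midpoints of the sides.
\<close>

definition billiard_length :: "real \<Rightarrow> (real \<Rightarrow> complex) \<Rightarrow> real" where
  "billiard_length r x =
     Inf {T. 0 < T \<and> (\<forall>t. x (t + T) = x t) \<and>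
             even (card {t. 0 \<le> t \<and> t < T \<and> x t \<in> (\<Union>k<5. side r k)})}"

definition reflection_symmetric :: "real \<Rightarrow> (real \<Rightarrow> complex) \<Rightarrow> bool" where
  "reflection_symmetric r x \<longleftrightarrow>
     (\<exists>u. u \<noteq> 0 \<and> line_reflection u ` pentagon r = pentagon r \<and>
          line_reflection u ` range x = range x)"

definition rotation_symmetric :: "(real \<Rightarrow> complex) \<Rightarrow> bool" where
  "rotation_symmetric x \<longleftrightarrow> (\<lambda>z. cis (2 * pi / 5) * z) ` range x = range x"


section \<open>The two possibilities for the preimage on the necklace\<close>

definition lifts_to_five ::
    "real \<Rightarrow> (real \<Rightarrow> (complex set \<times> complex) set) \<Rightarrow> bool" where
  "lifts_to_five r p \<longleftrightarrow>
     (\<exists>\<C>. card \<C> = 5 \<and> disjoint \<C> \<and>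
          necklace_preimage r p = \<Union>\<C> \<and>
          (\<forall>C\<in>\<C>. (\<exists>v q. periodic_trajectory (necklace r) v q \<and> C = range q) \<and>
                  bij_betw (covering r) C (range p)))"

definition lifts_to_one ::
    "real \<Rightarrow> (real \<Rightarrow> (complex set \<times> complex) set) \<Rightarrow> bool" where
  "lifts_to_one r p \<longleftrightarrow>
     (\<exists>v q. periodic_trajectory (necklace r) v q \<and>
            necklace_preimage r p = range q \<and>
            trajectory_length q = 5 * trajectory_length p)"

end

theory Submission
  imports Defs
begin

text \<open>
  Both surfaces are glued from copies of \<open>\<plusminus>Q\<close> along midpoint-preserving translations, and a point
  that is not a vertex has at most two representatives. Hence straight paths continue uniquely, and
  maps that permute the copies and act linearly on the plane carry trajectories to trajectories.

  The rotation by \<open>\<pi>\<close>, which exchanges \<open>Q\<close> and \<open>-Q\<close>, is an involution \<open>\<iota>\<close>. A core curve \<open>p\<close> is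
  invariant under it. Count, for each height in \<open>Q\<close>, the chords of \<open>p\<close> below it minus the chords of
  \<open>\<iota> p\<close> below it. Because \<open>p\<close> and \<open>\<iota> p\<close> cross the sides at opposite points, this count is constant
  along the flow, well defined on the surface and equal to a constant \<open>c\<close> at all vertices. If the
  cylinder \<open>C\<close> of \<open>p\<close> did not meet \<open>\<iota> p\<close>, the count would be nondecreasing across \<open>C\<close> and jump at
  \<open>p\<close>, so on one side of \<open>p\<close> it would differ from \<open>c\<close>; that side of \<open>C\<close> would stay away from the
  vertices, and \<open>C\<close> could be extended. So \<open>\<iota> C\<close> meets \<open>C\<close>, by maximality \<open>\<iota> C = C\<close>, and the
  core curve is mapped to itself with reversed direction. Its fixed points are midpoints of sides.

  Precomposition of the labels with rotations makes the necklace a \<open>\<int>/5\<close>-cover. If the monodromy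
  along \<open>p\<close> is trivial, \<open>p\<close> has five disjoint closed lifts, otherwise a single one, which is five
  times as long. The deck transformations fold to rotations of \<open>Q\<close>, and the lifts of \<open>\<iota>\<close> fold to
  reflections. In the trivial case a rotational symmetry would identify a lift with a translate of
  it by some \<open>h \<in> D\<close> that preserves its direction up to sign; then \<open>h\<^sup>2 = 1\<close>, and two of the five
  lifts would coincide.
\<close>

section \<open>The regular pentagon\<close>

text \<open>The surfaces carry no topology here: a trajectory is a function into classes with
  one-sided straight germs. Continuity arguments therefore take one form: a property is constant
  near each time, separately before and after it, and spreads over an interval by connectedness or
  bisection. Compactness of the surface enters through a Lebesgue number in the plane pentagon,
  which gives one chart radius for all points at a fixed distance from the vertices; this turns
  "stays away from the vertices" into "can be extended". The count replaces homology. The double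
  pentagon has genus 2 and its involution acts by -1 on homology, so a closed geodesic and its
  reversed image are homologous. The count is the height function that they bound together: it goes
  up across the one and down across the other. Lengths are compared through the parity of bounces.
  Parity decides the orientation of the copy, and among copies of one orientation the folded
  position and velocity determine the copy; so periods of the lift are exactly the even periods of
  the billiard path.\<close>

definition omega :: complex where "omega = cis (2 * pi / 5)"

text \<open>Serves both as the midpoint of side \<open>k\<close> and as an outward normal of that
  side, so that the half-planes of the pentagon read
  \<open>mid r k \<bullet> z \<le> apo r\<close>.\<close>

definition mid :: "real \<Rightarrow> nat \<Rightarrow> complex" where
  "mid r k = (vertex r k + vertex r (Suc k)) / 2"

text \<open>The square of the apothem: the normals \<open>mid r k\<close> are not normalised, and
  their length is the apothem.\<close>

definition apo :: "real \<Rightarrow> real" where "apo r = (r * cos (pi / 5))\<^sup>2"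

lemma omega_pow5 [simp]: "omega ^ 5 = 1"
  unfolding omega_def Complex.DeMoivre by simp

lemma omega_pow_mod: "omega ^ (n mod 5) = omega ^ n"
proof -
  have "omega ^ n = omega ^ (5 * (n div 5) + n mod 5)" by simp
  also have "\<dots> = omega ^ (n mod 5)" unfolding power_add power_mult by simp
  finally show ?thesis by simp
qed

lemma vertex_omega: "vertex r k = of_real r * \<i> * omega ^ k"
  unfolding vertex_def omega_def Complex.DeMoivre by (simp add: field_simps)

lemma vertex_mod: "vertex r (k mod 5) = vertex r k"
  by (simp add: vertex_omega omega_pow_mod)

lemma mid_omega: "mid r k = of_real r * \<i> * omega ^ k * ((1 + omega) / 2)"
  by (simp add: mid_def vertex_omega field_simps)

lemma cos_pi5_pos: "cos (pi / 5) > 0"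
  by (rule cos_gt_zero) auto

lemma half_one_omega: "(1 + omega) / 2 = of_real (cos (pi / 5)) * cis (pi / 5)"
proof -
  have "cos (2 * pi / 5) = 2 * (cos (pi / 5))\<^sup>2 - 1" "sin (2 * pi / 5) = 2 * sin (pi / 5) * cos (pi / 5)"
    using cos_double_cos[of "pi / 5"] sin_double[of "pi / 5"] by simp_all
  then show ?thesis by (simp add: omega_def complex_eq_iff power2_eq_square)
qed

text \<open>Polar form: \<open>mid r k\<close> has signed radius \<open>r * cos (pi / 5)\<close> and
  lies half a step, \<open>pi / 5\<close>, beyond \<open>vertex r k\<close>.\<close>

lemma mid_vertex: "mid r k \<bullet> vertex r l = r\<^sup>2 * cos (pi / 5) * cos (pi * (2 * (real l - real k) - 1) / 5)"
proof -
  have m: "mid r k = of_real (r * cos (pi / 5)) * (\<i> * cis (2 * pi * real k / 5 + pi / 5))"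
    unfolding mid_omega half_one_omega unfolding omega_def Complex.DeMoivre by (simp add: cis_mult add_divide_distrib mult_ac add.commute)
  have "mid r k \<bullet> vertex r l = r * cos (pi / 5) * r * cos ((2 * pi * real l / 5) - (2 * pi * real k / 5 + pi / 5))"
    unfolding m vertex_def by (simp add: inner_complex_def cos_diff algebra_simps)
  also have "(2 * pi * real l / 5) - (2 * pi * real k / 5 + pi / 5) = pi * (2 * (real l - real k) - 1) / 5"
    by (simp add: field_simps)
  finally show ?thesis by (simp add: power2_eq_square)
qed

text \<open>The angle is an odd multiple of \<open>pi / 5\<close>. Up to sign and period only the
  multiples 1, 3 and 5 occur, and cosine decreases on \<open>[0, pi]\<close>; the 25 pairs are then
  checked.\<close>

lemma cos_pent:
  assumes "k < 5" "l < 5"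
  shows "cos (pi * (2 * (real l - real k) - 1) / 5) \<le> cos (pi / 5)"
    and "cos (pi * (2 * (real l - real k) - 1) / 5) = cos (pi / 5) \<longleftrightarrow> l = k \<or> l = Suc k mod 5"
proof -
  define f where "f x = cos (pi * x / 5)" for x :: real
  have f3: "f 3 < f 1" and f5: "f 5 < f 1" unfolding f_def by (rule cos_monotone_0_pi; simp)+
  have per: "f (10 - x) = f x" and even: "f (- x) = f x" for x
    using cos_2pi_minus[of "pi * x / 5"] by (simp_all add: f_def field_simps)
  have f7: "f 7 = f 3" using per[of 3] by simp
  have f9: "f 9 = f 1" using per[of 1] by simp
  have e: "f (-1) = f 1" "f (-3) = f 3" "f (-5) = f 5" "f (-7) = f 3" "f (-9) = f 1"
    using even f7 f9 by metis+
  have kl: "k = 0 \<or> k = 1 \<or> k = 2 \<or> k = 3 \<or> k = 4" "l = 0 \<or> l = 1 \<or> l = 2 \<or> l = 3 \<or> l = 4"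
    using assms by linarith+
  have "f (2 * (real l - real k) - 1) \<le> f 1 \<and>
     (f (2 * (real l - real k) - 1) = f 1 \<longleftrightarrow> l = k \<or> l = Suc k mod 5)"
    using kl f3 f5 by (elim disjE) (simp_all add: e f7 f9)
  then show "cos (pi * (2 * (real l - real k) - 1) / 5) \<le> cos (pi / 5)"
    "cos (pi * (2 * (real l - real k) - 1) / 5) = cos (pi / 5) \<longleftrightarrow> l = k \<or> l = Suc k mod 5"
    by (simp_all add: f_def)
qed

lemma apo_pos: "r \<noteq> 0 \<Longrightarrow> apo r > 0"
  using cos_pi5_pos by (simp add: apo_def)

lemma mid_vertex_le:
  assumes "k < 5"
  shows "mid r k \<bullet> vertex r l \<le> apo r"
proof -
  have "mid r k \<bullet> vertex r (l mod 5) \<le> r\<^sup>2 * cos (pi / 5) * cos (pi / 5)"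
    unfolding mid_vertex using cos_pent(1)[OF assms, of "l mod 5"] cos_pi5_pos
    by (intro mult_left_mono) auto
  then show ?thesis by (simp add: vertex_mod apo_def power2_eq_square mult_ac)
qed

lemma mid_vertex_eq:
  assumes "k < 5" "r \<noteq> 0"
  shows "mid r k \<bullet> vertex r l = apo r \<longleftrightarrow> l mod 5 = k \<or> l mod 5 = Suc k mod 5"
proof -
  have "mid r k \<bullet> vertex r (l mod 5) = apo r \<longleftrightarrow>
     cos (pi * (2 * (real (l mod 5) - real k) - 1) / 5) = cos (pi / 5)"
    unfolding mid_vertex using cos_pi5_pos assms(2) by (auto simp: apo_def power2_eq_square)
  also have "\<dots> \<longleftrightarrow> l mod 5 = k \<or> l mod 5 = Suc k mod 5" by (rule cos_pent(2)) (use assms in auto)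
  finally show ?thesis by (simp add: vertex_mod)
qed

lemma mid_mid:
  assumes "r \<noteq> 0" "k < 5"
  shows "mid r k \<bullet> mid r k = apo r"
proof -
  have "mid r k \<bullet> vertex r k = apo r" "mid r k \<bullet> vertex r (Suc k) = apo r"
    using assms by (auto simp: mid_vertex_eq)
  then have "mid r k \<bullet> (vertex r k + vertex r (Suc k)) = 2 * apo r" by (simp add: inner_add_right)
  moreover have "vertex r k + vertex r (Suc k) = 2 *\<^sub>R mid r k" by (simp add: mid_def scaleR_conv_of_real)
  ultimately show ?thesis by simp
qed

text \<open>Sine rule: \<open>sin \<delta> * cis \<phi> = sin (\<delta> - \<phi>) + sin \<phi> * cis
  \<delta>\<close>, with nonnegative coefficients for \<open>\<phi>\<close> between 0 and
  \<open>\<delta> = 2 * pi / 5\<close>. The index \<open>k\<close> is the sector that contains the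
  argument of \<open>z\<close>.\<close>

lemma omega_cone: "\<exists>k<5. \<exists>\<alpha>\<ge>0. \<exists>\<beta>\<ge>0. z = of_real \<alpha> * omega ^ k + of_real \<beta> * omega ^ Suc k"
proof -
  obtain \<theta> where th: "0 \<le> \<theta>" "\<theta> < 2 * pi" "z = of_real (norm z) * cis \<theta>"
    using Arg2pi[of z] by (auto simp: cis_conv_exp is_Arg_def)
  define k where "k = nat \<lfloor>5 * \<theta> / (2 * pi)\<rfloor>"
  have k: "real k \<le> 5 * \<theta> / (2 * pi)" "5 * \<theta> / (2 * pi) < real k + 1"
    unfolding k_def using th by (simp_all add: of_nat_nat)
  have "5 * \<theta> / (2 * pi) < 5" using th by (simp add: field_simps)
  then have k5: "k < 5" using k by linarith
  define \<delta> where "\<delta> = 2 * pi / 5"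
  define \<phi> where "\<phi> = \<theta> - 2 * pi * real k / 5"
  have ph: "0 \<le> \<phi>" "\<phi> \<le> \<delta>" using k by (auto simp: \<phi>_def \<delta>_def field_simps)
  have s: "sin \<delta> > 0" unfolding \<delta>_def by (rule sin_gt_zero) auto
  have a: "sin (\<delta> - \<phi>) \<ge> 0" "sin \<phi> \<ge> 0" using ph pi_gt_zero by (auto intro!: sin_ge_zero simp: \<delta>_def)
  have e: "of_real (sin \<delta>) * cis \<phi> = of_real (sin (\<delta> - \<phi>)) + of_real (sin \<phi>) * cis \<delta>"
    by (simp add: complex_eq_iff sin_diff algebra_simps)
  have ok: "omega ^ k = cis (2 * pi * real k / 5)" unfolding omega_def Complex.DeMoivre by (simp add: field_simps)
  have "cis \<theta> = cis \<phi> * omega ^ k" unfolding ok cis_mult by (simp add: \<phi>_def)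
  also have "\<dots> = (of_real (sin (\<delta> - \<phi>)) + of_real (sin \<phi>) * omega) / of_real (sin \<delta>) * omega ^ k"
  proof -
    have "cis \<phi> = (of_real (sin (\<delta> - \<phi>)) + of_real (sin \<phi>) * omega) / of_real (sin \<delta>)"
      using e s unfolding omega_def \<delta>_def[symmetric] by (metis less_irrefl mult.commute nonzero_eq_divide_eq of_real_eq_0_iff)
    then show ?thesis by simp
  qed
  finally have c: "cis \<theta> = \<dots>" .
  have "z = of_real (norm z * sin (\<delta> - \<phi>) / sin \<delta>) * omega ^ k + of_real (norm z * sin \<phi> / sin \<delta>) * omega ^ Suc k"
    by (subst th(3), subst c) (simp add: field_simps add_divide_distrib)
  then show ?thesis using k5 a s by (intro exI[of _ k] conjI exI[of _ "norm z * sin (\<delta> - \<phi>) / sin \<delta>"] exI[of _ "norm z * sin \<phi> / sin \<delta>"]) auto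
qed

lemma omega_ne_1: "omega \<noteq> 1"
proof -
  have "sin (2 * pi / 5) > 0" by (rule sin_gt_zero) auto
  then show ?thesis by (auto simp: omega_def complex_eq_iff)
qed

text \<open>A nonzero residue is invertible modulo 5, so \<open>omega ^ n = 1\<close> with such an
  exponent would force \<open>omega = 1\<close>.\<close>

lemma omega_power_eq_1: "omega ^ n = 1 \<longleftrightarrow> 5 dvd n"
proof
  assume h: "omega ^ n = 1"
  show "5 dvd n"
  proof (rule ccontr)
    assume "\<not> 5 dvd n"
    then have "n mod 5 \<noteq> 0" "n mod 5 < 5" by (simp_all only: dvd_eq_mod_eq_0) simp
    then have "n mod 5 = 1 \<or> n mod 5 = 2 \<or> n mod 5 = 3 \<or> n mod 5 = 4" by linarith
    then have "\<exists>j. (n * j) mod 5 = 1"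
      by (elim disjE) (rule exI[of _ 1] exI[of _ 3] exI[of _ 2] exI[of _ 4], simp add: mod_mult_left_eq[symmetric])+
    then obtain j where "(n * j) mod 5 = 1" by blast
    then have "omega ^ (n * j) = omega" using omega_pow_mod[of "n * j"] by simp
    then show False using h omega_ne_1 by (simp add: power_mult)
  qed
next
  assume "5 dvd n" then show "omega ^ n = 1" by (auto simp: power_mult)
qed

lemma omega_ne0 [simp]: "omega \<noteq> 0" by (simp add: omega_def)

lemma omega_power_inj:
  assumes "k < 5" "l < 5" "omega ^ k = omega ^ l" shows "k = l"
proof -
  have *: "k = l" if "k \<le> l" "k < 5" "l < 5" "omega ^ k = omega ^ l" for k l
  proof -
    have "omega ^ l = omega ^ k * omega ^ (l - k)" using that by (metis le_add_diff_inverse power_add)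
    then have "omega ^ (l - k) = 1" using that by simp
    then have "5 dvd l - k" by (simp add: omega_power_eq_1)
    then have "l - k = 0" using that dvd_imp_le[of 5 "l - k"] by linarith
    then show ?thesis using that by simp
  qed
  show ?thesis using *[of k l] *[of l k] assms by (cases "k \<le> l") auto
qed

lemma norm_omega [simp]: "norm omega = 1" by (simp add: omega_def)

lemma unity5: "u ^ 5 = 1 \<longleftrightarrow> (\<exists>k<5. u = omega ^ k)" for u :: complex
proof
  assume "u ^ 5 = 1"
  then have "u \<in> (\<lambda>k. cis (2 * pi * real k / real 5)) ` {..<5}"
    using bij_betw_imp_surj_on[OF Complex.bij_betw_roots_unity[of 5], OF zero_less_numeral]
    by (metis (mono_tags, lifting) mem_Collect_eq of_nat_numeral)
  then obtain j where j: "u = cis (2 * pi * real j / 5)" "j < 5" by (metis (lifting) imageE lessThan_iff of_nat_numeral)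
  then have "u = omega ^ j" unfolding omega_def Complex.DeMoivre by (simp add: field_simps)
  then show "\<exists>k<5. u = omega ^ k" using j by blast
next
  assume "\<exists>k<5. u = omega ^ k"
  then obtain k where u: "u = omega ^ k" by blast
  have "u ^ 5 = (omega ^ 5) ^ k" by (simp only: u power_mult[symmetric] mult.commute)
  then show "u ^ 5 = 1" by (simp only: omega_pow5 power_one)
qed

lemma one_plus_omega_ne0: "1 + omega \<noteq> 0"
proof -
  have "sin (2 * pi / 5) > 0" by (rule sin_gt_zero) auto
  then show ?thesis by (auto simp: omega_def complex_eq_iff)
qed

lemma mid_inj:
  assumes "r \<noteq> 0" "k < 5" "l < 5" "mid r k = mid r l" shows "k = l"
  using assms one_plus_omega_ne0 by (auto simp: mid_omega intro: omega_power_inj)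

section \<open>Half-planes, sides and vertices of the pentagon\<close>

lemma zero_in_pentagon: "0 \<in> pentagon r"
proof -
  have "(\<Sum>k<5. omega ^ k) = 0"
    using geometric_sum[OF omega_ne_1, of 5] by simp
  then have s: "(\<Sum>k<5. (1/5) *\<^sub>R vertex r k) = 0"
    by (simp add: vertex_omega scaleR_conv_of_real flip: sum_distrib_left sum_divide_distrib)
  have "(\<Sum>k<5. (1/5::real) *\<^sub>R vertex r k) \<in> pentagon r" unfolding pentagon_def
    by (rule convex_sum) (auto intro: hull_inc)
  then show ?thesis using s by simp
qed

lemma vertex_in_pentagon: "vertex r k \<in> pentagon r"
proof -
  have "vertex r (k mod 5) \<in> pentagon r" unfolding pentagon_def by (rule hull_inc) auto
  then show ?thesis by (simp add: vertex_mod)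
qed

lemma convex_pentagon: "convex (pentagon r)" unfolding pentagon_def by simp

text \<open>For the harder inclusion, \<open>z\<close> lies in the cone over some side
  \<open>k\<close>. The inequality of that side alone bounds the sum of the cone coordinates by 1,
  which puts \<open>z\<close> into the triangle over the side with apex 0.\<close>

lemma pentagon_halfplanes:
  assumes "r \<noteq> 0"
  shows "pentagon r = {z. \<forall>k<5. mid r k \<bullet> z \<le> apo r}" (is "_ = ?H")
proof
  have "convex ?H"
  proof -
    have "?H = (\<Inter>k\<in>{..<5}. {z. mid r k \<bullet> z \<le> apo r})" by auto
    moreover have "convex (\<Inter>k\<in>{..<5}. {z. mid r k \<bullet> z \<le> apo r})" by (intro convex_INT convex_halfspace_le)
    ultimately show ?thesis by (simp only:)
  qed
  then show "pentagon r \<subseteq> ?H" unfolding pentagon_def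
    by (intro hull_minimal) (auto simp: mid_vertex_le)
  show "?H \<subseteq> pentagon r"
  proof
    fix z assume z: "z \<in> ?H"
    obtain k \<alpha> \<beta> where k: "k < 5" "\<alpha> \<ge> 0" "\<beta> \<ge> 0"
      "z / (of_real r * \<i>) = of_real \<alpha> * omega ^ k + of_real \<beta> * omega ^ Suc k"
      using omega_cone by blast
    then have zz: "z = \<alpha> *\<^sub>R vertex r k + \<beta> *\<^sub>R vertex r (Suc k)"
      using assms by (simp add: vertex_omega scaleR_conv_of_real field_simps)
    have "mid r k \<bullet> vertex r k = apo r" "mid r k \<bullet> vertex r (Suc k) = apo r"
      using assms k by (auto simp: mid_vertex_eq)
    then have "mid r k \<bullet> z = (\<alpha> + \<beta>) * apo r" by (simp add: zz inner_add_right algebra_simps)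
    then have "(\<alpha> + \<beta>) * apo r \<le> 1 * apo r" using z k by auto
    then have ab: "\<alpha> + \<beta> \<le> 1" using apo_pos[OF assms] by simp
    have "(1 - \<alpha> - \<beta>) *\<^sub>R 0 + \<alpha> *\<^sub>R vertex r k + \<beta> *\<^sub>R vertex r (Suc k) \<in> convex hull {0, vertex r k, vertex r (Suc k)}"
      unfolding convex_hull_3 mem_Collect_eq
      by (rule exI[of _ "1 - \<alpha> - \<beta>"], rule exI[of _ \<alpha>], rule exI[of _ \<beta>]) (use k ab in simp)
    moreover have "convex hull {0, vertex r k, vertex r (Suc k)} \<subseteq> pentagon r"
      by (intro hull_minimal convex_pentagon) (auto simp: zero_in_pentagon vertex_in_pentagon)
    ultimately show "z \<in> pentagon r" by (auto simp: zz)
  qed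
qed

lemma compact_pentagon: "compact (pentagon r)"
  unfolding pentagon_def by (intro compact_convex_hull finite_imp_compact) auto

text \<open>A supporting line cuts out a face of the convex hull. A face is the hull of the
  generators on it, and \<open>mid_vertex_eq\<close> leaves only the two ends of the side.\<close>

lemma side_tight:
  assumes "r \<noteq> 0" "k < 5"
  shows "side r k = {z \<in> pentagon r. mid r k \<bullet> z = apo r}" (is "_ = ?T")
proof
  have "side r k \<subseteq> pentagon r" unfolding side_def
    by (intro closed_segment_subset vertex_in_pentagon convex_pentagon)
  moreover have "side r k \<subseteq> {z. mid r k \<bullet> z = apo r}" unfolding side_def
    using assms by (intro closed_segment_subset convex_hyperplane) (auto simp: mid_vertex_eq)
  ultimately show "side r k \<subseteq> ?T" by auto
  have le: "\<And>z. z \<in> pentagon r \<Longrightarrow> mid r k \<bullet> z \<le> apo r" using assms by (auto simp: pentagon_halfplanes)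
  have "?T = pentagon r \<inter> {z. mid r k \<bullet> z = apo r}" by auto
  then have "?T face_of (convex hull (vertex r ` {..<5}))"
    using face_of_Int_supporting_hyperplane_le[OF convex_pentagon le] by (simp add: pentagon_def)
  then obtain S where S: "S \<subseteq> vertex r ` {..<5}" "?T = convex hull S"
    using face_of_convex_hull_subset[OF finite_imp_compact] by (metis (no_types, lifting) finite_imageI finite_lessThan)
  have "S \<subseteq> {vertex r k, vertex r (Suc k)}"
  proof
    fix x assume x: "x \<in> S"
    then obtain l where l: "x = vertex r l" using S by auto
    have "x \<in> ?T" using x S by (metis hull_inc)
    then have "l mod 5 = k \<or> l mod 5 = Suc k mod 5" using assms l by (auto simp: mid_vertex_eq)
    then have "vertex r (l mod 5) = vertex r k \<or> vertex r (l mod 5) = vertex r (Suc k)"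
      by (metis vertex_mod)
    then show "x \<in> {vertex r k, vertex r (Suc k)}" by (simp add: l vertex_mod)
  qed
  then have "convex hull S \<subseteq> convex hull {vertex r k, vertex r (Suc k)}" by (rule hull_mono)
  then show "?T \<subseteq> side r k" using S by (simp add: side_def segment_convex_hull)
qed

lemma norm_vertex: "norm (vertex r k) = \<bar>r\<bar>"
  by (simp add: vertex_def norm_mult)

lemma extreme_vertex:
  "z extreme_point_of pentagon r \<longleftrightarrow> (\<exists>k<5. z = vertex r k)"
proof
  assume "z extreme_point_of pentagon r"
  then show "\<exists>k<5. z = vertex r k" unfolding pentagon_def by (auto dest!: extreme_point_of_convex_hull)
next
  assume "\<exists>k<5. z = vertex r k"
  then obtain k where z: "z = vertex r k" by blast
  have sub: "pentagon r \<subseteq> cball 0 \<bar>r\<bar>" unfolding pentagon_def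
    by (intro hull_minimal convex_cball) (auto simp: norm_vertex)
  \<comment> \<open>Equality in Cauchy-Schwarz on the circumscribed disc: the vertex is the only
    point of the pentagon with the maximal component along it.\<close>
  have *: "a = z" if "a \<in> pentagon r" "a \<bullet> z = z \<bullet> z" for a
  proof -
    have "norm a \<le> norm z" using that sub by (auto simp: z norm_vertex)
    then have "a \<bullet> a \<le> z \<bullet> z" by (simp add: norm_le)
    moreover have "(a - z) \<bullet> (a - z) = a \<bullet> a - 2 * (a \<bullet> z) + z \<bullet> z"
      by (simp add: inner_diff_left inner_diff_right inner_commute)
    ultimately have "(a - z) \<bullet> (a - z) \<le> 0" using that by simp
    then show ?thesis by (metis inner_gt_zero_iff leD right_minus_eq)
  qed
  have le: "a \<bullet> z \<le> z \<bullet> z" if "a \<in> pentagon r" for a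
  proof -
    have "norm a \<le> norm z" using that sub by (auto simp: z norm_vertex)
    then have "norm a * norm z \<le> norm z * norm z" by (intro mult_right_mono) auto
    then show ?thesis using norm_cauchy_schwarz[of a z] by (simp add: dot_square_norm power2_eq_square)
  qed
  have "z \<notin> open_segment a b" if ab: "a \<in> pentagon r" "b \<in> pentagon r" for a b
  proof
    assume "z \<in> open_segment a b"
    then obtain u where u: "a \<noteq> b" "0 < u" "u < 1" "z = (1 - u) *\<^sub>R a + u *\<^sub>R b" by (auto simp: in_segment)
    have e: "z \<bullet> z = (1 - u) * (a \<bullet> z) + u * (b \<bullet> z)"
      by (subst (1) u(4)) (simp add: inner_add_left)
    have "(1 - u) * (z \<bullet> z - a \<bullet> z) + u * (z \<bullet> z - b \<bullet> z) = 0" using e by (simp add: algebra_simps)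
    moreover have "(1 - u) * (z \<bullet> z - a \<bullet> z) \<ge> 0" "u * (z \<bullet> z - b \<bullet> z) \<ge> 0" using le ab u by auto
    ultimately have "a \<bullet> z = z \<bullet> z" "b \<bullet> z = z \<bullet> z" using u by (auto simp: add_nonneg_eq_0_iff)
    then show False using *[of a] *[of b] ab u by auto
  qed
  then show "z extreme_point_of pentagon r" by (auto simp: extreme_point_of_def z vertex_in_pentagon)
qed

lemma vertex_extreme: "vertex r k extreme_point_of pentagon r"
  unfolding extreme_vertex by (intro exI[of _ "k mod 5"]) (simp add: vertex_mod)

text \<open>A point of side \<open>k\<close> that is no vertex lies strictly between the two ends.
  If it were also on line \<open>l\<close>, both ends would be, but two different sides share at
  most one vertex.\<close>

lemma two_sides_extreme:
  assumes "r \<noteq> 0" "k < 5" "l < 5" "k \<noteq> l" "z \<in> pentagon r" "mid r k \<bullet> z = apo r" "mid r l \<bullet> z = apo r"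
  shows "z extreme_point_of pentagon r"
proof (rule ccontr)
  assume n: "\<not> z extreme_point_of pentagon r"
  have "z \<in> side r k" using assms by (simp add: side_tight)
  then obtain u where u: "0 \<le> u" "u \<le> 1" "z = (1 - u) *\<^sub>R vertex r k + u *\<^sub>R vertex r (Suc k)"
    by (auto simp: side_def in_segment)
  have u': "0 < u" "u < 1" using u n vertex_extreme by (cases "u = 0"; cases "u = 1"; force)+
  have "(1 - u) * (apo r - mid r l \<bullet> vertex r k) + u * (apo r - mid r l \<bullet> vertex r (Suc k)) = 0"
    using assms(7) by (simp add: u inner_add_right algebra_simps)
  moreover have "(1 - u) * (apo r - mid r l \<bullet> vertex r k) \<ge> 0" "u * (apo r - mid r l \<bullet> vertex r (Suc k)) \<ge> 0"
    using mid_vertex_le[OF assms(3)] u by auto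
  ultimately have "mid r l \<bullet> vertex r k = apo r" "mid r l \<bullet> vertex r (Suc k) = apo r"
    using u' by (auto simp: add_nonneg_eq_0_iff)
  then have "(k mod 5 = l \<or> k mod 5 = Suc l mod 5)" "Suc k mod 5 = l \<or> Suc k mod 5 = Suc l mod 5"
    using assms by (auto simp: mid_vertex_eq)
  then show False using assms(2-4) by (auto simp: mod_Suc split: if_splits)
qed

lemma two_mid: "2 *\<^sub>R mid r k = vertex r k + vertex r (Suc k)"
  by (simp add: mid_def scaleR_conv_of_real)

text \<open>The gluing of side \<open>k\<close> is the translation by
  \<open>- 2 *\<^sub>R mid r k\<close>; followed by negation it becomes the point reflection in the
  midpoint, which keeps the side.\<close>

lemma opposite_side:
  assumes "z \<in> side r k" shows "2 *\<^sub>R mid r k - z \<in> side r k"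
proof -
  obtain u where u: "0 \<le> u" "u \<le> 1" "z = (1 - u) *\<^sub>R vertex r k + u *\<^sub>R vertex r (Suc k)"
    using assms unfolding side_def in_segment by blast
  then have "2 *\<^sub>R mid r k - z = (1 - (1 - u)) *\<^sub>R vertex r k + (1 - u) *\<^sub>R vertex r (Suc k)"
    by (simp add: two_mid algebra_simps)
  then show ?thesis using u(1,2) unfolding side_def in_segment by (intro exI[of _ "1 - u"]) simp
qed

lemma opposite_extreme:
  assumes "r \<noteq> 0" "k < 5" "z extreme_point_of pentagon r" "mid r k \<bullet> z = apo r"
  shows "(2 *\<^sub>R mid r k - z) extreme_point_of pentagon r"
proof -
  obtain l where l: "l < 5" "z = vertex r l" using assms(3) by (auto simp: extreme_vertex)
  then have "l mod 5 = k \<or> l mod 5 = Suc k mod 5" using assms by (auto simp: mid_vertex_eq)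
  then have "z = vertex r k \<or> z = vertex r (Suc k)" using l by (metis vertex_mod)
  then show ?thesis by (auto simp: two_mid vertex_extreme)
qed

section \<open>Surfaces glued from copies of a pentagon and its negative\<close>

lemma extreme_second_side:
  assumes "r \<noteq> 0" "z extreme_point_of pentagon r"
  shows "\<exists>j<5. j \<noteq> k \<and> mid r j \<bullet> z = apo r"
proof -
  obtain l where l: "l < 5" "z = vertex r l" using assms by (auto simp: extreme_vertex)
  have a: "mid r l \<bullet> z = apo r" using l assms(1) by (simp add: mid_vertex_eq)
  have "Suc ((l + 4) mod 5) mod 5 = l" using l by (simp add: mod_Suc_eq)
  then have b: "mid r ((l + 4) mod 5) \<bullet> z = apo r" using l assms(1) by (simp add: mid_vertex_eq)
  have "(l + 4) mod 5 \<noteq> l" using l(1) by presburger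
  then show ?thesis using a b l by (cases "k = l") (auto intro: exI[of _ "(l + 4) mod 5"])
qed

section \<open>Regular points and straight germs\<close>

definition regular :: "'i glued_polygons \<Rightarrow> 'i \<Rightarrow> complex \<Rightarrow> bool" where
  "regular S i z \<longleftrightarrow> i \<in> labels S \<and> z \<in> polygon S i \<and> \<not> z extreme_point_of polygon S i"

text \<open>A one-sided germ at time 0. The copy and the length of the piece belong to the germ, so
  the two germs at one time may lie in different copies.\<close>

definition ray :: "'i glued_polygons \<Rightarrow> complex \<Rightarrow> (real \<Rightarrow> ('i \<times> complex) set) \<Rightarrow> bool" where
  "ray S w \<gamma> \<longleftrightarrow> (\<exists>i z. \<exists>\<epsilon>>0. \<forall>s\<in>{0..\<epsilon>}.
     regular S i (z + s *\<^sub>R w) \<and> \<gamma> s = surface_point S (i, z + s *\<^sub>R w))"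

lemma straight_on_ray:
  "straight_on S v I \<gamma> \<longleftrightarrow> (\<forall>t\<in>I. ray S v (\<lambda>s. \<gamma> (t + s)) \<and> ray S (- v) (\<lambda>s. \<gamma> (t - s)))"
proof -
  have *: "ray S w \<gamma> \<longleftrightarrow> (\<exists>i\<in>labels S. \<exists>z. \<exists>\<epsilon>>0. \<forall>s\<in>{0..\<epsilon>}. z + s *\<^sub>R w \<in> polygon S i \<and>
      \<not> (z + s *\<^sub>R w) extreme_point_of polygon S i \<and> \<gamma> s = surface_point S (i, z + s *\<^sub>R w))" (is "_ = ?R")
    for w and \<gamma> :: "real \<Rightarrow> ('a \<times> complex) set"
  proof
    assume "ray S w \<gamma>"
    then obtain i z \<epsilon> where *: "\<epsilon> > 0" "\<forall>s\<in>{0..\<epsilon>}. regular S i (z + s *\<^sub>R w) \<and> \<gamma> s = surface_point S (i, z + s *\<^sub>R w)"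
      unfolding ray_def by blast
    then have "i \<in> labels S" by (auto simp: regular_def dest: bspec[of _ _ 0])
    then show ?R using * unfolding regular_def by blast
  next
    assume ?R
    then show "ray S w \<gamma>" unfolding ray_def regular_def by meson
  qed
  show ?thesis unfolding straight_on_def * by (simp add: scaleR_conv_of_real)
qed

lemma ray_cong:
  assumes "ray S w \<gamma>" "\<delta> > 0" "\<And>s. 0 \<le> s \<Longrightarrow> s < \<delta> \<Longrightarrow> \<gamma>' s = \<gamma> s"
  shows "ray S w \<gamma>'"
proof -
  obtain i z \<epsilon> where *: "\<epsilon> > 0" "\<And>s. s \<in> {0..\<epsilon>} \<Longrightarrow> regular S i (z + s *\<^sub>R w) \<and> \<gamma> s = surface_point S (i, z + s *\<^sub>R w)"
    using assms(1) unfolding ray_def by blast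
  show ?thesis unfolding ray_def
    by (rule exI[of _ i], rule exI[of _ z], rule exI[of _ "min \<epsilon> (\<delta> / 2)"]) (use * assms in auto)
qed

lemma straight_on_subset: "straight_on S v I \<gamma> \<Longrightarrow> J \<subseteq> I \<Longrightarrow> straight_on S v J \<gamma>"
  unfolding straight_on_ray by blast

lemma straight_on_cong:
  assumes "straight_on S v I \<gamma>" "open I" "\<And>t. t \<in> I \<Longrightarrow> \<gamma>' t = \<gamma> t"
  shows "straight_on S v I \<gamma>'"
  unfolding straight_on_ray
proof
  fix t assume t: "t \<in> I"
  then obtain e where e: "e > 0" "ball t e \<subseteq> I" using assms(2) openE by blast
  have eq: "\<gamma>' (t + s) = \<gamma> (t + s) \<and> \<gamma>' (t - s) = \<gamma> (t - s)" if "0 \<le> s" "s < e" for s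
    using that e(2) assms(3) by (auto simp: subset_iff dist_real_def)
  have "ray S v (\<lambda>s. \<gamma> (t + s))" "ray S (- v) (\<lambda>s. \<gamma> (t - s))"
    using assms(1) t unfolding straight_on_ray by auto
  then show "ray S v (\<lambda>s. \<gamma>' (t + s)) \<and> ray S (- v) (\<lambda>s. \<gamma>' (t - s))"
    using eq by (auto intro: ray_cong[OF _ e(1)])
qed

lemma straight_on_shift:
  assumes "straight_on S v I \<gamma>" shows "straight_on S v {t. t + c \<in> I} (\<lambda>t. \<gamma> (t + c))"
  using assms unfolding straight_on_ray by (force simp: algebra_simps)

lemma straight_on_reverse:
  assumes "straight_on S v I \<gamma>" shows "straight_on S (- v) {t. c - t \<in> I} (\<lambda>t. \<gamma> (c - t))"
  using assms unfolding straight_on_ray by (auto simp: algebra_simps)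

text \<open>The form in which germs are exploited: a property is compared just after and just before
  each time, and connectedness does the rest.\<close>

lemma locally_constant_interval:
  fixes f :: "real \<Rightarrow> 'b"
  assumes "connected I"
    and loc: "\<And>t. t \<in> I \<Longrightarrow> \<exists>\<epsilon>>0. \<forall>s. 0 < s \<and> s < \<epsilon> \<longrightarrow> (t + s \<in> I \<longrightarrow> f (t + s) = f t) \<and> (t - s \<in> I \<longrightarrow> f (t - s) = f t)"
    and "t \<in> I" "u \<in> I"
  shows "f t = f u"
proof -
  have "f constant_on I"
  proof (rule locally_constant_imp_constant[OF assms(1)])
    fix a assume a: "a \<in> I"
    obtain \<epsilon> where e: "\<epsilon> > 0" "\<And>s. 0 < s \<Longrightarrow> s < \<epsilon> \<Longrightarrow> (a + s \<in> I \<longrightarrow> f (a + s) = f a) \<and> (a - s \<in> I \<longrightarrow> f (a - s) = f a)"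
      using loc[OF a] by blast
    show "\<exists>T. openin (top_of_set I) T \<and> a \<in> T \<and> (\<forall>x\<in>T. f x = f a)"
    proof (intro exI[of _ "I \<inter> ball a \<epsilon>"] conjI ballI)
      fix x assume x: "x \<in> I \<inter> ball a \<epsilon>"
      then have d: "\<bar>x - a\<bar> < \<epsilon>" by (auto simp: dist_real_def)
      consider "x = a" | "x > a" | "x < a" by linarith
      then show "f x = f a" using e(2)[of "x - a"] e(2)[of "a - x"] x d by cases auto
    qed (use a e in \<open>auto simp: openin_open_Int\<close>)
  qed
  then show ?thesis using assms(3,4) by (auto simp: constant_on_def)
qed

section \<open>Surfaces made of pentagons, and unique continuation on them\<close>

lemma surface_point_mem: "y \<in> surface_point S x \<longleftrightarrow> surface_point S x = surface_point S y"
  using equivp_evquivclp[of "glue S"] unfolding surface_point_def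
  by (metis (mono_tags, lifting) Collect_cong equivp_def mem_Collect_eq)

lemma surface_point_refl [simp]: "x \<in> surface_point S x"
  by (simp add: surface_point_mem)

text \<open>The common shape of both surfaces. Side \<open>k\<close> of the copy \<open>i\<close> is
  the one with outward normal \<open>sg i *\<^sub>R mid r k\<close>, whatever number it inherits
  from the pentagon. With this indexing side \<open>k\<close> of \<open>i\<close> is always glued to
  side \<open>k\<close> of \<open>nb i k\<close>, and the copies on both sides have opposite
  signs.\<close>

locale pent =
  fixes S :: "'i glued_polygons" and r :: real and sg :: "'i \<Rightarrow> real" and nb :: "'i \<Rightarrow> nat \<Rightarrow> 'i"
  assumes r0: "r \<noteq> 0"
    and sg: "i \<in> labels S \<Longrightarrow> sg i = 1 \<or> sg i = -1"
    and poly: "i \<in> labels S \<Longrightarrow> polygon S i = (\<lambda>z. sg i *\<^sub>R z) ` pentagon r"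
    and nb_labels: "i \<in> labels S \<Longrightarrow> k < 5 \<Longrightarrow> nb i k \<in> labels S"
    and nb_sg: "i \<in> labels S \<Longrightarrow> k < 5 \<Longrightarrow> sg (nb i k) = - sg i"
    and nb_nb: "i \<in> labels S \<Longrightarrow> k < 5 \<Longrightarrow> nb (nb i k) k = i"
    and adj: "symclp (glue S) x y \<longleftrightarrow> fst x \<in> labels S \<and> snd x \<in> polygon S (fst x) \<and>
      (\<exists>k<5. sg (fst x) * (mid r k \<bullet> snd x) = apo r \<and>
         y = (nb (fst x) k, snd x - (2 * sg (fst x)) *\<^sub>R mid r k))"
begin

abbreviation cls :: "'i \<Rightarrow> complex \<Rightarrow> ('i \<times> complex) set" where
  "cls i z \<equiv> surface_point S (i, z)"

definition tight :: "'i \<Rightarrow> nat \<Rightarrow> complex \<Rightarrow> bool" where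
  "tight i k z \<longleftrightarrow> sg i * (mid r k \<bullet> z) = apo r"

definition opp :: "'i \<Rightarrow> nat \<Rightarrow> complex \<Rightarrow> complex" where
  "opp i k z = z - (2 * sg i) *\<^sub>R mid r k"

lemma sg_sq: "i \<in> labels S \<Longrightarrow> sg i * sg i = 1"
  using sg[of i] by auto

lemma mem_polygon_pentagon: "i \<in> labels S \<Longrightarrow> z \<in> polygon S i \<longleftrightarrow> sg i *\<^sub>R z \<in> pentagon r"
proof -
  assume i: "i \<in> labels S"
  have "z \<in> (\<lambda>z. sg i *\<^sub>R z) ` pentagon r \<longleftrightarrow> sg i *\<^sub>R z \<in> pentagon r"
    using sg[OF i] by (elim disjE) (auto simp: image_iff intro: bexI[of _ "- z"])
  then show ?thesis by (simp add: poly i)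
qed

lemma mem_polygon: "i \<in> labels S \<Longrightarrow> z \<in> polygon S i \<longleftrightarrow> (\<forall>k<5. sg i * (mid r k \<bullet> z) \<le> apo r)"
  by (simp add: mem_polygon_pentagon pentagon_halfplanes[OF r0])

lemma extreme_polygon:
  assumes "i \<in> labels S"
  shows "z extreme_point_of polygon S i \<longleftrightarrow> sg i *\<^sub>R z extreme_point_of pentagon r"
proof -
  have "linear (\<lambda>z::complex. sg i *\<^sub>R z)" by (rule linear_scaleR)
  moreover have "inj (\<lambda>z::complex. sg i *\<^sub>R z)" using sg[OF assms] by (auto simp: inj_def)
  ultimately have "((\<lambda>z. sg i *\<^sub>R z) ` {sg i *\<^sub>R z} face_of (\<lambda>z. sg i *\<^sub>R z) ` pentagon r) = ({sg i *\<^sub>R z} face_of pentagon r)"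
    by (rule face_of_linear_image)
  then show ?thesis using sg_sq[OF assms] by (simp add: face_of_singleton poly[OF assms])
qed

text \<open>A point of a copy is a vertex exactly if two of its side inequalities are tight. From
  here on extreme points are replaced by linear conditions.\<close>

lemma regular_iff: "regular S i z \<longleftrightarrow> i \<in> labels S \<and> z \<in> polygon S i \<and>
    (\<forall>k<5. \<forall>l<5. tight i k z \<and> tight i l z \<longrightarrow> k = l)"
proof (cases "i \<in> labels S \<and> z \<in> polygon S i")
  case True
  have "z extreme_point_of polygon S i \<longleftrightarrow> (\<exists>k<5. \<exists>l<5. k \<noteq> l \<and> tight i k z \<and> tight i l z)"
  proof
    assume "z extreme_point_of polygon S i"
    then have e: "sg i *\<^sub>R z extreme_point_of pentagon r" using True by (simp add: extreme_polygon)
    obtain k where "k < 5" "mid r k \<bullet> (sg i *\<^sub>R z) = apo r" using extreme_second_side[OF r0 e] by blast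
    moreover obtain l where "l < 5" "l \<noteq> k" "mid r l \<bullet> (sg i *\<^sub>R z) = apo r" using extreme_second_side[OF r0 e] by blast
    ultimately show "\<exists>k<5. \<exists>l<5. k \<noteq> l \<and> tight i k z \<and> tight i l z" by (auto simp: tight_def)
  next
    assume "\<exists>k<5. \<exists>l<5. k \<noteq> l \<and> tight i k z \<and> tight i l z"
    then show "z extreme_point_of polygon S i" using True two_sides_extreme[OF r0, of _ _ "sg i *\<^sub>R z"]
      by (auto simp: extreme_polygon tight_def mem_polygon_pentagon)
  qed
  then show ?thesis using True unfolding regular_def by blast
qed (auto simp: regular_def)

lemma regular_label: "regular S i z \<Longrightarrow> i \<in> labels S"
  and regular_mem: "regular S i z \<Longrightarrow> z \<in> polygon S i"
  and regular_tight: "regular S i z \<Longrightarrow> k < 5 \<Longrightarrow> l < 5 \<Longrightarrow> tight i k z \<Longrightarrow> tight i l z \<Longrightarrow> k = l"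
  by (auto simp: regular_iff)

lemma mid_self: "k < 5 \<Longrightarrow> mid r k \<bullet> mid r k = apo r"
  by (rule mid_mid[OF r0])

text \<open>Up to signs, crossing side \<open>k\<close> is the point reflection in its midpoint,
  which preserves the side and exchanges its end vertices.\<close>

lemma partner:
  assumes "regular S i z" "k < 5" "tight i k z"
  shows "regular S (nb i k) (opp i k z)" "tight (nb i k) k (opp i k z)" "opp (nb i k) k (opp i k z) = z"
proof -
  have i: "i \<in> labels S" using assms by (simp add: regular_label)
  note n = nb_labels[OF i assms(2)] nb_sg[OF i assms(2)]
  show "tight (nb i k) k (opp i k z)"
    using assms(3) sg[OF i] by (auto simp: tight_def opp_def n inner_diff_right mid_self[OF assms(2)])
  show "opp (nb i k) k (opp i k z) = z" by (simp add: opp_def n)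
  define \<zeta> where "\<zeta> = sg i *\<^sub>R z"
  have p: "sg (nb i k) *\<^sub>R opp i k z = 2 *\<^sub>R mid r k - \<zeta>"
    using sg[OF i] by (auto simp: opp_def n \<zeta>_def algebra_simps)
  have z: "\<zeta> \<in> side r k" using assms by (simp add: side_tight[OF r0] \<zeta>_def mem_polygon_pentagon[symmetric] i regular_mem tight_def)
  have "2 *\<^sub>R mid r k - \<zeta> \<in> side r k" by (rule opposite_side[OF z])
  then have m: "2 *\<^sub>R mid r k - \<zeta> \<in> pentagon r" "mid r k \<bullet> (2 *\<^sub>R mid r k - \<zeta>) = apo r"
    using side_tight[OF r0 assms(2)] by auto
  have "\<not> (2 *\<^sub>R mid r k - \<zeta>) extreme_point_of pentagon r"
    using opposite_extreme[OF r0 assms(2) _ m(2)] assms(1) by (auto simp: regular_def extreme_polygon i \<zeta>_def)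
  then show "regular S (nb i k) (opp i k z)"
    using m n(1) unfolding regular_def extreme_polygon[OF n(1)] mem_polygon_pentagon[OF n(1)] p by simp
qed

text \<open>The right-hand side is closed under gluing in both directions: a regular point has at
  most one tight side, and crossing back over it returns. So the equivalence closure stops after one
  step.\<close>

lemma cls_regular:
  assumes "regular S i z"
  shows "cls i z = insert (i, z) {(nb i k, opp i k z) | k. k < 5 \<and> tight i k z}" (is "_ = ?X")
proof -
  have i: "i \<in> labels S" using assms by (simp add: regular_label)
  have closed: "y \<in> ?X" if x: "x \<in> ?X" and xy: "symclp (glue S) x y" for x y
  proof -
    from xy obtain l where l: "l < 5" "tight (fst x) l (snd x)" "y = (nb (fst x) l, opp (fst x) l (snd x))"
      unfolding adj tight_def opp_def by blast
    from x consider "x = (i, z)" | k where "x = (nb i k, opp i k z)" "k < 5" "tight i k z" by blast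
    then show ?thesis
    proof cases
      case 1 then show ?thesis using l by auto
    next
      case 2
      note p = partner[OF assms 2(2,3)]
      have "l = k" using regular_tight[OF p(1) l(1) 2(2)] l(2) p(2) 2(1) by simp
      then show ?thesis using l 2 p(3) i by (simp add: nb_nb)
    qed
  qed
  have "(i, z) \<in> ?X" by simp
  have "y \<in> ?X" if "(symclp (glue S))\<^sup>*\<^sup>* (i, z) y" for y
    using that by (induction rule: rtranclp_induct) (use closed in \<open>blast+\<close>)
  then have "cls i z \<subseteq> ?X" unfolding surface_point_def equivclp_def by blast
  moreover have "?X \<subseteq> cls i z"
  proof
    fix y assume "y \<in> ?X"
    then consider "y = (i, z)" | k where "y = (nb i k, opp i k z)" "k < 5" "tight i k z" by blast
    then show "y \<in> cls i z"
    proof cases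
      case 2
      then have "symclp (glue S) (i, z) y" unfolding adj using assms by (auto simp: tight_def opp_def regular_def)
      then show ?thesis unfolding surface_point_def equivclp_def by blast
    qed simp
  qed
  ultimately show ?thesis by blast
qed

lemma cls_eq_iff:
  assumes "regular S i z"
  shows "cls i z = cls j w \<longleftrightarrow> j = i \<and> w = z \<or> (\<exists>k<5. tight i k z \<and> j = nb i k \<and> w = opp i k z)"
proof -
  have "cls i z = cls j w \<longleftrightarrow> (j, w) \<in> cls i z" by (simp only: surface_point_mem)
  then show ?thesis unfolding cls_regular[OF assms] by auto
qed

lemma cls_partner: "regular S i z \<Longrightarrow> k < 5 \<Longrightarrow> tight i k z \<Longrightarrow> cls (nb i k) (opp i k z) = cls i z"
  using cls_eq_iff by metis

lemma regular_cong: "regular S i z \<Longrightarrow> cls i z = cls j w \<Longrightarrow> regular S j w"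
  using cls_eq_iff partner(1) by metis

lemma nb_neq: "i \<in> labels S \<Longrightarrow> k < 5 \<Longrightarrow> nb i k \<noteq> i"
  using nb_sg[of i k] sg[of i] by auto

lemma cls_same_label: "regular S i z \<Longrightarrow> cls i z = cls i w \<longleftrightarrow> w = z"
  using cls_eq_iff nb_neq regular_label by metis

lemma convex_polygon: "i \<in> labels S \<Longrightarrow> convex (polygon S i)"
  by (simp add: poly convex_scaling convex_pentagon)

text \<open>The local core of unique continuation: whether a germ coincides with a segment shortly
  after time 0 is decided at time 0, even if the two are written in different copies.\<close>

lemma ray_segment:
  assumes "ray S w \<gamma>" "i \<in> labels S"
  shows "\<exists>\<epsilon>>0. \<forall>s. 0 < s \<and> s < \<epsilon> \<and> z \<in> polygon S i \<and> z + s *\<^sub>R w \<in> polygon S i \<longrightarrow>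
    (\<gamma> s = cls i (z + s *\<^sub>R w) \<longleftrightarrow> \<gamma> 0 = cls i z)"
proof -
  obtain j y \<epsilon> where e: "\<epsilon> > 0" and reg: "\<And>s. s \<in> {0..\<epsilon>} \<Longrightarrow> regular S j (y + s *\<^sub>R w)"
    and g: "\<And>s. s \<in> {0..\<epsilon>} \<Longrightarrow> \<gamma> s = cls j (y + s *\<^sub>R w)"
    using assms(1) unfolding ray_def by blast
  have reg0: "regular S j y" and g0: "\<gamma> 0 = cls j y" using reg[of 0] g[of 0] e by auto
  have j: "j \<in> labels S" using reg0 by (simp add: regular_label)
  show ?thesis
  proof (cases "\<gamma> 0 = cls i z")
    case True
    have "\<gamma> s = cls i (z + s *\<^sub>R w)" if s: "0 < s" "s < \<epsilon>" "z + s *\<^sub>R w \<in> polygon S i" for s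
    proof -
      have rs: "regular S j (y + s *\<^sub>R w)" "\<gamma> s = cls j (y + s *\<^sub>R w)" using reg g s by auto
      from True g0 consider "i = j" "z = y" | k where "k < 5" "tight j k y" "i = nb j k" "z = opp j k y"
        using cls_eq_iff[OF reg0] by metis
      then show ?thesis
      proof cases
        \<comment> \<open>The germ and the segment stay in two copies that lie on opposite sides of
          the common side, so both can only run along it.\<close>
        case 2
        have "sg j * (mid r k \<bullet> (y + s *\<^sub>R w)) \<le> apo r"
          using regular_mem[OF rs(1)] 2(1) by (simp add: mem_polygon j)
        moreover have "sg i * (mid r k \<bullet> (z + s *\<^sub>R w)) \<le> apo r"
          using s(3) 2(1) by (simp add: mem_polygon assms(2))
        moreover have "sg i = - sg j" using 2 j by (simp add: nb_sg)
        moreover have "mid r k \<bullet> z = mid r k \<bullet> y - 2 * sg j * apo r" "sg j * (mid r k \<bullet> y) = apo r"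
          using 2 by (simp_all add: opp_def tight_def inner_diff_right mid_self)
        moreover define c where "c = mid r k \<bullet> (s *\<^sub>R w)"
        ultimately have "c = 0"
          using sg[OF j] by (elim disjE) (simp_all add: inner_add_right del: inner_scaleR_right)
        then have "tight j k (y + s *\<^sub>R w)" using 2 unfolding c_def by (auto simp: tight_def algebra_simps)
        moreover have "opp j k (y + s *\<^sub>R w) = z + s *\<^sub>R w" using 2 by (simp add: opp_def)
        ultimately show ?thesis using cls_partner[OF rs(1) 2(1)] rs(2) 2 by simp
      qed (use rs in auto)
    qed
    then show ?thesis using e True by blast
  next
    case False
    \<comment> \<open>Coincidences at two different times \<open>s'\<close> and \<open>s\<close>
      come from the same translation, hence from the same side. The path is then parallel to this
      side and starts on it, so it coincides at time 0 as well.\<close>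
    have "\<exists>\<delta>>0. \<forall>s. 0 < s \<and> s < \<delta> \<longrightarrow> \<gamma> s \<noteq> cls i (z + s *\<^sub>R w)"
    proof (rule ccontr)
      assume "\<not> ?thesis"
      then have ex: "\<exists>s. 0 < s \<and> s < \<delta> \<and> \<gamma> s = cls i (z + s *\<^sub>R w)" if "\<delta> > 0" for \<delta> using that by blast
      have key: "\<exists>k<5. tight j k (y + s *\<^sub>R w) \<and> i = nb j k \<and> z = opp j k y"
        if s: "0 < s" "s < \<epsilon>" "\<gamma> s = cls i (z + s *\<^sub>R w)" for s
      proof -
        have rs: "regular S j (y + s *\<^sub>R w)" "\<gamma> s = cls j (y + s *\<^sub>R w)" using reg g s by auto
        have "\<not> (i = j \<and> z + s *\<^sub>R w = y + s *\<^sub>R w)" using False g0 by auto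
        then obtain k where "k < 5" "tight j k (y + s *\<^sub>R w)" "i = nb j k" "z + s *\<^sub>R w = opp j k (y + s *\<^sub>R w)"
          using cls_eq_iff[OF rs(1)] rs(2) s(3) by metis
        then show ?thesis by (auto simp: opp_def algebra_simps)
      qed
      obtain s where s: "0 < s" "s < \<epsilon>" "\<gamma> s = cls i (z + s *\<^sub>R w)" using ex[OF e] by blast
      obtain s' where s': "0 < s'" "s' < s" "\<gamma> s' = cls i (z + s' *\<^sub>R w)" using ex[OF s(1)] by blast
      obtain k where k: "k < 5" "tight j k (y + s *\<^sub>R w)" "i = nb j k" "z = opp j k y" using key[OF s] by blast
      have "s' < \<epsilon>" using s s' by simp
      then obtain k' where k': "k' < 5" "tight j k' (y + s' *\<^sub>R w)" "z = opp j k' y" using key[of s'] s' by blast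
      have "mid r k = mid r k'" using k k' sg[OF j] by (auto simp: opp_def)
      then have "k = k'" using mid_inj[OF r0] k k' by blast
      then have "sg j * (mid r k \<bullet> y) + s * (sg j * (mid r k \<bullet> w)) = apo r"
        "sg j * (mid r k \<bullet> y) + s' * (sg j * (mid r k \<bullet> w)) = apo r"
        using k(2) k'(2) by (simp_all add: tight_def algebra_simps)
      then have "(s - s') * (sg j * (mid r k \<bullet> w)) = 0" by (simp only: left_diff_distrib)
      then have "sg j * (mid r k \<bullet> w) = 0" using s' by simp
      then have "tight j k y" using k(2) by (auto simp: tight_def algebra_simps inner_add_right)
      then have "cls i z = cls j y" using cls_partner[OF reg0 k(1)] k by simp
      then show False using False g0 by simp
    qed
    then show ?thesis using False by blast
  qed
qed

lemma unique_continuation: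
  assumes "straight_on S v I \<gamma>" "straight_on S v I \<gamma>'" "connected I" "t \<in> I" "u \<in> I" "\<gamma> t = \<gamma>' t"
  shows "\<gamma> u = \<gamma>' u"
proof -
  have one: "\<exists>\<epsilon>>0. \<forall>s. 0 < s \<and> s < \<epsilon> \<longrightarrow> (\<gamma>1 s = \<gamma>2 s) = (\<gamma>1 0 = \<gamma>2 0)" if rr: "ray S w \<gamma>1" "ray S w \<gamma>2" for w \<gamma>1 \<gamma>2
  proof -
    obtain i z \<epsilon> where e: "\<epsilon> > 0" "\<And>s. s \<in> {0..\<epsilon>} \<Longrightarrow> regular S i (z + s *\<^sub>R w) \<and> \<gamma>2 s = cls i (z + s *\<^sub>R w)"
      using rr(2) unfolding ray_def by blast
    have i: "i \<in> labels S" "z \<in> polygon S i" "\<gamma>2 0 = cls i z" using e(2)[of 0] e(1) by (auto simp: regular_def)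
    obtain \<delta> where d: "\<delta> > 0" "\<And>s. 0 < s \<Longrightarrow> s < \<delta> \<Longrightarrow> z + s *\<^sub>R w \<in> polygon S i \<Longrightarrow> (\<gamma>1 s = cls i (z + s *\<^sub>R w) \<longleftrightarrow> \<gamma>1 0 = cls i z)"
      using ray_segment[OF rr(1) i(1), of z] i(2) by blast
    have "(\<gamma>1 s = \<gamma>2 s) = (\<gamma>1 0 = \<gamma>2 0)" if s: "0 < s" "s < min \<delta> \<epsilon>" for s
    proof -
      have "regular S i (z + s *\<^sub>R w) \<and> \<gamma>2 s = cls i (z + s *\<^sub>R w)" using e(2)[of s] s by simp
      then show ?thesis using d(2)[of s] s i(3) by (simp add: regular_mem)
    qed
    then show ?thesis using d(1) e(1) by (intro exI[of _ "min \<delta> \<epsilon>"]) simp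
  qed
  have "(\<gamma> t = \<gamma>' t) = (\<gamma> u = \<gamma>' u)"
  proof (rule locally_constant_interval[OF assms(3) _ assms(4,5)])
    fix t assume "t \<in> I"
    then have r: "ray S v (\<lambda>s. \<gamma> (t + s))" "ray S (- v) (\<lambda>s. \<gamma> (t - s))" "ray S v (\<lambda>s. \<gamma>' (t + s))" "ray S (- v) (\<lambda>s. \<gamma>' (t - s))"
      using assms(1,2) unfolding straight_on_ray by auto
    obtain \<epsilon>1 where "\<epsilon>1 > 0" "\<forall>s. 0 < s \<and> s < \<epsilon>1 \<longrightarrow> (\<gamma> (t + s) = \<gamma>' (t + s)) = (\<gamma> t = \<gamma>' t)" using one[OF r(1,3)] by auto
    moreover obtain \<epsilon>2 where "\<epsilon>2 > 0" "\<forall>s. 0 < s \<and> s < \<epsilon>2 \<longrightarrow> (\<gamma> (t - s) = \<gamma>' (t - s)) = (\<gamma> t = \<gamma>' t)" using one[OF r(2,4)] by auto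
    ultimately show "\<exists>\<epsilon>>0. \<forall>s. 0 < s \<and> s < \<epsilon> \<longrightarrow> (t + s \<in> I \<longrightarrow> (\<gamma> (t + s) = \<gamma>' (t + s)) = (\<gamma> t = \<gamma>' t)) \<and>
       (t - s \<in> I \<longrightarrow> (\<gamma> (t - s) = \<gamma>' (t - s)) = (\<gamma> t = \<gamma>' t))"
      by (intro exI[of _ "min \<epsilon>1 \<epsilon>2"]) auto
  qed
  then show ?thesis using assms(6) by simp
qed

lemma straight_on_regular:
  assumes "straight_on S v I \<gamma>" "t \<in> I"
  obtains i z where "regular S i z" "\<gamma> t = cls i z"
proof -
  have "ray S v (\<lambda>s. \<gamma> (t + s))" using assms unfolding straight_on_ray by blast
  then obtain i z \<epsilon> where "\<epsilon> > 0" "\<forall>s\<in>{0..\<epsilon>}. regular S i (z + s *\<^sub>R v) \<and> \<gamma> (t + s) = cls i (z + s *\<^sub>R v)"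
    unfolding ray_def by blast
  then have "regular S i z \<and> \<gamma> t = cls i z" by (auto dest: bspec[of _ _ 0])
  then show ?thesis using that by blast
qed

text \<open>The parameters of the chord form the convex set \<open>J\<close>, and following the
  chord is a locally constant property on it by \<open>ray_segment\<close>.\<close>

lemma chord:
  assumes "straight_on S v UNIV \<gamma>" "\<gamma> t = cls i z" "i \<in> labels S" "z \<in> polygon S i" "z + \<tau> *\<^sub>R v \<in> polygon S i"
  shows "\<gamma> (t + \<tau>) = cls i (z + \<tau> *\<^sub>R v)"
proof -
  define J where "J = {s. z + s *\<^sub>R v \<in> polygon S i}"
  have "convex J" unfolding convex_alt
  proof (intro ballI allI impI)
    fix a b u :: real assume ab: "a \<in> J" "b \<in> J" "0 \<le> u \<and> u \<le> 1"
    have "(1 - u) *\<^sub>R (z + a *\<^sub>R v) + u *\<^sub>R (z + b *\<^sub>R v) \<in> polygon S i"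
      using ab convexD_alt[OF convex_polygon[OF assms(3)]] unfolding J_def by blast
    then show "(1 - u) *\<^sub>R a + u *\<^sub>R b \<in> J" by (simp add: J_def algebra_simps)
  qed
  then have J: "connected J" by (rule convex_connected)
  have "(\<gamma> (t + 0) = cls i (z + 0 *\<^sub>R v)) = (\<gamma> (t + \<tau>) = cls i (z + \<tau> *\<^sub>R v))"
  proof (rule locally_constant_interval[OF J])
    fix s assume s: "s \<in> J"
    have r: "ray S v (\<lambda>h. \<gamma> ((t + s) + h))" "ray S (- v) (\<lambda>h. \<gamma> ((t + s) - h))"
      using assms(1) unfolding straight_on_ray by auto
    obtain \<epsilon>1 where "\<epsilon>1 > 0" "\<forall>h. 0 < h \<and> h < \<epsilon>1 \<and> z + s *\<^sub>R v \<in> polygon S i \<and> z + s *\<^sub>R v + h *\<^sub>R v \<in> polygon S i \<longrightarrow>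
       (\<gamma> (t + s + h) = cls i (z + s *\<^sub>R v + h *\<^sub>R v)) = (\<gamma> (t + s) = cls i (z + s *\<^sub>R v))"
      using ray_segment[OF r(1) assms(3), of "z + s *\<^sub>R v"] by auto
    moreover obtain \<epsilon>2 where "\<epsilon>2 > 0" "\<forall>h. 0 < h \<and> h < \<epsilon>2 \<and> z + s *\<^sub>R v \<in> polygon S i \<and> z + s *\<^sub>R v + h *\<^sub>R (- v) \<in> polygon S i \<longrightarrow>
       (\<gamma> (t + s - h) = cls i (z + s *\<^sub>R v + h *\<^sub>R (- v))) = (\<gamma> (t + s) = cls i (z + s *\<^sub>R v))"
      using ray_segment[OF r(2) assms(3), of "z + s *\<^sub>R v"] by auto
    ultimately show "\<exists>\<epsilon>>0. \<forall>h. 0 < h \<and> h < \<epsilon> \<longrightarrow>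
        (s + h \<in> J \<longrightarrow> (\<gamma> (t + (s + h)) = cls i (z + (s + h) *\<^sub>R v)) = (\<gamma> (t + s) = cls i (z + s *\<^sub>R v))) \<and>
        (s - h \<in> J \<longrightarrow> (\<gamma> (t + (s - h)) = cls i (z + (s - h) *\<^sub>R v)) = (\<gamma> (t + s) = cls i (z + s *\<^sub>R v)))"
      using s by (intro exI[of _ "min \<epsilon>1 \<epsilon>2"]) (auto simp: J_def algebra_simps)
  qed (use assms in \<open>auto simp: J_def\<close>)
  then show ?thesis using assms(2) by simp
qed

text \<open>Trajectories pass only through regular points, so no chord that they follow contains a
  vertex. This keeps the heights of vertices out of the finite sets of chord heights.\<close>

lemma chord_regular:
  assumes "straight_on S v UNIV \<gamma>" "\<gamma> t = cls i z" "i \<in> labels S" "z \<in> polygon S i" "z + \<tau> *\<^sub>R v \<in> polygon S i"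
  shows "regular S i (z + \<tau> *\<^sub>R v)"
  using chord[OF assms] straight_on_regular[OF assms(1), of "t + \<tau>"] regular_cong by (metis UNIV_I)

end

section \<open>Heights, periods and charts\<close>

lemma orthonormal_expansion:
  fixes v d :: complex
  assumes "norm v = 1"
  shows "d = (d \<bullet> v) *\<^sub>R v + (d \<bullet> (\<i> * v)) *\<^sub>R (\<i> * v)"
proof -
  have n: "(Re v)\<^sup>2 + (Im v)\<^sup>2 = 1" using assms by (simp add: cmod_def)
  show ?thesis unfolding complex_eq_iff inner_complex_def by (simp, use n in algebra)
qed

lemma same_height:
  fixes v z w :: complex
  assumes "norm v = 1" "z \<bullet> (\<i> * v) = w \<bullet> (\<i> * v)"
  obtains \<tau> where "w = z + \<tau> *\<^sub>R v"
proof
  show "w = z + ((w - z) \<bullet> v) *\<^sub>R v"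
    using orthonormal_expansion[OF assms(1), of "w - z"] assms(2) by (simp add: inner_diff_left algebra_simps)
qed

lemma inner_i_self [simp]: "v \<bullet> (\<i> * v) = 0" "(\<i> * v) \<bullet> v = 0" for v :: complex
  by (simp_all add: inner_complex_def)

lemma periodic_int:
  fixes f :: "real \<Rightarrow> 'b"
  assumes "\<And>t. f (t + T) = f t"
  shows "f (t + of_int n * T) = f t"
proof -
  have nat: "f (t + of_nat m * T) = f t" for m t
  proof (induction m)
    case (Suc m)
    have "f (t + of_nat (Suc m) * T) = f ((t + of_nat m * T) + T)" by (simp add: algebra_simps)
    then show ?case using assms Suc by simp
  qed simp
  show ?thesis
  proof (cases "n \<ge> 0")
    case True then show ?thesis using nat[of t "nat n"] by simp
  next
    case False then show ?thesis using nat[of "t + of_int n * T" "nat (- n)"] by simp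
  qed
qed

lemma periodic_reduce:
  fixes f :: "real \<Rightarrow> 'b"
  assumes "\<And>t. f (t + T) = f t" "T > 0"
  obtains u where "0 \<le> u" "u < T" "f u = f t"
proof
  define n where "n = \<lfloor>t / T\<rfloor>"
  have "of_int n \<le> t / T" "t / T < of_int n + 1" by (auto simp: n_def)
  then show "0 \<le> t + of_int (- n) * T" "t + of_int (- n) * T < T" using assms(2) by (auto simp: field_simps)
  show "f (t + of_int (- n) * T) = f t" by (rule periodic_int[of f, OF assms(1)])
qed

lemma open_ray:
  fixes U :: "complex set"
  assumes "open U" "z \<in> U"
  shows "\<exists>\<epsilon>>0. \<forall>s\<in>{0..\<epsilon>}. z + s *\<^sub>R w \<in> U"
proof -
  obtain e where e: "e > 0" "ball z e \<subseteq> U" using assms openE by blast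
  define \<epsilon> where "\<epsilon> = e / (2 * (norm w + 1))"
  have p: "norm w + 1 > 0" by (simp add: add_nonneg_pos)
  have "z + s *\<^sub>R w \<in> U" if "s \<in> {0..\<epsilon>}" for s
  proof -
    have "\<bar>s\<bar> * norm w \<le> \<epsilon> * (norm w + 1)" using that by (intro mult_mono) auto
    also have "\<dots> = e / 2" using p by (simp add: \<epsilon>_def field_simps)
    finally have "norm (s *\<^sub>R w) < e" using e by simp
    then show ?thesis using e(2) by (auto simp: dist_norm)
  qed
  moreover have "\<epsilon> > 0" using e p by (simp add: \<epsilon>_def)
  ultimately show ?thesis by blast
qed

text \<open>Weaker than a homeomorphism: only straight germs, in every direction and from every
  point of the disc, have to be preserved.\<close>

definition chart :: "'i glued_polygons \<Rightarrow> real \<Rightarrow> (complex \<Rightarrow> ('i \<times> complex) set) \<Rightarrow> bool" where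
  "chart S \<rho> \<Psi> \<longleftrightarrow> (\<forall>u w. norm u < \<rho> \<longrightarrow> ray S w (\<lambda>s. \<Psi> (u + s *\<^sub>R w)))"

lemma chart_straight:
  assumes "chart S \<rho> \<Psi>" "\<And>t. t \<in> I \<Longrightarrow> norm (u + t *\<^sub>R w) < \<rho>"
  shows "straight_on S w I (\<lambda>t. \<Psi> (u + t *\<^sub>R w))"
  unfolding straight_on_ray
proof
  fix t assume t: "t \<in> I"
  have "ray S w' (\<lambda>s. \<Psi> (u + t *\<^sub>R w + s *\<^sub>R w'))" for w'
    using assms t unfolding chart_def by blast
  from this[of w] this[of "- w"]
  show "ray S w (\<lambda>s. \<Psi> (u + (t + s) *\<^sub>R w)) \<and> ray S (- w) (\<lambda>s. \<Psi> (u + (t - s) *\<^sub>R w))"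
    by (simp add: algebra_simps)
qed

context pent
begin

text \<open>A single germ shows at most six heights in copy \<open>i\<close>: its own and those of
  its translates across the five sides. Bisection over one period leaves finitely many
  germs.\<close>

lemma finite_heights:
  assumes "straight_on S v UNIV \<gamma>" "T > 0" "\<And>t. \<gamma> (t + T) = \<gamma> t" "v \<bullet> w = 0"
  shows "finite {z \<bullet> w | z. cls i z \<in> range \<gamma>}"
proof -
  define H where "H a b = {z \<bullet> w | z. \<exists>t\<ge>a. t \<le> b \<and> cls i z = \<gamma> t}" for a b
  have one: "\<exists>\<epsilon>>0. finite {z \<bullet> w | z. \<exists>s\<ge>0. s \<le> \<epsilon> \<and> cls i z = \<gamma>' s}" if rr: "ray S v' \<gamma>'" "v' \<bullet> w = 0" for v' \<gamma>'
  proof -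
    obtain j y \<epsilon> where e: "\<epsilon> > 0" "\<And>s. s \<in> {0..\<epsilon>} \<Longrightarrow> regular S j (y + s *\<^sub>R v') \<and> \<gamma>' s = cls j (y + s *\<^sub>R v')"
      using rr(1) unfolding ray_def by blast
    have "z \<bullet> w \<in> insert (y \<bullet> w) ((\<lambda>k. opp j k y \<bullet> w) ` {..<5})" if z: "0 \<le> s" "s \<le> \<epsilon>" "cls i z = \<gamma>' s" for z s
    proof -
      have "regular S j (y + s *\<^sub>R v')" "cls j (y + s *\<^sub>R v') = cls i z" using e(2)[of s] z by auto
      then have "z = y + s *\<^sub>R v' \<or> (\<exists>k<5. z = opp j k (y + s *\<^sub>R v'))" using cls_eq_iff by blast
      then show ?thesis using rr(2) by (auto simp: opp_def inner_add_left inner_diff_left)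
    qed
    then have "{z \<bullet> w | z. \<exists>s\<ge>0. s \<le> \<epsilon> \<and> cls i z = \<gamma>' s} \<subseteq> insert (y \<bullet> w) ((\<lambda>k. opp j k y \<bullet> w) ` {..<5})" by blast
    moreover have "finite (insert (y \<bullet> w) ((\<lambda>k. opp j k y \<bullet> w) ` {..<5}))" by simp
    ultimately show ?thesis using e(1) finite_subset by blast
  qed
  have "finite (H 0 T)"
  proof (rule Bolzano[where P = "\<lambda>a b. finite (H a b)"])
    show "0 \<le> T" using assms by simp
    fix a b c assume "finite (H a b)" "finite (H b c)"
    moreover have "H a c \<subseteq> H a b \<union> H b c" unfolding H_def by (auto; metis linear)
    ultimately show "finite (H a c)" using finite_subset by blast
  next
    fix x
    have r: "ray S v (\<lambda>s. \<gamma> (x + s))" "ray S (- v) (\<lambda>s. \<gamma> (x - s))"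
      using assms(1) unfolding straight_on_ray by auto
    obtain \<epsilon>1 where e1: "\<epsilon>1 > 0" "finite {z \<bullet> w | z. \<exists>s\<ge>0. s \<le> \<epsilon>1 \<and> cls i z = \<gamma> (x + s)}" (is "finite ?A")
      using one[OF r(1) assms(4)] by blast
    obtain \<epsilon>2 where e2: "\<epsilon>2 > 0" "finite {z \<bullet> w | z. \<exists>s\<ge>0. s \<le> \<epsilon>2 \<and> cls i z = \<gamma> (x - s)}" (is "finite ?B")
      using one[OF r(2)] assms(4) by auto
    have "H a b \<subseteq> ?A \<union> ?B" if ab: "a \<le> x \<and> x \<le> b \<and> b - a < min \<epsilon>1 \<epsilon>2" for a b
    proof
      fix h assume "h \<in> H a b"
      then obtain z t where z: "h = z \<bullet> w" "a \<le> t" "t \<le> b" "cls i z = \<gamma> t" by (auto simp: H_def)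
      show "h \<in> ?A \<union> ?B"
      proof (cases "t \<ge> x")
        case True
        then have "\<exists>s\<ge>0. s \<le> \<epsilon>1 \<and> cls i z = \<gamma> (x + s)" using z ab by (intro exI[of _ "t - x"]) simp
        then have "h \<in> ?A" using z(1) by blast
        then show ?thesis ..
      next
        case False
        then have "\<exists>s\<ge>0. s \<le> \<epsilon>2 \<and> cls i z = \<gamma> (x - s)" using z ab by (intro exI[of _ "x - t"]) simp
        then have "h \<in> ?B" using z(1) by blast
        then show ?thesis ..
      qed
    qed
    then show "\<exists>d>0. \<forall>a b. a \<le> x \<and> x \<le> b \<and> b - a < d \<longrightarrow> finite (H a b)"
      using e1 e2 by (intro exI[of _ "min \<epsilon>1 \<epsilon>2"]) (auto intro: finite_subset)
  qed
  moreover have "{z \<bullet> w | z. cls i z \<in> range \<gamma>} \<subseteq> H 0 T"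
  proof
    fix h assume "h \<in> {z \<bullet> w | z. cls i z \<in> range \<gamma>}"
    then obtain z t where z: "h = z \<bullet> w" "cls i z = \<gamma> t" by blast
    obtain u where "0 \<le> u" "u < T" "\<gamma> u = \<gamma> t" using periodic_reduce[of \<gamma> T t] assms by blast
    then have "\<exists>t\<ge>0. t \<le> T \<and> cls i z = \<gamma> t" using z by (intro exI[of _ u]) simp
    then show "h \<in> H 0 T" using z(1) unfolding H_def by blast
  qed
  ultimately show ?thesis using finite_subset by blast
qed

text \<open>\<open>K\<close> is the pentagon without discs about its vertices. It is covered by the
  open pentagon \<open>W0\<close> and by the sets \<open>W k\<close>, where a point and its
  reflection in the midpoint of side \<open>k\<close> strictly satisfy the other four inequalities,
  so that a chart can only cross side \<open>k\<close>. The radius is a Lebesgue number of this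
  cover.\<close>

lemma uniform_charts:
  assumes "\<delta> > 0"
  shows "\<exists>\<rho>>0. \<forall>i\<in>labels S. \<forall>z\<in>polygon S i. (\<forall>k. dist (sg i *\<^sub>R z) (vertex r k) \<ge> \<delta>) \<longrightarrow>
    (\<exists>\<Psi>. chart S \<rho> \<Psi> \<and> \<Psi> 0 = cls i z)"
proof -
  define K where "K = {z \<in> pentagon r. \<forall>k<5. dist z (vertex r k) \<ge> \<delta>}"
  define W where "W k = {z. \<forall>j<5. j \<noteq> k \<longrightarrow> mid r j \<bullet> z < apo r \<and> mid r j \<bullet> (2 *\<^sub>R mid r k - z) < apo r}" for k
  define W0 where "W0 = {z. \<forall>j<5. mid r j \<bullet> z < apo r}"
  have K: "compact K"
  proof -
    have "K = pentagon r \<inter> (\<Inter>k\<in>{..<5}. - ball (vertex r k) \<delta>)" by (auto simp: K_def dist_commute not_less)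
    moreover have "closed (\<Inter>k\<in>{..<5}. - ball (vertex r k) \<delta>)" by (intro closed_INT ballI) auto
    ultimately show ?thesis using compact_pentagon compact_Int_closed by metis
  qed
  have W0: "open W0"
  proof -
    have "W0 = (\<Inter>j\<in>{..<5}. {z. mid r j \<bullet> z < apo r})" by (auto simp: W0_def)
    moreover have "open (\<Inter>j\<in>{..<5}. {z. mid r j \<bullet> z < apo r})"
      by (intro open_INT ballI open_halfspace_lt) auto
    ultimately show ?thesis by (simp only:)
  qed
  have W: "open (W k)" for k
  proof -
    have "W k = (\<Inter>j\<in>{..<5} - {k}. {z. mid r j \<bullet> z < apo r} \<inter> {z. mid r j \<bullet> z > mid r j \<bullet> (2 *\<^sub>R mid r k) - apo r})"
      by (auto simp: W_def inner_diff_right algebra_simps)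
    moreover have "open (\<Inter>j\<in>{..<5} - {k}. {z. mid r j \<bullet> z < apo r} \<inter> {z. mid r j \<bullet> z > mid r j \<bullet> (2 *\<^sub>R mid r k) - apo r})"
      by (intro open_INT ballI open_Int open_halfspace_lt open_halfspace_gt) auto
    ultimately show ?thesis by (simp only:)
  qed
  have cover: "K \<subseteq> \<Union>(insert W0 (W ` {..<5}))"
  proof
    fix z assume z: "z \<in> K"
    have le: "mid r j \<bullet> z \<le> apo r" if "j < 5" for j using z that by (auto simp: K_def pentagon_halfplanes[OF r0])
    have zp: "z \<in> pentagon r" and ne: "\<not> z extreme_point_of pentagon r" using z assms by (auto simp: K_def extreme_vertex)
    show "z \<in> \<Union>(insert W0 (W ` {..<5}))"
    proof (cases "\<exists>k<5. mid r k \<bullet> z = apo r")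
      case False
      then have "z \<in> W0" using le unfolding W0_def by (auto simp: less_le)
      then show ?thesis by blast
    next
      case True
      then obtain k where k: "k < 5" "mid r k \<bullet> z = apo r" by blast
      have 1: "mid r j \<bullet> z < apo r" if "j < 5" "j \<noteq> k" for j
        using two_sides_extreme[OF r0 k(1) that(1) _ zp k(2)] le[OF that(1)] that ne by fastforce
      have m2: "mid r k \<bullet> (2 *\<^sub>R mid r k - z) = apo r" by (simp add: inner_diff_right k mid_self)
      have "z \<in> side r k" using zp k by (simp add: side_tight[OF r0])
      then have p2: "2 *\<^sub>R mid r k - z \<in> pentagon r" using opposite_side side_tight[OF r0 k(1)] by blast
      have ne2: "\<not> (2 *\<^sub>R mid r k - z) extreme_point_of pentagon r"
        using opposite_extreme[OF r0 k(1) _ m2] ne by auto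
      have 2: "mid r j \<bullet> (2 *\<^sub>R mid r k - z) < apo r" if "j < 5" "j \<noteq> k" for j
        using two_sides_extreme[OF r0 k(1) that(1) _ p2 m2] p2 that ne2 by (fastforce simp: pentagon_halfplanes[OF r0])
      have "z \<in> W k" unfolding W_def using 1 2 by blast
      then show ?thesis using k(1) by blast
    qed
  qed
  obtain \<rho> where rho: "\<rho> > 0" "\<And>z. z \<in> K \<Longrightarrow> \<exists>G \<in> insert W0 (W ` {..<5}). ball z \<rho> \<subseteq> G"
    using Heine_Borel_lemma[OF K cover] W0 W by (metis (no_types, lifting) imageE insertE)
  show ?thesis
  proof (intro exI[of _ \<rho>] conjI ballI impI)
    fix i z assume i: "i \<in> labels S" and z: "z \<in> polygon S i" "\<forall>k. dist (sg i *\<^sub>R z) (vertex r k) \<ge> \<delta>"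
    have "sg i *\<^sub>R z \<in> K" using z i by (auto simp: K_def mem_polygon_pentagon)
    then obtain G where G: "G \<in> insert W0 (W ` {..<5})" "ball (sg i *\<^sub>R z) \<rho> \<subseteq> G" using rho by blast
    have mem: "sg i *\<^sub>R (z + u) \<in> G" if "norm u < \<rho>" for u
    proof -
      have "sg i *\<^sub>R (z + u) \<in> ball (sg i *\<^sub>R z) \<rho>" using that sg[OF i] by (auto simp: dist_norm algebra_simps)
      then show ?thesis using G by blast
    qed
    have opG: "open G" using G W0 W by auto
    have step: "\<exists>\<epsilon>>0. \<forall>s\<in>{0..\<epsilon>}. sg i *\<^sub>R (z + u + s *\<^sub>R w) \<in> G" if "norm u < \<rho>" for u w
      using open_ray[OF opG mem[OF that], of "sg i *\<^sub>R w"] by (simp add: algebra_simps)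
    show "\<exists>\<Psi>. chart S \<rho> \<Psi> \<and> \<Psi> 0 = cls i z"
    proof (cases "G = W0")
      case True
      have reg: "regular S i y" if "sg i *\<^sub>R y \<in> W0" for y
        using that i unfolding regular_iff by (auto simp: W0_def mem_polygon tight_def less_le)
      have "chart S \<rho> (\<lambda>u. cls i (z + u))" unfolding chart_def ray_def
      proof (intro allI impI)
        fix u w :: complex assume u: "norm u < \<rho>"
        obtain \<epsilon> where e: "\<epsilon> > 0" "\<forall>s\<in>{0..\<epsilon>}. sg i *\<^sub>R (z + u + s *\<^sub>R w) \<in> G" using step[OF u] by blast
        show "\<exists>i' z'. \<exists>\<epsilon>>0. \<forall>s\<in>{0..\<epsilon>}. regular S i' (z' + s *\<^sub>R w) \<and> cls i (z + (u + s *\<^sub>R w)) = cls i' (z' + s *\<^sub>R w)"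
          using e True by (intro exI[of _ i] exI[of _ "z + u"] exI[of _ \<epsilon>]) (auto intro: reg simp: add.assoc)
      qed
      then show ?thesis by (intro exI[of _ "\<lambda>u. cls i (z + u)"]) simp
    next
      case False
      then obtain k where k: "k < 5" "G = W k" using G by blast
      note n = nb_labels[OF i k(1)] nb_sg[OF i k(1)]
      \<comment> \<open>The chart across side \<open>k\<close> uses the copy itself up to the side
        and its neighbour beyond; on the side the two agree by \<open>cls_partner\<close>.\<close>
      define f where "f y = (if sg i * (mid r k \<bullet> y) \<le> apo r then cls i y else cls (nb i k) (opp i k y))" for y
      have reg1: "regular S i y" if y: "sg i *\<^sub>R y \<in> W k" "sg i * (mid r k \<bullet> y) \<le> apo r" for y
      proof -
        have lt: "sg i * (mid r j \<bullet> y) < apo r" if "j < 5" "j \<noteq> k" for j using y that by (auto simp: W_def)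
        then have "sg i * (mid r j \<bullet> y) \<le> apo r" if "j < 5" for j using y(2) that by (cases "j = k") (auto simp: less_le)
        then show ?thesis using i lt unfolding regular_iff by (auto simp: mem_polygon tight_def less_le)
      qed
      have reg2: "regular S (nb i k) (opp i k y)" if y: "sg i *\<^sub>R y \<in> W k" "sg i * (mid r k \<bullet> y) \<ge> apo r" for y
      proof -
        have o: "sg (nb i k) * (mid r j \<bullet> opp i k y) = mid r j \<bullet> (2 *\<^sub>R mid r k - sg i *\<^sub>R y)" for j
          using sg_sq[OF i] by (simp add: n opp_def inner_diff_right algebra_simps)
        have lt: "sg (nb i k) * (mid r j \<bullet> opp i k y) < apo r" if "j < 5" "j \<noteq> k" for j unfolding o using y that by (auto simp: W_def)
        have "sg (nb i k) * (mid r k \<bullet> opp i k y) \<le> apo r" unfolding o using y(2) by (simp add: inner_diff_right mid_self[OF k(1)])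
        then have "sg (nb i k) * (mid r j \<bullet> opp i k y) \<le> apo r" if "j < 5" for j using lt that by (cases "j = k") (auto simp: less_le)
        then show ?thesis using n(1) lt unfolding regular_iff by (auto simp: mem_polygon tight_def less_le)
      qed
      have "chart S \<rho> (\<lambda>u. f (z + u))" unfolding chart_def
      proof (intro allI impI)
        fix u w :: complex assume u: "norm u < \<rho>"
        obtain \<epsilon> where e: "\<epsilon> > 0" "\<And>s. s \<in> {0..\<epsilon>} \<Longrightarrow> sg i *\<^sub>R (z + u + s *\<^sub>R w) \<in> W k" using step[OF u] k by blast
        define c where "c s = sg i * (mid r k \<bullet> (z + u + s *\<^sub>R w))" for s
        have c: "c s = c 0 + s * (sg i * (mid r k \<bullet> w))" for s by (simp add: c_def inner_add_right algebra_simps)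
        \<comment> \<open>A short germ either stays on the near side or runs beyond it at all
          positive times; if it starts on the side, the slope decides.\<close>
        have "\<exists>\<delta>>0. (\<forall>s\<in>{0..\<delta>}. c s \<le> apo r) \<or> c 0 \<ge> apo r \<and> (\<forall>s\<in>{0<..\<delta>}. c s > apo r)"
        proof -
          consider "c 0 < apo r" | "c 0 > apo r" | "c 0 = apo r" "sg i * (mid r k \<bullet> w) \<le> 0" | "c 0 = apo r" "sg i * (mid r k \<bullet> w) > 0" by linarith
          then show ?thesis
          proof cases
            case 1
            have "open {y. sg i * (mid r k \<bullet> y) < apo r}" using open_halfspace_lt[of "sg i *\<^sub>R mid r k" "apo r"] by simp
            from open_ray[OF this, of "z + u" w] show ?thesis using 1 by (force simp: c_def)
          next
            case 2
            have "open {y. sg i * (mid r k \<bullet> y) > apo r}" using open_halfspace_gt[of "apo r" "sg i *\<^sub>R mid r k"] by simp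
            from open_ray[OF this, of "z + u" w] show ?thesis using 2 by (force simp: c_def)
          next
            case 3
            have "c s \<le> apo r" if "s \<ge> 0" for s unfolding c[of s] using 3 mult_nonneg_nonpos[OF that 3(2)] by simp
            then show ?thesis by (intro exI[of _ 1]) auto
          next
            case 4
            have "c s > apo r" if "s > 0" for s unfolding c[of s] using 4 that by simp
            then show ?thesis using 4 by (intro exI[of _ 1]) auto
          qed
        qed
        then obtain \<delta> where d: "\<delta> > 0" "(\<forall>s\<in>{0..\<delta>}. c s \<le> apo r) \<or> c 0 \<ge> apo r \<and> (\<forall>s\<in>{0<..\<delta>}. c s > apo r)" by blast
        show "ray S w (\<lambda>s. f (z + (u + s *\<^sub>R w)))" unfolding ray_def
          using d(2)
        proof
          assume cs: "\<forall>s\<in>{0..\<delta>}. c s \<le> apo r"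
          show "\<exists>i' z'. \<exists>\<epsilon>>0. \<forall>s\<in>{0..\<epsilon>}. regular S i' (z' + s *\<^sub>R w) \<and> f (z + (u + s *\<^sub>R w)) = cls i' (z' + s *\<^sub>R w)"
          proof (intro exI[of _ i] exI[of _ "z + u"] exI[of _ "min \<epsilon> \<delta>"] conjI ballI)
            fix s assume s: "s \<in> {0..min \<epsilon> \<delta>}"
            have "c s \<le> apo r" "sg i *\<^sub>R (z + u + s *\<^sub>R w) \<in> W k" using s cs e by auto
            then show "regular S i (z + u + s *\<^sub>R w)" "f (z + (u + s *\<^sub>R w)) = cls i (z + u + s *\<^sub>R w)"
              by (auto intro: reg1 simp: c_def f_def add.assoc)
          qed (use e d in auto)
        next
          assume cs: "c 0 \<ge> apo r \<and> (\<forall>s\<in>{0<..\<delta>}. c s > apo r)"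
          show "\<exists>i' z'. \<exists>\<epsilon>>0. \<forall>s\<in>{0..\<epsilon>}. regular S i' (z' + s *\<^sub>R w) \<and> f (z + (u + s *\<^sub>R w)) = cls i' (z' + s *\<^sub>R w)"
          proof (intro exI[of _ "nb i k"] exI[of _ "opp i k (z + u)"] exI[of _ "min \<epsilon> \<delta>"] conjI ballI)
            fix s assume s: "s \<in> {0..min \<epsilon> \<delta>}"
            define y where "y = z + u + s *\<^sub>R w"
            have y: "sg i *\<^sub>R y \<in> W k" using s e(2)[of s] by (simp add: y_def)
            have y2: "c s \<ge> apo r"
            proof (cases "s = 0")
              case False
              then have "s \<in> {0<..\<delta>}" using s by simp
              then show ?thesis using cs by (meson less_imp_le)
            qed (use cs in simp)
            have o: "opp i k (z + u) + s *\<^sub>R w = opp i k y" by (simp add: opp_def y_def)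
            have cy: "c s = sg i * (mid r k \<bullet> y)" by (simp add: c_def y_def)
            show "regular S (nb i k) (opp i k (z + u) + s *\<^sub>R w)" unfolding o using y y2 cy by (simp add: reg2)
            have "f y = cls (nb i k) (opp i k y)"
            proof (cases "c s = apo r")
              case True
              then have "regular S i y" "tight i k y" using y cy reg1 by (auto simp: tight_def)
              then show ?thesis using cls_partner k(1) True cy by (simp add: f_def)
            qed (use y2 cy in \<open>simp add: f_def\<close>)
            then show "f (z + (u + s *\<^sub>R w)) = cls (nb i k) (opp i k (z + u) + s *\<^sub>R w)"
              unfolding o by (simp add: y_def add.assoc)
          qed (use e d in auto)
        qed
      qed
      moreover have "f (z + 0) = cls i z" using z(1) i k by (simp add: f_def mem_polygon)
      ultimately show ?thesis by blast
    qed
  qed (use rho in auto)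
qed

end

section \<open>Maps between pentagon surfaces\<close>

locale pent_morphism = P: pent S r sg nb + P': pent S' r sg' nb'
  for S :: "'i glued_polygons" and r sg nb and S' :: "'j glued_polygons" and sg' nb' +
  fixes f :: "'i \<Rightarrow> 'j" and h :: "complex \<Rightarrow> complex"
  assumes h: "orthogonal_transformation h"
    and lab: "i \<in> labels S \<Longrightarrow> f i \<in> labels S'"
    and sides: "i \<in> labels S \<Longrightarrow> k < 5 \<Longrightarrow> \<exists>k'<5. f (nb i k) = nb' (f i) k' \<and> h (sg i *\<^sub>R mid r k) = sg' (f i) *\<^sub>R mid r k'"
begin

text \<open>\<open>h\<close> is injective, so the side map \<open>\<kappa>\<close> is a permutation
  of the five sides. Tightness and gluing partners are carried over in both directions, which is why
  the image of a class is a whole class.\<close>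

lemma morphism:
  assumes reg: "regular S i z"
  shows regular: "regular S' (f i) (h z)"
    and cls: "map_prod f h ` surface_point S (i, z) = surface_point S' (f i, h z)"
proof -
  have i: "i \<in> labels S" and fi: "f i \<in> labels S'" using reg lab by (auto simp: regular_def)
  have lin: "linear h" and inner: "h x \<bullet> h y = x \<bullet> y" for x y using h by (auto simp: orthogonal_transformation_def)
  obtain \<kappa> where kap: "\<And>k. k < 5 \<Longrightarrow> \<kappa> k < 5 \<and> f (nb i k) = nb' (f i) (\<kappa> k) \<and> h (sg i *\<^sub>R mid r k) = sg' (f i) *\<^sub>R mid r (\<kappa> k)"
    using sides[OF i] by metis
  have "inj_on \<kappa> {..<5}"
  proof (rule inj_onI)
    fix k l assume kl: "k \<in> {..<5}" "l \<in> {..<5}" "\<kappa> k = \<kappa> l"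
    then have "h (sg i *\<^sub>R mid r k) = h (sg i *\<^sub>R mid r l)" using kap[of k] kap[of l] by simp
    then have "sg i *\<^sub>R mid r k = sg i *\<^sub>R mid r l" using orthogonal_transformation_inj[OF h] by (simp add: inj_eq)
    then show "k = l" using P.sg[OF i] kl by (auto intro: mid_inj[OF P.r0])
  qed
  then have surj: "\<kappa> ` {..<5} = {..<5}" using kap by (intro endo_inj_surj) auto
  have val: "sg' (f i) * (mid r (\<kappa> k) \<bullet> h z) = sg i * (mid r k \<bullet> z)" if "k < 5" for k z
    using inner[of "sg i *\<^sub>R mid r k" z] kap[OF that] by simp
  have tight: "P'.tight (f i) (\<kappa> k) (h z) \<longleftrightarrow> P.tight i k z" if "k < 5" for k
    using val[OF that] by (simp add: P.tight_def P'.tight_def)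
  have opp: "h (P.opp i k z) = P'.opp (f i) (\<kappa> k) (h z)" if "k < 5" for k
  proof -
    have "h (P.opp i k z) = h z - 2 *\<^sub>R h (sg i *\<^sub>R mid r k)"
      by (simp add: P.opp_def linear_diff[OF lin] linear_cmul[OF lin])
    then show ?thesis using kap[OF that] by (simp add: P'.opp_def)
  qed
  have all: "(\<forall>k<5. Q k) \<longleftrightarrow> (\<forall>k<5. Q (\<kappa> k))" for Q
    using surj by (metis (no_types, lifting) image_iff lessThan_iff)
  have ex: "(\<exists>k<5. Q k) \<longleftrightarrow> (\<exists>k<5. Q (\<kappa> k))" for Q
    using all[of "\<lambda>k. \<not> Q k"] by blast
  have inj: "\<kappa> k = \<kappa> l \<longleftrightarrow> k = l" if "k < 5" "l < 5" for k l using \<open>inj_on \<kappa> {..<5}\<close> that by (auto simp: inj_on_eq_iff)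
  show reg': "regular S' (f i) (h z)"
    unfolding P'.regular_iff
  proof (intro conjI)
    show "h z \<in> polygon S' (f i)" unfolding P'.mem_polygon[OF fi] all[of "\<lambda>k. sg' (f i) * (mid r k \<bullet> h z) \<le> apo r"]
      using P.regular_mem[OF reg] by (simp add: val P.mem_polygon[OF i])
    show "\<forall>k<5. \<forall>l<5. P'.tight (f i) k (h z) \<and> P'.tight (f i) l (h z) \<longrightarrow> k = l"
    proof (intro allI impI)
      fix k l :: nat assume kl: "k < 5" "l < 5" "P'.tight (f i) k (h z) \<and> P'.tight (f i) l (h z)"
      obtain k0 l0 where "k = \<kappa> k0" "k0 < 5" "l = \<kappa> l0" "l0 < 5" using kl(1,2) surj by blast
      then show "k = l" using kl(3) P.regular_tight[OF reg] tight by blast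
    qed
  qed (fact fi)
  show "map_prod f h ` surface_point S (i, z) = surface_point S' (f i, h z)"
  proof -
    have "{(nb' (f i) k, P'.opp (f i) k (h z)) |k. k < 5 \<and> P'.tight (f i) k (h z)} =
       {(nb' (f i) (\<kappa> k), P'.opp (f i) (\<kappa> k) (h z)) |k. k < 5 \<and> P'.tight (f i) (\<kappa> k) (h z)}"
    proof -
      have "(\<exists>k<5. P'.tight (f i) k (h z) \<and> x = (nb' (f i) k, P'.opp (f i) k (h z))) \<longleftrightarrow>
        (\<exists>k<5. P'.tight (f i) (\<kappa> k) (h z) \<and> x = (nb' (f i) (\<kappa> k), P'.opp (f i) (\<kappa> k) (h z)))" for x
        by (rule ex)
      then show ?thesis by blast
    qed
    also have "\<dots> = map_prod f h ` {(nb i k, P.opp i k z) |k. k < 5 \<and> P.tight i k z}"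
      unfolding setcompr_eq_image image_image
      by (rule image_cong) (auto simp: kap opp tight)
    finally show ?thesis unfolding P.cls_regular[OF reg] P'.cls_regular[OF reg'] by simp
  qed
qed

lemma straight:
  assumes str: "straight_on S v I \<gamma>"
  shows "straight_on S' (h v) I (\<lambda>t. map_prod f h ` \<gamma> t)"
proof -
  have lin: "linear h" using h by (auto simp: orthogonal_transformation_def)
  have one: "ray S' (h w) (\<lambda>s. map_prod f h ` \<gamma>' s)" if ra: "ray S w \<gamma>'" for w \<gamma>'
  proof -
    obtain i z \<epsilon> where e: "\<epsilon> > 0" "\<And>s. s \<in> {0..\<epsilon>} \<Longrightarrow> regular S i (z + s *\<^sub>R w) \<and> \<gamma>' s = surface_point S (i, z + s *\<^sub>R w)"
      using ra unfolding ray_def by blast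
    have h': "h z + s *\<^sub>R h w = h (z + s *\<^sub>R w)" for s by (simp add: linear_add[OF lin] linear_cmul[OF lin])
    show ?thesis unfolding ray_def
      by (rule exI[of _ "f i"], rule exI[of _ "h z"], rule exI[of _ \<epsilon>])
        (use e morphism in \<open>simp add: h'\<close>)
  qed
  show ?thesis using str one linear_neg[OF lin] unfolding straight_on_ray by metis
qed

end

section \<open>The dihedral group\<close>

definition rot :: "complex \<Rightarrow> complex \<Rightarrow> complex" where "rot u = (\<lambda>z. u * z)"
definition rfl :: "complex \<Rightarrow> complex \<Rightarrow> complex" where "rfl u = (\<lambda>z. u * cnj z)"

lemma unity_norm: "u ^ 5 = 1 \<Longrightarrow> norm u = 1" for u :: complex
  by (auto simp: unity5 norm_power)

lemma unity_cnj: "u ^ 5 = 1 \<Longrightarrow> u * cnj u = 1" "u ^ 5 = 1 \<Longrightarrow> cnj u * u = 1" for u :: complex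
  using unity_norm[of u] by (simp_all add: complex_norm_square[symmetric] mult.commute)

lemma unity_cnj_pow [simp]: "u ^ 5 = 1 \<Longrightarrow> cnj u ^ 5 = 1" for u :: complex
  by (metis complex_cnj_one complex_cnj_power)

lemma unity_mult [simp]: "u ^ 5 = 1 \<Longrightarrow> v ^ 5 = 1 \<Longrightarrow> (u * v) ^ 5 = 1" for u v :: complex
  by (simp add: power_mult_distrib)

lemma omega_pow_unity [simp]: "(omega ^ n) ^ 5 = 1"
  by (metis omega_pow5 power_mult mult.commute power_one)

text \<open>Exponents remain natural numbers, with \<open>cnj omega\<close> written as
  \<open>omega ^ 4\<close>; congruence modulo 5 therefore appears with explicit multiples on both
  sides.\<close>

lemma omega_pow_cong:
  assumes "a + 5 * x = b + 5 * y" shows "omega ^ a = omega ^ b"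
proof -
  have "omega ^ (c + 5 * n) = omega ^ c" for c n by (simp only: power_add power_mult omega_pow5 power_one mult_1_right)
  then show ?thesis using assms by metis
qed

lemma cnj_omega: "cnj omega = omega ^ 4"
proof -
  have "omega * cnj omega = omega * omega ^ 4" using unity_cnj(1)[OF omega_pow5] omega_pow5 by (metis power_Suc eval_nat_numeral(3))
  then show ?thesis by simp
qed

lemma cnj_omega_pow: "cnj (omega ^ n) = omega ^ (4 * n)"
  by (simp add: cnj_omega power_mult)

lemma rot_rot: "rot u \<circ> rot v = rot (u * v)" and rot_rfl: "rot u \<circ> rfl v = rfl (u * v)"
  and rfl_rot: "rfl u \<circ> rot v = rfl (u * cnj v)" and rfl_rfl: "rfl u \<circ> rfl v = rot (u * cnj v)"
  by (auto simp: rot_def rfl_def fun_eq_iff)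

lemma rot_one [simp]: "rot 1 = id" by (auto simp: rot_def)

lemma orthogonal_rot: "norm u = 1 \<Longrightarrow> orthogonal_transformation (rot u)"
  unfolding orthogonal_transformation rot_def by (auto simp: norm_mult intro!: linearI simp: algebra_simps)

lemma orthogonal_rfl: "norm u = 1 \<Longrightarrow> orthogonal_transformation (rfl u)"
  unfolding orthogonal_transformation rfl_def by (auto simp: norm_mult intro!: linearI simp: algebra_simps)

definition half_side :: "real \<Rightarrow> nat \<Rightarrow> complex" where
  "half_side r k = (vertex r (Suc k) - vertex r k) / 2"

lemma half_side_omega: "half_side r k = of_real r * \<i> * omega ^ k * ((omega - 1) / 2)"
  by (simp add: half_side_def vertex_omega field_simps)

lemma side_mid: "side r k = closed_segment (mid r k - half_side r k) (mid r k + half_side r k)"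
proof -
  have "mid r k - half_side r k = vertex r k" "mid r k + half_side r k = vertex r (Suc k)"
    by (simp_all add: mid_def half_side_def field_simps)
  then show ?thesis by (simp add: side_def)
qed

text \<open>No two sides of the pentagon are parallel: 5 is odd, so \<open>-1\<close> is not a fifth
  root of unity.\<close>

lemma half_side_eq:
  assumes "r \<noteq> 0" "k < 5" "l < 5"
  shows "half_side r l = half_side r k \<or> half_side r l = - half_side r k \<longleftrightarrow> l = k"
proof
  assume "half_side r l = half_side r k \<or> half_side r l = - half_side r k"
  then have "omega ^ l = omega ^ k \<or> omega ^ l = - (omega ^ k)"
  proof -
    define c where "c = of_real r * \<i> * ((omega - 1) / 2)"
    have "half_side r n = c * omega ^ n" for n by (simp add: half_side_omega c_def)
    moreover have "c \<noteq> 0" using assms(1) omega_ne_1 by (simp add: c_def)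
    moreover have "x = - y \<longleftrightarrow> c * x = - (c * y)" if "c \<noteq> 0" for x y
      using that by (metis mult_cancel_left mult_minus_right)
    ultimately show ?thesis using \<open>half_side r l = half_side r k \<or> half_side r l = - half_side r k\<close> by simp
  qed
  moreover have "omega ^ l \<noteq> - (omega ^ k)"
  proof
    assume "omega ^ l = - (omega ^ k)"
    then have "(omega ^ l) ^ 5 = (- (omega ^ k)) ^ 5" by simp
    then show False by (simp only: power_minus_odd odd_numeral omega_pow_unity) simp
  qed
  ultimately show "l = k" using omega_power_inj assms by blast
qed simp

text \<open>The direction of side \<open>k\<close> is a real multiple of
  \<open>\<i> * omega ^ k * (omega - 1)\<close>. Since \<open>cnj omega\<close> is the inverse of
  \<open>omega\<close>, its quotient by the conjugate is \<open>omega ^ (2 * k + 1)\<close>.\<close>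

lemma side_reflection_rfl:
  assumes "r \<noteq> 0"
  shows "side_reflection r k = rfl (omega ^ (2 * k + 1))"
proof -
  define u where "u = vertex r (Suc k) - vertex r k"
  have u: "u = of_real r * \<i> * omega ^ k * (omega - 1)" by (simp add: u_def vertex_omega algebra_simps)
  have c: "cnj u = - (of_real r * \<i> * omega ^ (4 * k) * (omega ^ 4 - 1))"
    unfolding u by (simp add: cnj_omega_pow[symmetric] cnj_omega)
  have n: "cnj u \<noteq> 0" using assms omega_ne_1 by (simp add: u)
  have a: "omega ^ (2 * k + 1) * omega ^ (4 * k) * omega ^ 4 = omega ^ k"
    unfolding power_add[symmetric] by (rule omega_pow_cong[of _ 0 _ "k + 1"]) simp
  have b: "omega ^ (2 * k + 1) * omega ^ (4 * k) = omega ^ k * omega"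
    unfolding power_add[symmetric] power_Suc2[symmetric] by (rule omega_pow_cong[of _ 0 _ k]) simp
  have key: "P * - (R * Q * (W - 1)) = R * K * (w - 1)" if "P * Q * W = K" "P * Q = K * w" for P Q W K R w :: complex
  proof -
    have "P * - (R * Q * (W - 1)) = R * (P * Q) - R * (P * Q * W)" by (simp add: algebra_simps)
    then show ?thesis by (subst (asm) that(1), subst (asm) that(2)) (simp add: algebra_simps)
  qed
  have "omega ^ (2 * k + 1) * cnj u = u"
    by (subst c, subst u) (rule key[OF a b])
  then have "u / cnj u = omega ^ (2 * k + 1)" using n by (simp add: field_simps)
  then show ?thesis unfolding side_reflection_def line_reflection_def rfl_def u_def[symmetric] by (simp add: fun_eq_iff)
qed

lemma dihedral_eq:
  assumes "r \<noteq> 0"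
  shows "g \<in> dihedral r \<longleftrightarrow> (\<exists>u. u ^ 5 = 1 \<and> (g = rot u \<or> g = rfl u))"
proof
  assume "g \<in> dihedral r"
  then show "\<exists>u. u ^ 5 = 1 \<and> (g = rot u \<or> g = rfl u)"
  proof induction
    case id
    show ?case by (rule exI[of _ 1]) simp
  next
    case (comp g k)
    then obtain u where u: "u ^ 5 = 1" "g = rot u \<or> g = rfl u" by blast
    have w: "(omega ^ (2 * k + 1)) ^ 5 = 1" by (rule omega_pow_unity)
    from u(2) show ?case
    proof
      assume "g = rot u"
      then show ?thesis using unity_mult[OF u(1) w] by (auto simp: side_reflection_rfl[OF assms] rot_rfl simp del: power_mult_distrib)
    next
      assume "g = rfl u"
      then show ?thesis using unity_mult[OF u(1) unity_cnj_pow[OF w]] by (auto simp: side_reflection_rfl[OF assms] rfl_rfl simp del: power_mult_distrib)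
    qed
  qed
next
  have R: "rfl u \<in> dihedral r" if "u ^ 5 = 1" for u
  proof -
    obtain j where j: "u = omega ^ j" using \<open>u ^ 5 = 1\<close> unity5 by blast
    \<comment> \<open>The index \<open>3 * j + 2\<close> solves \<open>2 * k + 1 = j\<close> modulo
      5.\<close>
    have "id \<circ> side_reflection r ((3 * j + 2) mod 5) \<in> dihedral r" by (intro dihedral.intros) simp
    moreover have "omega ^ (2 * ((3 * j + 2) mod 5) + 1) = omega ^ j"
    proof (rule omega_pow_cong[of _ "2 * ((3 * j + 2) div 5)" _ "j + 1"])
      have *: "3 * j + 2 = m + 5 * q \<Longrightarrow> 2 * m + 1 + 5 * (2 * q) = j + 5 * (j + 1)" for m q by simp
      show "2 * ((3 * j + 2) mod 5) + 1 + 5 * (2 * ((3 * j + 2) div 5)) = j + 5 * (j + 1)"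
        by (rule *) (rule mod_mult_div_eq[symmetric])
    qed
    ultimately show ?thesis by (simp only: side_reflection_rfl[OF assms] j id_comp)
  qed
  assume "\<exists>u. u ^ 5 = 1 \<and> (g = rot u \<or> g = rfl u)"
  then obtain u where u: "u ^ 5 = 1" "g = rot u \<or> g = rfl u" by blast
  have "rot u \<in> dihedral r"
  proof -
    \<comment> \<open>Side 2 is horizontal, so its reflection is complex conjugation; composing with
      it turns reflections into rotations.\<close>
    have "omega ^ (2 * 2 + 1) = omega ^ 0" by (rule omega_pow_cong[of _ 0 _ 1]) simp
    then have s2: "side_reflection r 2 = rfl 1" by (simp only: side_reflection_rfl[OF assms] power_0)
    have "rfl u \<circ> side_reflection r 2 \<in> dihedral r" by (rule dihedral.comp[OF R[OF u(1)]]) simp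
    then show ?thesis by (simp add: s2 rfl_rfl)
  qed
  then show "g \<in> dihedral r" using u R by blast
qed

lemma dihedral_cases:
  assumes "r \<noteq> 0" "g \<in> dihedral r"
  obtains j where "g = rot (omega ^ j)" | j where "g = rfl (omega ^ j)"
  using assms unity5 dihedral_eq by metis

lemma rot_dihedral: "r \<noteq> 0 \<Longrightarrow> u ^ 5 = 1 \<Longrightarrow> rot u \<in> dihedral r"
  and rfl_dihedral: "r \<noteq> 0 \<Longrightarrow> u ^ 5 = 1 \<Longrightarrow> rfl u \<in> dihedral r"
  by (auto simp: dihedral_eq)

lemma dihedral_comp:
  assumes "r \<noteq> 0" "g \<in> dihedral r" "h \<in> dihedral r"
  shows "g \<circ> h \<in> dihedral r"
proof -
  obtain u v where "u ^ 5 = 1" "g = rot u \<or> g = rfl u" "v ^ 5 = 1" "h = rot v \<or> h = rfl v"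
    using assms by (auto simp: dihedral_eq)
  then show ?thesis
    by (auto simp: rot_rot rot_rfl rfl_rot rfl_rfl intro!: rot_dihedral[OF assms(1)] rfl_dihedral[OF assms(1)])
qed

lemma dihedral_orthogonal: "r \<noteq> 0 \<Longrightarrow> g \<in> dihedral r \<Longrightarrow> orthogonal_transformation g"
  by (auto simp: dihedral_eq unity_norm intro: orthogonal_rot orthogonal_rfl)

lemma dihedral_bij: "r \<noteq> 0 \<Longrightarrow> g \<in> dihedral r \<Longrightarrow> bij g"
  using dihedral_orthogonal orthogonal_transformation_bij by blast

text \<open>The determinant of \<open>g\<close> as a real linear map of the plane.\<close>

definition orient :: "(complex \<Rightarrow> complex) \<Rightarrow> real" where
  "orient g = Im (cnj (g 1) * g \<i>)"

lemma orient_rot [simp]: "u ^ 5 = 1 \<Longrightarrow> orient (rot u) = 1"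
  and orient_rfl [simp]: "u ^ 5 = 1 \<Longrightarrow> orient (rfl u) = -1"
  by (simp_all add: orient_def rot_def rfl_def mult.assoc[symmetric] unity_cnj)

lemma orient_comp:
  assumes "r \<noteq> 0" "g \<in> dihedral r" "h \<in> dihedral r"
  shows "orient (g \<circ> h) = orient g * orient h"
proof -
  obtain u v where "u ^ 5 = 1" "g = rot u \<or> g = rfl u" "v ^ 5 = 1" "h = rot v \<or> h = rfl v"
    using assms by (auto simp: dihedral_eq)
  then show ?thesis using unity_mult[of u v] unity_mult[of u "cnj v"]
    by (auto simp: rot_rot rot_rfl rfl_rot rfl_rfl simp del: power_mult_distrib unity_mult)
qed

lemma orient_cases: "r \<noteq> 0 \<Longrightarrow> g \<in> dihedral r \<Longrightarrow> orient g = 1 \<or> orient g = -1"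
  by (auto simp: dihedral_eq)

text \<open>Conjugation by \<open>g\<close> turns the reflection in a side direction into the one
  for the image side. On indices, \<open>rot (omega ^ j)\<close> sends \<open>k\<close> to
  \<open>k + j\<close> and \<open>rfl (omega ^ j)\<close> sends \<open>k\<close> to
  \<open>j - k - 1\<close>, modulo 5. The second part inverts the first.\<close>

lemma dihedral_side:
  assumes "r \<noteq> 0" "g \<in> dihedral r" "k < 5"
  shows "\<exists>k'<5. g (mid r k) = orient g *\<^sub>R mid r k' \<and> g \<circ> side_reflection r k = side_reflection r k' \<circ> g"
    and "\<exists>k'<5. g (mid r k') = orient g *\<^sub>R mid r k \<and> g \<circ> side_reflection r k' = side_reflection r k \<circ> g"
proof -
  have mu: "omega * cnj (1 + omega) = 1 + omega" using unity_cnj(1)[OF omega_pow5] by (simp add: algebra_simps)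
  have A: "rot (omega ^ j) (mid r k) = mid r l \<and> rot (omega ^ j) \<circ> side_reflection r k = side_reflection r l \<circ> rot (omega ^ j)"
    if l: "l + 5 * x = k + j + 5 * y" for j k l x y
  proof
    have "omega ^ l = omega ^ j * omega ^ k" unfolding power_add[symmetric] using l by (intro omega_pow_cong[of _ x _ y]) simp
    then show "rot (omega ^ j) (mid r k) = mid r l" by (simp add: rot_def mid_omega)
    have "omega ^ j * omega ^ (2 * k + 1) = omega ^ (2 * l + 1) * omega ^ (4 * j)"
      unfolding power_add[symmetric] using l by (intro omega_pow_cong[of _ "j + 2 * y" _ "2 * x"]) simp
    then show "rot (omega ^ j) \<circ> side_reflection r k = side_reflection r l \<circ> rot (omega ^ j)"
      by (simp only: side_reflection_rfl[OF assms(1)] rot_rfl rfl_rot cnj_omega_pow)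
  qed
  have B: "rfl (omega ^ j) (mid r k) = - mid r l \<and> rfl (omega ^ j) \<circ> side_reflection r k = side_reflection r l \<circ> rfl (omega ^ j)"
    if l: "l + 5 * x = j + 4 * k + 4 + 5 * y" for j k l x y
  proof
    have "omega ^ (l + 1) = omega ^ j * omega ^ (4 * k)" unfolding power_add[symmetric] using l by (intro omega_pow_cong[of _ x _ "y + 1"]) simp
    then have l': "omega ^ j * omega ^ (4 * k) = omega ^ l * omega" by (simp add: mult.commute)
    have "rfl (omega ^ j) (mid r k) = - (of_real r * \<i> * (omega ^ j * omega ^ (4 * k)) * (cnj (1 + omega) / 2))"
      by (simp add: rfl_def mid_omega cnj_omega_pow[symmetric])
    also have "\<dots> = - (of_real r * \<i> * omega ^ l * ((omega * cnj (1 + omega)) / 2))" unfolding l' by simp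
    finally show "rfl (omega ^ j) (mid r k) = - mid r l" unfolding mu mid_omega .
    have "omega ^ j * omega ^ (4 * (2 * k + 1)) = omega ^ (2 * l + 1) * omega ^ (4 * j)"
      unfolding power_add[symmetric] using l by (intro omega_pow_cong[of _ "j + 1 + 2 * y" _ "2 * x"]) simp
    then show "rfl (omega ^ j) \<circ> side_reflection r k = side_reflection r l \<circ> rfl (omega ^ j)"
      by (simp only: side_reflection_rfl[OF assms(1)] rfl_rfl cnj_omega_pow)
  qed
  show "\<exists>k'<5. g (mid r k) = orient g *\<^sub>R mid r k' \<and> g \<circ> side_reflection r k = side_reflection r k' \<circ> g"
    using assms(1,2)
  proof (cases rule: dihedral_cases)
    case (1 j)
    then show ?thesis using A[of "(k + j) mod 5" "(k + j) div 5" k j 0] by (intro exI[of _ "(k + j) mod 5"]) simp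
  next
    case (2 j)
    then show ?thesis using B[of "(j + 4 * k + 4) mod 5" "(j + 4 * k + 4) div 5" j k 0] by (intro exI[of _ "(j + 4 * k + 4) mod 5"]) simp
  qed
  show "\<exists>k'<5. g (mid r k') = orient g *\<^sub>R mid r k \<and> g \<circ> side_reflection r k' = side_reflection r k \<circ> g"
    using assms(1,2)
  proof (cases rule: dihedral_cases)
    case (1 j)
    have "k + 5 * j = (k + 4 * j) mod 5 + j + 5 * ((k + 4 * j) div 5)"
    proof -
      have *: "k + 4 * j = m + 5 * q \<Longrightarrow> k + 5 * j = m + j + 5 * q" for m q by simp
      show ?thesis by (rule *) (rule mod_mult_div_eq[symmetric])
    qed
    then show ?thesis using A[of k j "(k + 4 * j) mod 5" j "(k + 4 * j) div 5"] 1 by (intro exI[of _ "(k + 4 * j) mod 5"]) simp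
  next
    case (2 j)
    have "k + 5 * (j + 3 * k + 4) = j + 4 * ((j + 4 * k + 4) mod 5) + 4 + 5 * (4 * ((j + 4 * k + 4) div 5))"
    proof -
      have *: "j + 4 * k + 4 = m + 5 * q \<Longrightarrow> k + 5 * (j + 3 * k + 4) = j + 4 * m + 4 + 5 * (4 * q)" for m q by simp
      show ?thesis by (rule *) (rule mod_mult_div_eq[symmetric])
    qed
    then show ?thesis using B[of k "j + 3 * k + 4" j "(j + 4 * k + 4) mod 5" "4 * ((j + 4 * k + 4) div 5)"] 2 by (intro exI[of _ "(j + 4 * k + 4) mod 5"]) simp
  qed
qed

lemma vertex_set: "vertex r ` {..<5} = (\<lambda>u. of_real r * \<i> * u) ` {u. u ^ 5 = 1}"
  by (auto simp: vertex_omega unity5)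

text \<open>\<open>g\<close> permutes the fifth roots of unity, and conjugation also changes the
  sign of the factor \<open>\<i>\<close> in the vertices. Linearity extends this to the convex
  hull.\<close>

lemma dihedral_pentagon:
  assumes "r \<noteq> 0" "g \<in> dihedral r"
  shows "g ` pentagon r = (\<lambda>z. orient g *\<^sub>R z) ` pentagon r"
proof -
  obtain u where u: "u ^ 5 = 1" "g = rot u \<or> g = rfl u" using assms dihedral_eq by blast
  have V: "g ` vertex r ` {..<5} = (\<lambda>z. orient g *\<^sub>R z) ` vertex r ` {..<5}"
    using u(2)
  proof
    assume g: "g = rot u"
    have 1: "(u * w) ^ 5 = 1" "w = u * (cnj u * w)" "(cnj u * w) ^ 5 = 1" if "w ^ 5 = 1" for w
      using u(1) that by (simp_all add: mult.assoc[symmetric] unity_cnj del: power_mult_distrib)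
    have "(\<lambda>w. u * w) ` {u. u ^ 5 = 1} = {u. u ^ 5 = 1}"
    proof
      show "{u. u ^ 5 = 1} \<subseteq> (\<lambda>w. u * w) ` {u. u ^ 5 = 1}" using 1 by blast
    qed (use 1 in auto)
    then have "(\<lambda>w. of_real r * \<i> * w) ` (\<lambda>w. u * w) ` {u. u ^ 5 = 1} = (\<lambda>w. of_real r * \<i> * w) ` {u. u ^ 5 = 1}" by simp
    moreover have o: "orient g = 1" using g u(1) by simp
    ultimately show ?thesis unfolding vertex_set o by (simp add: g image_image rot_def mult_ac)
  next
    assume g: "g = rfl u"
    have 1: "(u * cnj w) ^ 5 = 1" "w = u * cnj (u * cnj w)" if "w ^ 5 = 1" for w
      using u(1) that by (simp_all add: mult.assoc[symmetric] unity_cnj del: power_mult_distrib)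
    have "(\<lambda>w. u * cnj w) ` {u. u ^ 5 = 1} = {u. u ^ 5 = 1}"
    proof
      show "{u. u ^ 5 = 1} \<subseteq> (\<lambda>w. u * cnj w) ` {u. u ^ 5 = 1}" using 1 by blast
    qed (use 1 in auto)
    then have "(\<lambda>w. - (of_real r * \<i> * w)) ` (\<lambda>w. u * cnj w) ` {u. u ^ 5 = 1} = (\<lambda>w. - (of_real r * \<i> * w)) ` {u. u ^ 5 = 1}" by simp
    moreover have o: "orient g = - 1" using g u(1) by simp
    ultimately show ?thesis unfolding vertex_set o by (simp add: g image_image rfl_def mult_ac)
  qed
  have "linear g" using dihedral_orthogonal[OF assms] by (simp add: orthogonal_transformation_def)
  moreover have "linear (\<lambda>z::complex. orient g *\<^sub>R z)" by (rule linear_scaleR)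
  ultimately show ?thesis unfolding pentagon_def by (simp only: convex_hull_linear_image V)
qed

text \<open>Keeps the two labels of the double pentagon apart. Vertex 0 lies opposite side 2 and its
  distance from the centre exceeds the apothem, so its negative lies beyond side 2.\<close>

lemma pentagon_neq_uminus:
  assumes "r \<noteq> 0" shows "uminus ` pentagon r \<noteq> pentagon r"
proof
  assume e: "uminus ` pentagon r = pentagon r"
  have "- vertex r 0 \<in> pentagon r" using e vertex_in_pentagon[of r 0] by blast
  then have "mid r 2 \<bullet> (- vertex r 0) \<le> apo r" by (simp add: pentagon_halfplanes[OF assms])
  moreover have "mid r 2 \<bullet> vertex r 0 = - (r\<^sup>2 * cos (pi / 5))"
    unfolding mid_vertex by simp
  ultimately have "r\<^sup>2 * cos (pi / 5) \<le> r\<^sup>2 * (cos (pi / 5))\<^sup>2" by (simp add: apo_def power_mult_distrib)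
  moreover have "cos (pi / 5) < cos 0" by (rule cos_monotone_0_pi) auto
  then have "r\<^sup>2 * (cos (pi / 5) * cos (pi / 5)) < r\<^sup>2 * (cos (pi / 5) * 1)" using cos_pi5_pos assms
    by (intro mult_strict_left_mono) auto
  ultimately show False by (simp add: power2_eq_square)
qed

text \<open>A translation between segments matches the midpoints, and the half vectors up to sign.
  In centre and half-vector form, the gluing is the translation by the difference of the
  centres.\<close>

lemma glued_segments:
  "glued_by_translation (closed_segment (a - d) (a + d)) (closed_segment (b - e) (b + e)) z w \<longleftrightarrow>
   (e = d \<or> e = - d) \<and> z \<in> closed_segment (a - d) (a + d) \<and> w = z + (b - a)"
proof -
  have "closed_segment (b - e) (b + e) = (+) c ` closed_segment (a - d) (a + d) \<longleftrightarrow> c = b - a \<and> (e = d \<or> e = - d)" for c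
  proof -
    have "closed_segment (b - e) (b + e) = (+) c ` closed_segment (a - d) (a + d) \<longleftrightarrow>
      {b - e, b + e} = {c + (a - d), c + (a + d)}"
      unfolding closed_segment_translation[symmetric] by (simp only: closed_segment_eq)
    also have "\<dots> \<longleftrightarrow> c = b - a \<and> (e = d \<or> e = - d)"
    proof
      assume "{b - e, b + e} = {c + (a - d), c + (a + d)}"
      then consider "b - e = c + (a - d)" "b + e = c + (a + d)" | "b - e = c + (a + d)" "b + e = c + (a - d)"
        by (auto simp: doubleton_eq_iff)
      then show "c = b - a \<and> (e = d \<or> e = - d)"
      proof cases
        case 1
        have "2 * b = 2 * (c + a)" "2 * e = 2 * d" using 1 by algebra+
        then have "b = c + a" "e = d" by (simp_all only: mult_cancel_left) simp_all
        then show ?thesis by simp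
      next
        case 2
        have "2 * b = 2 * (c + a)" "2 * e = 2 * (- d)" using 2 by algebra+
        then have "b = c + a" "e = - d" by (simp_all only: mult_cancel_left) simp_all
        then show ?thesis by simp
      qed
    qed (auto simp: insert_commute)
    finally show ?thesis .
  qed
  then show ?thesis unfolding glued_by_translation_def by (auto simp: add.commute)
qed

section \<open>The double pentagon and the necklace\<close>

definition sgD :: "real \<Rightarrow> complex set \<Rightarrow> real" where
  "sgD r P = (if P = pentagon r then 1 else - 1)"

definition nbD :: "complex set \<Rightarrow> nat \<Rightarrow> complex set" where
  "nbD P k = uminus ` P"

text \<open>The reflection stands on the left, although the gluing composes it on the right: sides
  are indexed here by their direction in the plane, and \<open>dihedral_side\<close> converts
  between the two numberings.\<close>

definition nbN :: "real \<Rightarrow> (complex \<Rightarrow> complex) \<Rightarrow> nat \<Rightarrow> complex \<Rightarrow> complex" where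
  "nbN r g k = side_reflection r k \<circ> g"

lemma glued_by_translation_sym: "glued_by_translation A B z w \<longleftrightarrow> glued_by_translation B A w z"
proof -
  have "glued_by_translation B A w z" if gl: "glued_by_translation A B z w" for A B z w
  proof -
    obtain c where c: "B = (+) c ` A" "z \<in> A" "w = c + z" using gl unfolding glued_by_translation_def by blast
    have "A = (+) (- c) ` B" unfolding c(1) by (simp add: image_image)
    then show ?thesis using c unfolding glued_by_translation_def by (intro exI[of _ "- c"]) auto
  qed
  then show ?thesis by blast
qed

lemma uminus_side: "uminus ` side r k = closed_segment (- mid r k - half_side r k) (- mid r k + half_side r k)"
proof -
  have "uminus ` side r k = closed_segment (- (mid r k - half_side r k)) (- (mid r k + half_side r k))"
    unfolding side_mid by (rule closed_segment_linear_image[symmetric]) (rule linear_uminus)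
  then show ?thesis by (simp add: closed_segment_commute)
qed

lemma glue_double_pentagon:
  assumes r: "r \<noteq> 0"
  shows "glue (double_pentagon r) (P, z) (P', w) \<longleftrightarrow> P = pentagon r \<and> P' = uminus ` pentagon r \<and>
     (\<exists>k<5. z \<in> side r k \<and> w = z - 2 *\<^sub>R mid r k)"
proof -
  have "glued_by_translation (side r k) (uminus ` side r l) z w \<longleftrightarrow> l = k \<and> z \<in> side r k \<and> w = z + (- mid r l - mid r k)"
    if "k < 5" "l < 5" for k l
    unfolding uminus_side unfolding side_mid[of r k] glued_segments half_side_eq[OF r that] by (rule refl)
  then have "(\<exists>k<5. \<exists>l<5. glued_by_translation (side r k) (uminus ` side r l) z w) \<longleftrightarrow>
    (\<exists>k<5. z \<in> side r k \<and> w = z + (- mid r k - mid r k))" by blast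
  then show ?thesis by (simp add: double_pentagon_def scaleR_2)
qed

lemma pent_double_pentagon:
  assumes r: "r \<noteq> 0"
  shows "pent (double_pentagon r) r (sgD r) nbD"
proof
  let ?S = "double_pentagon r"
  note ne = pentagon_neq_uminus[OF r]
  have lab: "labels ?S = {pentagon r, uminus ` pentagon r}" and pol: "polygon ?S P = P" for P
    by (simp_all add: double_pentagon_def)
  show "r \<noteq> 0" by fact
  fix P assume P: "P \<in> labels ?S"
  show "sgD r P = 1 \<or> sgD r P = - 1" by (simp add: sgD_def)
  show "polygon ?S P = (\<lambda>z. sgD r P *\<^sub>R z) ` pentagon r" using P ne by (auto simp: lab pol sgD_def)
  fix k :: nat assume k: "k < 5"
  show "nbD P k \<in> labels ?S" using P by (auto simp: lab nbD_def image_image)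
  show "sgD r (nbD P k) = - sgD r P" using P ne by (auto simp: lab nbD_def sgD_def image_image)
  show "nbD (nbD P k) k = P" by (simp add: nbD_def image_image)
next
  let ?S = "double_pentagon r"
  note ne = pentagon_neq_uminus[OF r]
  fix x y :: "complex set \<times> complex"
  obtain P z P' w where xy: "x = (P, z)" "y = (P', w)" by (cases x, cases y)
  note glue = glue_double_pentagon[OF r]
  \<comment> \<open>The gluing relation is directed from \<open>Q\<close> to \<open>-Q\<close>; this
    is its converse, read from \<open>-Q\<close>.\<close>
  have opp: "w \<in> side r k \<and> z = w - 2 *\<^sub>R mid r k \<longleftrightarrow> - z \<in> side r k \<and> w = z + 2 *\<^sub>R mid r k" if "k < 5" for k w z
  proof -
    from opposite_side[of w r k] opposite_side[of "- z" r k] show ?thesis by (auto simp: algebra_simps)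
  qed
  have "symclp (glue ?S) x y \<longleftrightarrow> P = pentagon r \<and> P' = uminus ` pentagon r \<and> (\<exists>k<5. z \<in> side r k \<and> w = z - 2 *\<^sub>R mid r k) \<or>
    P = uminus ` pentagon r \<and> P' = pentagon r \<and> (\<exists>k<5. - z \<in> side r k \<and> w = z + 2 *\<^sub>R mid r k)"
    unfolding symclp_def xy glue using opp by blast
  also have "\<dots> \<longleftrightarrow> P \<in> labels ?S \<and> z \<in> polygon ?S P \<and>
      (\<exists>k<5. sgD r P * (mid r k \<bullet> z) = apo r \<and> (P', w) = (nbD P k, z - (2 * sgD r P) *\<^sub>R mid r k))"
  proof -
    have "- z \<in> side r k \<longleftrightarrow> z \<in> uminus ` pentagon r \<and> - (mid r k \<bullet> z) = apo r" if "k < 5" for k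
      using side_tight[OF r that] by (force simp: image_iff)
    then show ?thesis using ne side_tight[OF r]
      by (auto simp: double_pentagon_def sgD_def nbD_def image_image)
  qed
  finally show "symclp (glue ?S) x y \<longleftrightarrow> fst x \<in> labels ?S \<and> snd x \<in> polygon ?S (fst x) \<and>
      (\<exists>k<5. sgD r (fst x) * (mid r k \<bullet> snd x) = apo r \<and> y = (nbD (fst x) k, snd x - (2 * sgD r (fst x)) *\<^sub>R mid r k))"
    by (simp add: xy)
qed

lemma side_reflection_involution:
  assumes "r \<noteq> 0" shows "side_reflection r k \<circ> side_reflection r k = id"
proof -
  have u: "(omega ^ (2 * k + 1)) ^ 5 = 1" by (rule omega_pow_unity)
  show ?thesis by (simp only: side_reflection_rfl[OF assms] rfl_rfl unity_cnj[OF u] rot_one)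
qed

lemma side_reflection_half_side:
  assumes "r \<noteq> 0" shows "side_reflection r k (half_side r k) = half_side r k"
proof -
  have "half_side r k \<noteq> 0" using assms omega_ne_1 by (simp add: half_side_omega)
  moreover have "vertex r (Suc k) - vertex r k = 2 * half_side r k" by (simp add: half_side_def)
  ultimately show ?thesis by (simp add: side_reflection_def line_reflection_def)
qed

lemma side_reflection_mid:
  assumes "r \<noteq> 0" shows "side_reflection r k (mid r k) = - mid r k"
proof -
  have mu: "omega * cnj (1 + omega) = 1 + omega" using unity_cnj(1)[OF omega_pow5] by (simp add: algebra_simps)
  have e: "omega ^ (2 * k + 1) * omega ^ (4 * k) = omega ^ k * omega"
    unfolding power_add[symmetric] power_Suc2[symmetric] by (rule omega_pow_cong[of _ 0 _ k]) simp
  have "rfl (omega ^ (2 * k + 1)) (mid r k) = - (of_real r * \<i> * (omega ^ (2 * k + 1) * omega ^ (4 * k)) * (cnj (1 + omega) / 2))"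
    by (simp add: rfl_def mid_omega cnj_omega_pow[symmetric])
  also have "\<dots> = - (of_real r * \<i> * omega ^ k * ((omega * cnj (1 + omega)) / 2))" unfolding e by simp
  finally show ?thesis unfolding mu mid_omega side_reflection_rfl[OF assms] .
qed

lemma pent_necklace:
  assumes r: "r \<noteq> 0"
  shows "pent (necklace r) r orient (nbN r)"
proof
  let ?S = "necklace r"
  show "r \<noteq> 0" by fact
  fix g assume "g \<in> labels ?S"
  then have g: "g \<in> dihedral r" by (simp add: necklace_def)
  show "orient g = 1 \<or> orient g = - 1" using orient_cases[OF r g] .
  show "polygon ?S g = (\<lambda>z. orient g *\<^sub>R z) ` pentagon r" using dihedral_pentagon[OF r g] by (simp add: necklace_def)
  fix k :: nat assume k: "k < 5"
  have s: "side_reflection r k \<in> dihedral r" using dihedral.comp[OF dihedral.id k] by simp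
  have u: "(omega ^ (2 * k + 1)) ^ 5 = 1" by (rule omega_pow_unity)
  show "nbN r g k \<in> labels ?S" using dihedral_comp[OF r s g] by (simp add: nbN_def necklace_def)
  show "orient (nbN r g k) = - orient g"
    unfolding nbN_def orient_comp[OF r s g] by (simp only: side_reflection_rfl[OF r] orient_rfl[OF u])
  show "nbN r (nbN r g k) k = g" unfolding nbN_def by (metis comp_assoc id_comp side_reflection_involution[OF r])
next
  let ?S = "necklace r"
  fix x y :: "(complex \<Rightarrow> complex) \<times> complex"
  obtain g z h w where xy: "x = (g, z)" "y = (h, w)" by (cases x, cases y)
  note invol = side_reflection_involution[OF r] and srd = side_reflection_half_side[OF r] and srm = side_reflection_mid[OF r]
  have glue: "glue ?S (g, z) (h, w) \<longleftrightarrow> g \<in> dihedral r \<and>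
     (\<exists>k<5. h = g \<circ> side_reflection r k \<and> glued_by_translation (g ` side r k) (h ` side r k) z w)"
    and glue': "glue ?S (g, z) (h, w) \<longleftrightarrow> g \<in> dihedral r \<and>
     (\<exists>k<5. h = g \<circ> side_reflection r k \<and> z \<in> g ` side r k \<and> w = z - 2 *\<^sub>R g (mid r k))" for g z h w
  proof -
    \<comment> \<open>The maps \<open>g\<close> and \<open>h\<close> agree on the half vector of
      side \<open>k\<close> and differ by sign on its midpoint. So this side is glued to itself
      across the reflection, and no other side of the copy \<open>h\<close> is parallel to
      it.\<close>
    have *: "glued_by_translation (g ` side r k) (h ` side r l) z w \<longleftrightarrow> l = k \<and> z \<in> g ` side r k \<and> w = z - 2 *\<^sub>R g (mid r k)"
      if g: "g \<in> dihedral r" and h: "h = g \<circ> side_reflection r k" and kl: "k < 5" "l < 5" for k l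
    proof -
      have "h \<in> dihedral r" unfolding h by (rule dihedral.comp[OF g kl(1)])
      then have lin: "linear g" "linear h" and inj: "inj h"
        using dihedral_orthogonal[OF r] g dihedral_bij[OF r] by (auto simp: orthogonal_transformation_def bij_def)
      have im: "f ` side r n = closed_segment (f (mid r n) - f (half_side r n)) (f (mid r n) + f (half_side r n))" if "linear f" for f n
        unfolding side_mid closed_segment_linear_image[OF that, symmetric] by (simp add: linear_add[OF that] linear_diff[OF that])
      have gh: "g (half_side r k) = h (half_side r k)" "h (mid r k) = - g (mid r k)"
        unfolding h by (simp_all add: srd srm linear_neg[OF lin(1)])
      have "h (half_side r l) = g (half_side r k) \<or> h (half_side r l) = - g (half_side r k) \<longleftrightarrow> l = k"
        unfolding gh(1) linear_neg[OF lin(2), symmetric] inj_eq[OF inj] by (rule half_side_eq[OF r kl])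
      then show ?thesis unfolding im[OF lin(1)] im[OF lin(2)] glued_segments
        using gh(2) by (auto simp: scaleR_2)
    qed
    have "glue ?S (g, z) (h, w) \<longleftrightarrow> g \<in> dihedral r \<and>
     (\<exists>k<5. \<exists>l<5. h = g \<circ> side_reflection r k \<and> glued_by_translation (g ` side r k) (h ` side r l) z w)"
      by (simp add: necklace_def)
    then show "glue ?S (g, z) (h, w) \<longleftrightarrow> g \<in> dihedral r \<and>
     (\<exists>k<5. h = g \<circ> side_reflection r k \<and> glued_by_translation (g ` side r k) (h ` side r k) z w)"
     "glue ?S (g, z) (h, w) \<longleftrightarrow> g \<in> dihedral r \<and>
     (\<exists>k<5. h = g \<circ> side_reflection r k \<and> z \<in> g ` side r k \<and> w = z - 2 *\<^sub>R g (mid r k))"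
      using * by blast+
  qed
  \<comment> \<open>Here the gluing is symmetric already, because side reflections are
    involutions.\<close>
  have sym: "glue ?S (h, w) (g, z)" if gl: "glue ?S (g, z) (h, w)" for g z h w
  proof -
    obtain k where k: "g \<in> dihedral r" "k < 5" "h = g \<circ> side_reflection r k" "glued_by_translation (g ` side r k) (h ` side r k) z w"
      using gl unfolding glue by blast
    have hg: "g = h \<circ> side_reflection r k" unfolding k(3) by (simp add: comp_assoc invol)
    have hd: "h \<in> dihedral r" unfolding k(3) by (rule dihedral.comp[OF k(1,2)])
    have gs: "glued_by_translation (h ` side r k) (g ` side r k) w z" using k(4) glued_by_translation_sym by blast
    show ?thesis unfolding glue using hd hg k(2) gs by blast
  qed
  have "symclp (glue ?S) x y \<longleftrightarrow> glue ?S (g, z) (h, w)" unfolding symclp_def xy using sym by blast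
  also have "\<dots> \<longleftrightarrow> g \<in> labels ?S \<and> z \<in> polygon ?S g \<and>
      (\<exists>k<5. orient g * (mid r k \<bullet> z) = apo r \<and> (h, w) = (nbN r g k, z - (2 * orient g) *\<^sub>R mid r k))"
  proof (cases "g \<in> dihedral r")
    case True
    have key: "z \<in> g ` side r k \<longleftrightarrow> z \<in> g ` pentagon r \<and> orient g * (mid r l \<bullet> z) = apo r"
      if kl: "k < 5" "g (mid r k) = orient g *\<^sub>R mid r l" for k l
    proof -
      have "orient g * (mid r l \<bullet> g y) = mid r k \<bullet> y" for y
        using dihedral_orthogonal[OF r True] kl(2) unfolding orthogonal_transformation_def by (metis inner_scaleR_left)
      then show ?thesis using side_tight[OF r kl(1)] by auto
    qed
    have "(\<exists>k<5. h = g \<circ> side_reflection r k \<and> z \<in> g ` side r k \<and> w = z - 2 *\<^sub>R g (mid r k)) \<longleftrightarrow>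
      z \<in> g ` pentagon r \<and> (\<exists>k<5. orient g * (mid r k \<bullet> z) = apo r \<and> h = side_reflection r k \<circ> g \<and> w = z - (2 * orient g) *\<^sub>R mid r k)"
    proof
      assume "\<exists>k<5. h = g \<circ> side_reflection r k \<and> z \<in> g ` side r k \<and> w = z - 2 *\<^sub>R g (mid r k)"
      then obtain k where k: "k < 5" "h = g \<circ> side_reflection r k" "z \<in> g ` side r k" "w = z - 2 *\<^sub>R g (mid r k)" by blast
      obtain l where l: "l < 5" "g (mid r k) = orient g *\<^sub>R mid r l" "g \<circ> side_reflection r k = side_reflection r l \<circ> g"
        using dihedral_side(1)[OF r True k(1)] by blast
      show "z \<in> g ` pentagon r \<and> (\<exists>k<5. orient g * (mid r k \<bullet> z) = apo r \<and> h = side_reflection r k \<circ> g \<and> w = z - (2 * orient g) *\<^sub>R mid r k)"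
        using key[OF k(1) l(2)] k l by (auto intro!: exI[of _ l])
    next
      assume a: "z \<in> g ` pentagon r \<and> (\<exists>k<5. orient g * (mid r k \<bullet> z) = apo r \<and> h = side_reflection r k \<circ> g \<and> w = z - (2 * orient g) *\<^sub>R mid r k)"
      then obtain l where l: "l < 5" "orient g * (mid r l \<bullet> z) = apo r" "h = side_reflection r l \<circ> g" "w = z - (2 * orient g) *\<^sub>R mid r l" by blast
      obtain k where k: "k < 5" "g (mid r k) = orient g *\<^sub>R mid r l" "g \<circ> side_reflection r k = side_reflection r l \<circ> g"
        using dihedral_side(2)[OF r True l(1)] by blast
      show "\<exists>k<5. h = g \<circ> side_reflection r k \<and> z \<in> g ` side r k \<and> w = z - 2 *\<^sub>R g (mid r k)"
        using key[OF k(1,2)] k l a by (auto intro!: exI[of _ k])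
    qed
    then show ?thesis unfolding glue' using True by (simp add: necklace_def nbN_def)
  qed (simp add: necklace_def)
  finally show "symclp (glue ?S) x y \<longleftrightarrow> fst x \<in> labels ?S \<and> snd x \<in> polygon ?S (fst x) \<and>
      (\<exists>k<5. orient (fst x) * (mid r k \<bullet> snd x) = apo r \<and> y = (nbN r (fst x) k, snd x - (2 * orient (fst x)) *\<^sub>R mid r k))"
    by (simp add: xy)
qed

section \<open>The covering, the hyperelliptic involution, deck transformations and the dihedral
  action\<close>

locale pentagon_surfaces =
  fixes r :: real
  assumes r0: "r \<noteq> 0"
begin

sublocale DP: pent "double_pentagon r" r "sgD r" nbD by (rule pent_double_pentagon[OF r0])
sublocale N: pent "necklace r" r orient "nbN r" by (rule pent_necklace[OF r0])

lemma labels_DP: "labels (double_pentagon r) = {pentagon r, uminus ` pentagon r}"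
  and polygon_DP: "polygon (double_pentagon r) P = P"
  and labels_N: "labels (necklace r) = dihedral r"
  and polygon_N: "polygon (necklace r) g = g ` pentagon r"
  by (simp_all add: double_pentagon_def necklace_def)

definition iota :: "(complex set \<times> complex) set \<Rightarrow> (complex set \<times> complex) set" where
  "iota c = map_prod ((`) uminus) uminus ` c"

text \<open>Composition on the right commutes with the composition on the left in
  \<open>nbN\<close>, so labels change while points of the plane stay put.\<close>

definition deck :: "complex \<Rightarrow> ((complex \<Rightarrow> complex) \<times> complex) set \<Rightarrow> ((complex \<Rightarrow> complex) \<times> complex) set" where
  "deck u c = map_prod (\<lambda>g. g \<circ> rot u) id ` c"

text \<open>The lifts of \<open>iota\<close>, one for each fifth root of unity
  \<open>u\<close>.\<close>

definition flip :: "complex \<Rightarrow> ((complex \<Rightarrow> complex) \<times> complex) set \<Rightarrow> ((complex \<Rightarrow> complex) \<times> complex) set" where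
  "flip u c = map_prod (\<lambda>g. g \<circ> rfl u) uminus ` c"

text \<open>Composition on the left moves the point together with its copy: the folded point
  remains, and directions are turned by \<open>h\<close>.\<close>

definition act :: "(complex \<Rightarrow> complex) \<Rightarrow> ((complex \<Rightarrow> complex) \<times> complex) set \<Rightarrow> ((complex \<Rightarrow> complex) \<times> complex) set" where
  "act h c = map_prod (\<lambda>g. h \<circ> g) h ` c"

lemma covering_map_prod: "covering r c = map_prod (\<lambda>g. g ` pentagon r) id ` c"
  unfolding covering_def by (auto simp: map_prod_def)

lemma orthogonal_uminus: "orthogonal_transformation (uminus :: complex \<Rightarrow> complex)"
  unfolding orthogonal_transformation by (simp add: linear_uminus)

lemma orthogonal_id': "orthogonal_transformation (id :: complex \<Rightarrow> complex)"
  by (simp add: id_def)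

lemma sgD_image: "g \<in> dihedral r \<Longrightarrow> sgD r (g ` pentagon r) = orient g"
  using orient_cases[OF r0, of g] pentagon_neq_uminus[OF r0] by (auto simp: sgD_def dihedral_pentagon[OF r0])

lemma image_label: "g \<in> dihedral r \<Longrightarrow> g ` pentagon r \<in> labels (double_pentagon r)"
  using orient_cases[OF r0, of g] by (auto simp: labels_DP dihedral_pentagon[OF r0])

lemma side_reflection_dihedral: "k < 5 \<Longrightarrow> side_reflection r k \<in> dihedral r"
  using dihedral.comp[OF dihedral.id] by fastforce

lemma covering_sides:
  assumes "g \<in> labels (necklace r)" "k < 5"
  shows "\<exists>k'<5. nbN r g k ` pentagon r = nbD (g ` pentagon r) k' \<and> id (orient g *\<^sub>R mid r k) = sgD r (g ` pentagon r) *\<^sub>R mid r k'"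
proof -
  have g: "g \<in> dihedral r" using assms by (simp add: labels_N)
  have "nbN r g k \<in> dihedral r" "orient (nbN r g k) = - orient g"
    using N.nb_labels[OF assms] N.nb_sg[OF assms] by (auto simp: labels_N)
  then have "nbN r g k ` pentagon r = uminus ` g ` pentagon r"
    using g by (simp add: dihedral_pentagon[OF r0] image_image)
  then show ?thesis using assms g by (intro exI[of _ k]) (simp add: nbD_def sgD_image)
qed

lemma covering_morphism: "pent_morphism (necklace r) r orient (nbN r) (double_pentagon r) (sgD r) nbD (\<lambda>g. g ` pentagon r) id"
  by (intro pent_morphism.intro pent_morphism_axioms.intro N.pent_axioms DP.pent_axioms) (use orthogonal_id' image_label covering_sides labels_N in auto)

lemma covering_regular: "regular (necklace r) g z \<Longrightarrow> regular (double_pentagon r) (g ` pentagon r) z"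
  and covering_cls: "regular (necklace r) g z \<Longrightarrow> covering r (N.cls g z) = DP.cls (g ` pentagon r) z"
  using pent_morphism.morphism[OF covering_morphism] by (simp_all add: covering_map_prod)

lemma covering_straight: "straight_on (necklace r) v I \<gamma> \<Longrightarrow> straight_on (double_pentagon r) v I (\<lambda>t. covering r (\<gamma> t))"
  using pent_morphism.straight[OF covering_morphism] by (simp add: covering_map_prod)

lemma iota_sides:
  assumes "P \<in> labels (double_pentagon r)" "k < 5"
  shows "\<exists>k'<5. uminus ` nbD P k = nbD (uminus ` P) k' \<and> - (sgD r P *\<^sub>R mid r k) = sgD r (uminus ` P) *\<^sub>R mid r k'"
  using assms DP.nb_sg[OF assms] by (intro exI[of _ k]) (simp add: nbD_def)

lemma uminus_label: "P \<in> labels (double_pentagon r) \<Longrightarrow> uminus ` P \<in> labels (double_pentagon r)"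
  using DP.nb_labels[of P 0] by (simp add: nbD_def)

lemma iota_morphism: "pent_morphism (double_pentagon r) r (sgD r) nbD (double_pentagon r) (sgD r) nbD ((`) uminus) uminus"
  by (intro pent_morphism.intro pent_morphism_axioms.intro N.pent_axioms DP.pent_axioms) (use orthogonal_uminus uminus_label iota_sides in auto)

lemma iota_cls: "regular (double_pentagon r) P z \<Longrightarrow> iota (DP.cls P z) = DP.cls (uminus ` P) (- z)"
  using pent_morphism.morphism[OF iota_morphism] by (simp add: iota_def)

lemma iota_straight: "straight_on (double_pentagon r) v I \<gamma> \<Longrightarrow> straight_on (double_pentagon r) (- v) I (\<lambda>t. iota (\<gamma> t))"
  using pent_morphism.straight[OF iota_morphism] by (simp add: iota_def)

lemma deck_sides:
  assumes "u ^ 5 = 1" "g \<in> labels (necklace r)" "k < 5"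
  shows "\<exists>k'<5. nbN r g k \<circ> rot u = nbN r (g \<circ> rot u) k' \<and> id (orient g *\<^sub>R mid r k) = orient (g \<circ> rot u) *\<^sub>R mid r k'"
  using assms orient_comp[OF r0 _ rot_dihedral[OF r0 assms(1)], of g]
  by (intro exI[of _ k]) (simp add: nbN_def comp_assoc labels_N)

lemma comp_rot_label: "u ^ 5 = 1 \<Longrightarrow> g \<in> labels (necklace r) \<Longrightarrow> g \<circ> rot u \<in> labels (necklace r)"
  by (simp add: labels_N dihedral_comp[OF r0] rot_dihedral[OF r0])

lemma comp_rfl_label: "u ^ 5 = 1 \<Longrightarrow> g \<in> labels (necklace r) \<Longrightarrow> g \<circ> rfl u \<in> labels (necklace r)"
  by (simp add: labels_N dihedral_comp[OF r0] rfl_dihedral[OF r0])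

lemma deck_morphism: "u ^ 5 = 1 \<Longrightarrow> pent_morphism (necklace r) r orient (nbN r) (necklace r) orient (nbN r) (\<lambda>g. g \<circ> rot u) id"
  by (intro pent_morphism.intro pent_morphism_axioms.intro N.pent_axioms DP.pent_axioms) (use orthogonal_id' comp_rot_label deck_sides in auto)

lemma deck_regular: "u ^ 5 = 1 \<Longrightarrow> regular (necklace r) g z \<Longrightarrow> regular (necklace r) (g \<circ> rot u) z"
  and deck_cls: "u ^ 5 = 1 \<Longrightarrow> regular (necklace r) g z \<Longrightarrow> deck u (N.cls g z) = N.cls (g \<circ> rot u) z"
  using pent_morphism.morphism[OF deck_morphism] by (simp_all add: deck_def)

lemma deck_straight: "u ^ 5 = 1 \<Longrightarrow> straight_on (necklace r) v I \<gamma> \<Longrightarrow> straight_on (necklace r) v I (\<lambda>t. deck u (\<gamma> t))"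
  using pent_morphism.straight[OF deck_morphism] by (simp add: deck_def)

lemma deck_deck: "deck u (deck v c) = deck (v * u) c"
  by (simp add: deck_def image_image map_prod_def case_prod_unfold comp_assoc rot_rot)

lemma deck_one [simp]: "deck 1 c = c"
  by (simp add: deck_def map_prod_def case_prod_unfold)

lemma flip_sides:
  assumes "u ^ 5 = 1" "g \<in> labels (necklace r)" "k < 5"
  shows "\<exists>k'<5. nbN r g k \<circ> rfl u = nbN r (g \<circ> rfl u) k' \<and> - (orient g *\<^sub>R mid r k) = orient (g \<circ> rfl u) *\<^sub>R mid r k'"
  using assms orient_comp[OF r0 _ rfl_dihedral[OF r0 assms(1)], of g]
  by (intro exI[of _ k]) (simp add: nbN_def comp_assoc labels_N)

lemma flip_morphism: "u ^ 5 = 1 \<Longrightarrow> pent_morphism (necklace r) r orient (nbN r) (necklace r) orient (nbN r) (\<lambda>g. g \<circ> rfl u) uminus"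
  by (intro pent_morphism.intro pent_morphism_axioms.intro N.pent_axioms DP.pent_axioms) (use orthogonal_uminus comp_rfl_label flip_sides in auto)

lemma flip_cls: "u ^ 5 = 1 \<Longrightarrow> regular (necklace r) g z \<Longrightarrow> flip u (N.cls g z) = N.cls (g \<circ> rfl u) (- z)"
  using pent_morphism.morphism[OF flip_morphism] by (simp add: flip_def)

lemma flip_straight: "u ^ 5 = 1 \<Longrightarrow> straight_on (necklace r) v I \<gamma> \<Longrightarrow> straight_on (necklace r) (- v) I (\<lambda>t. flip u (\<gamma> t))"
  using pent_morphism.straight[OF flip_morphism] by (simp add: flip_def)

lemma act_sides:
  assumes "h \<in> dihedral r" "g \<in> labels (necklace r)" "k < 5"
  shows "\<exists>k'<5. h \<circ> nbN r g k = nbN r (h \<circ> g) k' \<and> h (orient g *\<^sub>R mid r k) = orient (h \<circ> g) *\<^sub>R mid r k'"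
proof -
  obtain k' where k': "k' < 5" "h (mid r k) = orient h *\<^sub>R mid r k'" "h \<circ> side_reflection r k = side_reflection r k' \<circ> h"
    using dihedral_side(1)[OF r0 assms(1,3)] by blast
  have lin: "linear h" using dihedral_orthogonal[OF r0 assms(1)] by (simp add: orthogonal_transformation_def)
  have "h \<circ> nbN r g k = nbN r (h \<circ> g) k'" unfolding nbN_def comp_assoc[symmetric] k'(3) by (rule refl)
  moreover have "h (orient g *\<^sub>R mid r k) = orient (h \<circ> g) *\<^sub>R mid r k'"
    using orient_comp[OF r0 assms(1), of g] assms(2) by (simp add: labels_N linear_cmul[OF lin] k'(2) mult.commute)
  ultimately show ?thesis using k'(1) by blast
qed

lemma comp_label: "h \<in> dihedral r \<Longrightarrow> g \<in> labels (necklace r) \<Longrightarrow> h \<circ> g \<in> labels (necklace r)"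
  by (simp add: labels_N dihedral_comp[OF r0])

lemma act_morphism: "h \<in> dihedral r \<Longrightarrow> pent_morphism (necklace r) r orient (nbN r) (necklace r) orient (nbN r) (\<lambda>g. h \<circ> g) h"
  by (intro pent_morphism.intro pent_morphism_axioms.intro N.pent_axioms DP.pent_axioms) (use dihedral_orthogonal[OF r0] comp_label act_sides in auto)

lemma act_cls: "h \<in> dihedral r \<Longrightarrow> regular (necklace r) g z \<Longrightarrow> act h (N.cls g z) = N.cls (h \<circ> g) (h z)"
  using pent_morphism.morphism[OF act_morphism] by (simp add: act_def)

lemma act_straight: "h \<in> dihedral r \<Longrightarrow> straight_on (necklace r) v I \<gamma> \<Longrightarrow> straight_on (necklace r) (h v) I (\<lambda>t. act h (\<gamma> t))"
  using pent_morphism.straight[OF act_morphism] by (simp add: act_def)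

end

section \<open>Cylinders\<close>

text \<open>Since \<open>sgn 0 = 0\<close>, the jump at a height splits into two unit steps, one on
  arrival and one on departure; so the count is meaningful on the chords themselves.\<close>

lemma sgn_sum_step:
  fixes H :: "real set"
  assumes "finite H"
  shows "\<exists>\<epsilon>>0. \<forall>h. 0 < h \<and> h < \<epsilon> \<longrightarrow>
    (\<Sum>x\<in>H. sgn (y + h - x)) = (\<Sum>x\<in>H. sgn (y - x)) + (if y \<in> H then 1 else 0) \<and>
    (\<Sum>x\<in>H. sgn (y - h - x)) = (\<Sum>x\<in>H. sgn (y - x)) - (if y \<in> H then 1 else 0)"
  using assms
proof induction
  case empty
  show ?case by (intro exI[of _ 1]) simp
next
  case (insert x H)
  obtain \<epsilon> where e: "\<epsilon> > 0" "\<And>h. 0 < h \<Longrightarrow> h < \<epsilon> \<Longrightarrow>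
    (\<Sum>x\<in>H. sgn (y + h - x)) = (\<Sum>x\<in>H. sgn (y - x)) + (if y \<in> H then 1 else 0) \<and>
    (\<Sum>x\<in>H. sgn (y - h - x)) = (\<Sum>x\<in>H. sgn (y - x)) - (if y \<in> H then 1 else 0)"
    using insert.IH by blast
  define \<delta> where "\<delta> = (if y = x then \<epsilon> else min \<epsilon> \<bar>y - x\<bar>)"
  have d: "\<delta> > 0" "\<delta> \<le> \<epsilon>" using e(1) by (auto simp: \<delta>_def)
  show ?case
  proof (intro exI[of _ \<delta>] conjI allI impI)
    fix h assume h: "0 < h \<and> h < \<delta>"
    have 1: "sgn (y + h - x) = sgn (y - x) + (if y = x then 1 else 0)" "sgn (y - h - x) = sgn (y - x) - (if y = x then 1 else 0)"
      using h by (auto simp: \<delta>_def sgn_if split: if_splits)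
    have 2: "h < \<epsilon>" using h d by simp
    show "(\<Sum>x\<in>insert x H. sgn (y + h - x)) = (\<Sum>x\<in>insert x H. sgn (y - x)) + (if y \<in> insert x H then 1 else 0)"
      "(\<Sum>x\<in>insert x H. sgn (y - h - x)) = (\<Sum>x\<in>insert x H. sgn (y - x)) - (if y \<in> insert x H then 1 else 0)"
      using e(2)[of h] h 2 insert.hyps by (auto simp: 1)
  qed (fact d(1))
qed

lemma locally_mono_imp_mono:
  fixes g :: "real \<Rightarrow> real"
  assumes loc: "\<And>s. a < s \<Longrightarrow> s < b \<Longrightarrow> \<exists>\<epsilon>>0. \<forall>h. 0 < h \<and> h < \<epsilon> \<longrightarrow> g s \<le> g (s + h) \<and> g (s - h) \<le> g s"
    and "a < s" "s \<le> t" "t < b"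
  shows "g s \<le> g t"
proof -
  have "a < s \<and> t < b \<longrightarrow> g s \<le> g t"
  proof (rule Bolzano[where P = "\<lambda>x y. a < x \<and> y < b \<longrightarrow> g x \<le> g y"])
    show "s \<le> t" by fact
    fix x assume x: "s \<le> x" "x \<le> t"
    then obtain \<epsilon> where e: "\<epsilon> > 0" "\<And>h. 0 < h \<Longrightarrow> h < \<epsilon> \<Longrightarrow> g x \<le> g (x + h) \<and> g (x - h) \<le> g x"
      using loc[of x] assms(2-4) by (meson order_le_less_trans order_less_le_trans)
    have "g u \<le> g w" if uw: "u \<le> x" "x \<le> w" "w - u < \<epsilon>" for u w
    proof -
      have "g u \<le> g x" using e(2)[of "x - u"] uw by (cases "u = x") auto
      also have "g x \<le> g w" using e(2)[of "w - x"] uw by (cases "w = x") auto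
      finally show ?thesis .
    qed
    then show "\<exists>d>0. \<forall>u w. u \<le> x \<and> x \<le> w \<and> w - u < d \<longrightarrow> (a < u \<and> w < b \<longrightarrow> g u \<le> g w)"
      using e(1) by blast
  qed auto
  then show ?thesis using assms by simp
qed

context pent
begin

text \<open>Unique continuation in the transverse direction.\<close>

lemma family_agree:
  assumes "parallel_family S v a b F" "parallel_family S v a' b' F'"
    and "s1 \<in> {a<..<b}" "s1 \<in> {a'<..<b'}" "\<And>t. F s1 t = F' s1 t"
    and "s \<in> {a<..<b}" "s \<in> {a'<..<b'}"
  shows "F s t = F' s t"
proof (rule unique_continuation[where \<gamma> = "\<lambda>s. F s t" and \<gamma>' = "\<lambda>s. F' s t" and t = s1 and u = s
      and I = "{max a a'<..<min b b'}" and v = "\<i> * v"])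
  have "straight_on S (\<i> * v) {a<..<b} (\<lambda>s. F s t)" "straight_on S (\<i> * v) {a'<..<b'} (\<lambda>s. F' s t)"
    using assms(1,2) unfolding parallel_family_def by auto
  then show "straight_on S (\<i> * v) {max a a'<..<min b b'} (\<lambda>s. F s t)" "straight_on S (\<i> * v) {max a a'<..<min b b'} (\<lambda>s. F' s t)"
    by (auto elim!: straight_on_subset)
  show "s1 \<in> {max a a'<..<min b b'}" "s \<in> {max a a'<..<min b b'}" using assms by auto
qed (use assms in auto)

text \<open>The two families coincide on their overlap, so together they form one parallel family,
  and maximality applies to it.\<close>

lemma cylinder_contains_family:
  assumes cyl: "cylinder S v a b F" and fam: "parallel_family S v a' b' F'"
    and s1: "s1 \<in> {a<..<b}" "s1 \<in> {a'<..<b'}" "\<And>t. F s1 t = F' s1 t"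
  shows "a \<le> a' \<and> b' \<le> b"
proof -
  have famF: "parallel_family S v a b F" using cyl by (simp add: cylinder_def)
  define G where "G s = (if s \<in> {a<..<b} then F s else F' s)" for s
  have G1: "G s = F s" if "s \<in> {a<..<b}" for s using that by (simp add: G_def)
  have G2: "G s t = F' s t" if "s \<in> {a'<..<b'}" for s t
    using family_agree[OF famF fam s1] that by (simp add: G_def)
  have un: "{min a a'<..<max b b'} = {a<..<b} \<union> {a'<..<b'}" using s1 by auto
  have "parallel_family S v (min a a') (max b b') G"
    unfolding parallel_family_def
  proof (intro conjI ballI allI)
    show "min a a' < max b b'" using s1 by auto
    fix s assume "s \<in> {min a a'<..<max b b'}"
    then consider "s \<in> {a<..<b}" | "s \<in> {a'<..<b'}" unfolding un by blast
    then show "periodic_trajectory S v (G s)"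
    proof cases
      case 1 then show ?thesis using famF by (simp add: G1 parallel_family_def)
    next
      case 2
      then have "G s = F' s" using G2 by blast
      then show ?thesis using fam 2 by (simp add: parallel_family_def)
    qed
  next
    fix t
    have "straight_on S (\<i> * v) {a<..<b} (\<lambda>s. F s t)" "straight_on S (\<i> * v) {a'<..<b'} (\<lambda>s. F' s t)"
      using famF fam unfolding parallel_family_def by auto
    then have "straight_on S (\<i> * v) {a<..<b} (\<lambda>s. G s t)" "straight_on S (\<i> * v) {a'<..<b'} (\<lambda>s. G s t)"
      by (auto elim!: straight_on_cong simp: G1 G2)
    then show "straight_on S (\<i> * v) {min a a'<..<max b b'} (\<lambda>s. G s t)"
      unfolding un unfolding straight_on_ray by blast
  qed
  moreover have "min a a' \<le> a" "b \<le> max b b'" "\<forall>s\<in>{a<..<b}. G s = F s" using G1 by auto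
  ultimately have "min a a' = a \<and> max b b' = b" using cyl unfolding cylinder_def by blast
  then show ?thesis by linarith
qed

lemma norm_add_orthogonal_le:
  fixes v :: complex
  assumes "norm v = 1" shows "norm (x *\<^sub>R v + y *\<^sub>R (\<i> * v)) \<le> \<bar>x\<bar> + \<bar>y\<bar>"
  using norm_triangle_ineq[of "x *\<^sub>R v" "y *\<^sub>R (\<i> * v)"] assms by (simp add: norm_mult)

text \<open>Moving transversally inside the charts along \<open>F s1\<close> produces a parallel
  family of half-width \<open>\<rho>\<close> around it, which a maximal family must contain.\<close>

lemma cylinder_contains_chart_strip:
  assumes cyl: "cylinder S v a b F" and s1: "s1 \<in> {a<..<b}" and rho: "\<rho> > 0"
    and charts: "\<And>t. \<exists>\<Psi>. chart S \<rho> \<Psi> \<and> \<Psi> 0 = F s1 t"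
  shows "a \<le> s1 - \<rho> \<and> s1 + \<rho> \<le> b"
proof -
  have famF: "parallel_family S v a b F" using cyl by (simp add: cylinder_def)
  then have per: "periodic_trajectory S v (F s1)" using s1 by (simp add: parallel_family_def)
  then have v: "norm v = 1" and str: "straight_on S v UNIV (F s1)" by (auto simp: periodic_trajectory_def trajectory_def)
  obtain T where T: "T > 0" "\<And>t. F s1 (t + T) = F s1 t" using per by (auto simp: periodic_trajectory_def)
  \<comment> \<open>The chart is chosen from the point and not from the time, so the family inherits
    the period \<open>T\<close>.\<close>
  define ch where "ch x = (SOME \<Psi>. chart S \<rho> \<Psi> \<and> \<Psi> 0 = x)" for x
  define \<Psi> where "\<Psi> t = ch (F s1 t)" for t
  have Psi: "chart S \<rho> (\<Psi> t)" "\<Psi> t 0 = F s1 t" for t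
    using someI_ex[OF charts[of t]] by (auto simp: \<Psi>_def ch_def)
  define G where "G s t = \<Psi> t ((s - s1) *\<^sub>R (\<i> * v))" for s t
  have ball: "norm (x *\<^sub>R v + y *\<^sub>R (\<i> * v)) < \<rho>" if "\<bar>x\<bar> + \<bar>y\<bar> < \<rho>" for x y
    using norm_add_orthogonal_le[OF v, of x y] that by simp
  have along: "\<Psi> t (h *\<^sub>R v) = F s1 (t + h)" if h: "\<bar>h\<bar> < \<rho>" for t h
  proof -
    have "straight_on S v {-\<rho><..<\<rho>} (\<lambda>h. \<Psi> t (0 + h *\<^sub>R v))"
      using Psi(1) ball[of _ 0] by (intro chart_straight) auto
    moreover have "straight_on S v {-\<rho><..<\<rho>} (\<lambda>h. F s1 (h + t))"
      using straight_on_shift[OF str, of t] by (auto elim!: straight_on_subset)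
    ultimately have "\<Psi> t (0 + h *\<^sub>R v) = F s1 (h + t)"
      by (rule unique_continuation[where t = 0]) (use Psi(2) h rho in auto)
    then show ?thesis by (simp add: add.commute)
  qed
  \<comment> \<open>Charts at nearby times match: on a common transverse line both are straight, and
    they agree where it meets the trajectory.\<close>
  have shift: "\<Psi> (t + h) (\<sigma> *\<^sub>R (\<i> * v)) = \<Psi> t (h *\<^sub>R v + \<sigma> *\<^sub>R (\<i> * v))" if h: "\<bar>h\<bar> + \<bar>\<sigma>\<bar> < \<rho>" for t h \<sigma>
  proof -
    define I where "I = {\<bar>h\<bar> - \<rho> <..< \<rho> - \<bar>h\<bar>}"
    have "straight_on S (\<i> * v) I (\<lambda>\<sigma>. \<Psi> (t + h) (0 + \<sigma> *\<^sub>R (\<i> * v)))"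
      using Psi(1) ball[of 0] h by (intro chart_straight) (auto simp: I_def)
    moreover have "straight_on S (\<i> * v) I (\<lambda>\<sigma>. \<Psi> t (h *\<^sub>R v + \<sigma> *\<^sub>R (\<i> * v)))"
      using Psi(1) ball[of h] by (intro chart_straight) (auto simp: I_def)
    ultimately have "\<Psi> (t + h) (0 + \<sigma> *\<^sub>R (\<i> * v)) = \<Psi> t (h *\<^sub>R v + \<sigma> *\<^sub>R (\<i> * v))"
      by (rule unique_continuation[where t = 0]) (use h Psi(2) along in \<open>auto simp: I_def\<close>)
    then show ?thesis by simp
  qed
  have "parallel_family S v (s1 - \<rho>) (s1 + \<rho>) G"
    unfolding parallel_family_def
  proof (intro conjI ballI allI)
    show "s1 - \<rho> < s1 + \<rho>" using rho by simp
    fix s assume s: "s \<in> {s1 - \<rho><..<s1 + \<rho>}"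
    define \<sigma> where "\<sigma> = s - s1"
    have sig: "\<bar>\<sigma>\<bar> < \<rho>" using s by (auto simp: \<sigma>_def)
    have "straight_on S v UNIV (G s)" unfolding straight_on_ray
    proof
      fix t
      have r: "ray S w (\<lambda>h. \<Psi> t (\<sigma> *\<^sub>R (\<i> * v) + h *\<^sub>R w))" for w
        using Psi(1)[of t] ball[of 0 \<sigma>] sig unfolding chart_def by simp
      have "G s (t + h) = \<Psi> t (\<sigma> *\<^sub>R (\<i> * v) + h *\<^sub>R v)" if "\<bar>h\<bar> < \<rho> - \<bar>\<sigma>\<bar>" for h
        using shift[of h \<sigma> t] that by (simp add: G_def \<sigma>_def add.commute)
      from this this[of "- _"] show "ray S v (\<lambda>h. G s (t + h)) \<and> ray S (- v) (\<lambda>h. G s (t - h))"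
        using sig by (intro conjI ray_cong[OF r, where \<delta> = "\<rho> - \<bar>\<sigma>\<bar>"]) auto
    qed
    moreover have "G s (t + T) = G s t" for t by (simp add: G_def \<Psi>_def T)
    ultimately show "periodic_trajectory S v (G s)" unfolding periodic_trajectory_def trajectory_def using v T(1) by blast
  next
    fix t
    have "straight_on S (\<i> * v) {s1 - \<rho><..<s1 + \<rho>} (\<lambda>s. \<Psi> t ((- s1) *\<^sub>R (\<i> * v) + s *\<^sub>R (\<i> * v)))"
    proof (rule chart_straight[OF Psi(1)])
      fix s assume "s \<in> {s1 - \<rho><..<s1 + \<rho>}"
      then show "norm ((- s1) *\<^sub>R (\<i> * v) + s *\<^sub>R (\<i> * v)) < \<rho>"
        using ball[of 0 "s - s1"] by (auto simp: scaleR_left_diff_distrib)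
    qed
    then show "straight_on S (\<i> * v) {s1 - \<rho><..<s1 + \<rho>} (\<lambda>s. G s t)"
      by (simp add: G_def algebra_simps)
  qed
  moreover have "F s1 t = G s1 t" for t by (simp add: G_def Psi)
  moreover have "s1 \<in> {s1 - \<rho><..<s1 + \<rho>}" using rho by simp
  ultimately show ?thesis using cylinder_contains_family[OF cyl _ s1] by blast
qed

end

section \<open>Core curves are invariant under the hyperelliptic involution\<close>

lemma finite_avoid:
  fixes y :: real
  assumes "finite H" "y \<notin> H"
  shows "\<exists>\<delta>>0. \<forall>x. \<bar>x - y\<bar> < \<delta> \<longrightarrow> (\<forall>h\<in>H. sgn (x - h) = sgn (y - h))"
  using assms
proof induction
  case empty show ?case by (intro exI[of _ 1]) simp
next
  case (insert k H)
  have "y \<notin> H" using insert.prems by simp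
  from insert.IH[OF this] obtain \<delta> where d: "\<delta> > 0" "\<forall>x. \<bar>x - y\<bar> < \<delta> \<longrightarrow> (\<forall>h\<in>H. sgn (x - h) = sgn (y - h))"
    by (elim exE conjE)
  have "k \<noteq> y" using insert.prems by auto
  then have k: "sgn (x - k) = sgn (y - k)" if "\<bar>x - y\<bar> < \<bar>y - k\<bar>" for x
    using that by (auto simp: sgn_if)
  show ?case
  proof (intro exI[of _ "min \<delta> \<bar>y - k\<bar>"] conjI allI impI ballI)
    fix x h assume x: "\<bar>x - y\<bar> < min \<delta> \<bar>y - k\<bar>" and "h \<in> insert k H"
    then consider "h = k" | "h \<in> H" by blast
    then show "sgn (x - h) = sgn (y - h)"
    proof cases
      case 1 then show ?thesis using k x by simp
    next
      case 2
      have "\<bar>x - y\<bar> < \<delta>" using x by simp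
      then show ?thesis using d(2) 2 by blast
    qed
  qed (use d(1) \<open>k \<noteq> y\<close> in simp)
qed

section \<open>The level function of a closed geodesic\<close>

locale closed_geodesic = pentagon_surfaces +
  fixes p :: "real \<Rightarrow> (complex set \<times> complex) set" and v :: complex and T :: real
  assumes v: "norm v = 1" and str: "straight_on (double_pentagon r) v UNIV p"
    and T: "T > 0" and per: "\<And>t. p (t + T) = p t"
begin

abbreviation Q :: "complex set" where "Q \<equiv> pentagon r"
abbreviation Q' :: "complex set" where "Q' \<equiv> uminus ` pentagon r"

definition ht :: "complex \<Rightarrow> real" where "ht z = z \<bullet> (\<i> * v)"

definition HQ :: "real set" where "HQ = {ht z | z. DP.cls Q z \<in> range p}"
text \<open>The involution carries \<open>Q'\<close> to \<open>Q\<close> and negates heights, so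
  these are the heights in \<open>Q\<close> of the image of \<open>p\<close>.\<close>

definition HQ' :: "real set" where "HQ' = {- ht z | z. DP.cls Q' z \<in> range p}"

text \<open>Twice the number of chords of \<open>p\<close> below a given height in the upper pentagon, minus the same
  number for the image of \<open>p\<close> under the hyperelliptic involution, up to an additive constant.\<close>

definition level :: "real \<Rightarrow> real" where
  "level y = (\<Sum>h\<in>HQ. sgn (y - h)) - (\<Sum>h\<in>HQ'. sgn (y - h))"

lemma ht_simps: "ht (x + y) = ht x + ht y" "ht (x - y) = ht x - ht y" "ht (- x) = - ht x" "ht (a *\<^sub>R x) = a * ht x" "ht v = 0"
  by (simp_all add: ht_def inner_add_left inner_diff_left)

lemma ht_iv: "ht (\<i> * v) = 1"
  using v by (simp add: ht_def dot_square_norm norm_mult)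

lemma same_ht: "ht z = ht w \<Longrightarrow> \<exists>\<tau>. w = z + \<tau> *\<^sub>R v"
  using same_height[OF v, of z w] unfolding ht_def by blast

lemma Q_label: "Q \<in> labels (double_pentagon r)" "Q' \<in> labels (double_pentagon r)"
  by (auto simp: labels_DP)

lemma sgD_Q [simp]: "sgD r Q = 1" "sgD r Q' = -1"
  using pentagon_neq_uminus[OF r0] by (auto simp: sgD_def)

lemma finite_H: "finite HQ" "finite HQ'"
proof -
  have 1: "finite {z \<bullet> (\<i> * v) | z. DP.cls P z \<in> range p}" for P
    by (rule DP.finite_heights[OF str T per]) simp
  show "finite HQ" using 1 by (simp add: HQ_def ht_def)
  have "HQ' = uminus ` {z \<bullet> (\<i> * v) | z. DP.cls Q' z \<in> range p}" by (auto simp: HQ'_def ht_def)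
  then show "finite HQ'" using 1 by simp
qed

lemma chord_in:
  assumes "straight_on (double_pentagon r) v UNIV \<gamma>" "\<gamma> t = DP.cls P z" "P \<in> {Q, Q'}" "z \<in> P" "w \<in> P" "ht z = ht w"
  shows "DP.cls P w \<in> range \<gamma>" "regular (double_pentagon r) P w"
proof -
  obtain \<tau> where w: "w = z + \<tau> *\<^sub>R v" using same_ht assms by blast
  have P: "P \<in> labels (double_pentagon r)" using assms(3) by (simp add: labels_DP)
  have "\<gamma> (t + \<tau>) = DP.cls P w" unfolding w
    by (rule DP.chord[OF assms(1,2) P]) (use assms in \<open>simp_all add: polygon_DP flip: w\<close>)
  then show "DP.cls P w \<in> range \<gamma>" by (metis rangeI)
  show "regular (double_pentagon r) P w" unfolding w
    by (rule DP.chord_regular[OF assms(1,2) P]) (use assms in \<open>simp_all add: polygon_DP flip: w\<close>)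
qed

lemma traj_mem:
  assumes "straight_on (double_pentagon r) v' UNIV \<gamma>" "\<gamma> t = DP.cls P z"
  shows "regular (double_pentagon r) P z" "z \<in> P" "P \<in> {Q, Q'}"
proof -
  show "regular (double_pentagon r) P z" using assms DP.straight_on_regular[OF assms(1), of t] DP.regular_cong by (metis UNIV_I)
  then show "z \<in> P" "P \<in> {Q, Q'}" by (auto simp: regular_def polygon_DP labels_DP)
qed

lemma vertex_not_regular: "\<not> regular (double_pentagon r) Q (vertex r k)" "\<not> regular (double_pentagon r) Q' (- vertex r k)"
  using vertex_extreme[of r k] Q_label by (simp_all add: regular_def DP.extreme_polygon)

text \<open>A chord at the height of a vertex would contain that vertex.\<close>

lemma vertex_ht: "ht (vertex r k) \<notin> HQ" "ht (vertex r k) \<notin> HQ'"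
proof
  assume "ht (vertex r k) \<in> HQ"
  then obtain z t where z: "ht z = ht (vertex r k)" "p t = DP.cls Q z" by (auto simp: HQ_def)
  show False using chord_in(2)[OF str z(2) _ traj_mem(2)[OF str z(2)] vertex_in_pentagon z(1)] vertex_not_regular by simp
next
  show "ht (vertex r k) \<notin> HQ'"
  proof
    assume "ht (vertex r k) \<in> HQ'"
    then obtain z t where z: "ht z = ht (- vertex r k)" "p t = DP.cls Q' z" by (auto simp: HQ'_def ht_simps)
    have "- vertex r k \<in> Q'" using vertex_in_pentagon by blast
    then show False using chord_in(2)[OF str z(2) _ traj_mem(2)[OF str z(2)] _ z(1)] vertex_not_regular by simp
  qed
qed

text \<open>A chord in the height range of side \<open>k\<close> meets this side, at
  \<open>z'\<close>, and passes there between \<open>Q\<close> and \<open>Q'\<close>. On heights the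
  crossing is the reflection in the height of the midpoint.\<close>

lemma H_swap:
  assumes k: "k < 5" and h: "\<bar>h - ht (mid r k)\<bar> \<le> \<bar>ht (half_side r k)\<bar>"
  shows "h \<in> HQ \<longleftrightarrow> 2 * ht (mid r k) - h \<in> HQ'"
proof -
  \<comment> \<open>If \<open>v\<close> is parallel to the side, its range is a single height and
    \<open>z'\<close> may be the midpoint, hence the value 0.\<close>
  define \<mu> where "\<mu> = (if ht (half_side r k) = 0 then 0 else (h - ht (mid r k)) / ht (half_side r k))"
  define z' where "z' = mid r k + \<mu> *\<^sub>R half_side r k"
  have mu: "\<bar>\<mu>\<bar> \<le> 1" "\<mu> * ht (half_side r k) = h - ht (mid r k)" using h by (auto simp: \<mu>_def field_simps abs_divide)
  have ht': "ht z' = h" by (simp add: z'_def ht_simps mu)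
  have "z' = (1 - (1 + \<mu>) / 2) *\<^sub>R (mid r k - half_side r k) + ((1 + \<mu>) / 2) *\<^sub>R (mid r k + half_side r k)"
    by (simp add: z'_def scaleR_conv_of_real field_simps)
  then have side: "z' \<in> side r k" unfolding side_mid in_segment using mu(1) by (intro exI[of _ "(1 + \<mu>) / 2"]) auto
  then have z': "z' \<in> Q" "mid r k \<bullet> z' = apo r" using side_tight[OF r0 k] by auto
  have tight: "DP.tight Q k z'" using z' by (simp add: DP.tight_def)
  have opp: "DP.opp Q k z' = z' - 2 *\<^sub>R mid r k" by (simp add: DP.opp_def)
  have nbQ: "nbD Q k = Q'" "nbD Q' k = Q" by (simp_all add: nbD_def image_image)
  show ?thesis
  proof
    assume "h \<in> HQ"
    then obtain z t where z: "ht z = ht z'" "p t = DP.cls Q z" by (auto simp: HQ_def ht')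
    have c: "DP.cls Q z' \<in> range p" "regular (double_pentagon r) Q z'"
      using chord_in[OF str z(2) _ traj_mem(2)[OF str z(2)] z'(1) z(1)] by auto
    have "DP.cls Q' (z' - 2 *\<^sub>R mid r k) \<in> range p" using DP.cls_partner[OF c(2) k tight] c(1) by (simp add: nbQ opp)
    then show "2 * ht (mid r k) - h \<in> HQ'" unfolding HQ'_def by (intro CollectI exI[of _ "z' - 2 *\<^sub>R mid r k"]) (simp add: ht_simps ht')
  next
    assume "2 * ht (mid r k) - h \<in> HQ'"
    then obtain w t where w: "2 * ht (mid r k) - h = - ht w" "p t = DP.cls Q' w" by (auto simp: HQ'_def)
    have e: "ht w = ht (z' - 2 *\<^sub>R mid r k)" using w(1) by (simp add: ht_simps ht')
    have "- (z' - 2 *\<^sub>R mid r k) \<in> side r k" using opposite_side[OF side] by simp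
    then have m: "- (z' - 2 *\<^sub>R mid r k) \<in> Q" "mid r k \<bullet> (- (z' - 2 *\<^sub>R mid r k)) = apo r" using side_tight[OF r0 k] by auto
    have m1: "z' - 2 *\<^sub>R mid r k \<in> Q'" using m(1) by (metis image_eqI minus_minus)
    have c: "DP.cls Q' (z' - 2 *\<^sub>R mid r k) \<in> range p" "regular (double_pentagon r) Q' (z' - 2 *\<^sub>R mid r k)"
      using chord_in[OF str w(2) _ traj_mem(2)[OF str w(2)] m1 e] by auto
    have t: "DP.tight Q' k (z' - 2 *\<^sub>R mid r k)" using m(2) by (simp add: DP.tight_def inner_diff_right)
    have "DP.cls Q z' \<in> range p" using DP.cls_partner[OF c(2) k t] c(1) by (simp add: nbQ DP.opp_def)
    then show "h \<in> HQ" unfolding HQ_def using ht' by blast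
  qed
qed

text \<open>Heights outside the range \<open>R\<close> of the side lie on the same side of
  \<open>y\<close> and of its mirror image. Inside \<open>R\<close> the reflection exchanges
  \<open>HQ\<close> and \<open>HQ'\<close> and reverses signs, which the minus sign in
  \<open>level\<close> compensates.\<close>

lemma level_symmetric:
  assumes k: "k < 5" and y: "\<bar>y - ht (mid r k)\<bar> \<le> \<bar>ht (half_side r k)\<bar>"
  shows "level (2 * ht (mid r k) - y) = level y"
proof -
  define m where "m = ht (mid r k)"
  define R where "R = {h. \<bar>h - m\<bar> \<le> \<bar>ht (half_side r k)\<bar>}"
  have split: "(\<Sum>h\<in>H. sgn (x - h)) = (\<Sum>h\<in>H \<inter> R. sgn (x - h)) + (\<Sum>h\<in>H - R. sgn (x - h))" if "finite H" for H x
    using that by (simp add: sum.Int_Diff[of H _ R])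
  have out: "(\<Sum>h\<in>H - R. sgn (2 * m - y - h)) = (\<Sum>h\<in>H - R. sgn (y - h))" for H
    by (rule sum.cong) (use y in \<open>auto simp: R_def m_def sgn_if split: if_splits\<close>)
  have swap: "(\<Sum>h\<in>HQ \<inter> R. sgn (x - h)) = - (\<Sum>h\<in>HQ' \<inter> R. sgn (2 * m - x - h))" for x
  proof -
    have "(\<Sum>h\<in>HQ \<inter> R. sgn (x - h)) = (\<Sum>h\<in>HQ' \<inter> R. sgn (x - (2 * m - h)))"
      by (rule sum.reindex_bij_witness[of _ "\<lambda>h. 2 * m - h" "\<lambda>h. 2 * m - h"])
        (use H_swap[OF k] in \<open>force simp: R_def m_def abs_le_iff\<close>)+
    also have "\<dots> = (\<Sum>h\<in>HQ' \<inter> R. - sgn (2 * m - x - h))" by (rule sum.cong) (auto simp: sgn_if)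
    finally show ?thesis by (simp add: sum_negf)
  qed
  have "level (2 * m - y) = level y"
    unfolding level_def split[OF finite_H(1)] split[OF finite_H(2)] out
    using swap[of y] swap[of "2 * m - y"] by simp
  then show ?thesis by (simp add: m_def)
qed

definition base :: real where "base = level (ht (vertex r 0))"

text \<open>The two ends of a side have mirror-image heights; the equality is passed on around the
  pentagon.\<close>

lemma level_vertex: "level (ht (vertex r k)) = base"
proof -
  have step: "level (ht (vertex r (Suc k))) = level (ht (vertex r k))" if "k < 5" for k
  proof -
    have "vertex r k = mid r k - half_side r k" "vertex r (Suc k) = mid r k + half_side r k"
      by (simp_all add: mid_def half_side_def field_simps)
    then have "ht (vertex r k) = ht (mid r k) - ht (half_side r k)" "ht (vertex r (Suc k)) = ht (mid r k) + ht (half_side r k)"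
      by (simp_all add: ht_simps)
    then show ?thesis using level_symmetric[OF that, of "ht (vertex r k)"] by simp
  qed
  have "level (ht (vertex r k)) = base" if "k \<le> 5" for k
    using that by (induction k) (auto simp: base_def step)
  then have "level (ht (vertex r (k mod 5))) = base" by simp
  then show ?thesis by (simp add: vertex_mod)
qed

lemma level_near_vertex: "\<exists>\<delta>>0. \<forall>k y. \<bar>y - ht (vertex r k)\<bar> < \<delta> \<longrightarrow> level y = base"
proof -
  have one: "\<exists>\<delta>>0. \<forall>y. \<bar>y - ht (vertex r k)\<bar> < \<delta> \<longrightarrow> level y = base" for k
  proof -
    obtain \<delta>1 where d1: "\<delta>1 > 0" "\<And>x. \<bar>x - ht (vertex r k)\<bar> < \<delta>1 \<Longrightarrow> \<forall>h\<in>HQ. sgn (x - h) = sgn (ht (vertex r k) - h)"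
      using finite_avoid[OF finite_H(1) vertex_ht(1)] by blast
    obtain \<delta>2 where d2: "\<delta>2 > 0" "\<And>x. \<bar>x - ht (vertex r k)\<bar> < \<delta>2 \<Longrightarrow> \<forall>h\<in>HQ'. sgn (x - h) = sgn (ht (vertex r k) - h)"
      using finite_avoid[OF finite_H(2) vertex_ht(2)] by blast
    have "level y = base" if "\<bar>y - ht (vertex r k)\<bar> < min \<delta>1 \<delta>2" for y
    proof -
      have "level y = level (ht (vertex r k))" unfolding level_def using d1(2)[of y] d2(2)[of y] that by simp
      then show ?thesis by (simp add: level_vertex)
    qed
    then show ?thesis using d1 d2 by (intro exI[of _ "min \<delta>1 \<delta>2"]) simp
  qed
  then obtain d where d: "\<And>k. d k > 0" "\<And>k y. \<bar>y - ht (vertex r k)\<bar> < d k \<Longrightarrow> level y = base" by metis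
  show ?thesis
  proof (intro exI[of _ "Min (d ` {..<5})"] conjI allI impI)
    show "Min (d ` {..<5}) > 0" using d(1) by (subst Min_gr_iff) (auto simp: lessThan_empty_iff)
    fix k y assume y: "\<bar>y - ht (vertex r k)\<bar> < Min (d ` {..<5})"
    have "Min (d ` {..<5}) \<le> d (k mod 5)" by (rule Min_le) auto
    with y have "\<bar>y - ht (vertex r k)\<bar> < d (k mod 5)" by linarith
    then show "level y = base" using d(2)[of y "k mod 5"] by (simp add: vertex_mod)
  qed
qed

definition lev :: "complex set \<Rightarrow> complex \<Rightarrow> real" where
  "lev P z = level (sgD r P * ht z)"

text \<open>Crossing a side replaces the signed height by its mirror image in the height of the
  midpoint, where \<open>level_symmetric\<close> applies.\<close>

lemma lev_cong:
  assumes reg: "regular (double_pentagon r) P z" and eq: "DP.cls P z = DP.cls P' w"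
  shows "lev P z = lev P' w"
proof -
  have P: "P \<in> labels (double_pentagon r)" using reg by (rule DP.regular_label)
  from eq consider "P' = P" "w = z" | k where "k < 5" "DP.tight P k z" "P' = nbD P k" "w = DP.opp P k z"
    using DP.cls_eq_iff[OF reg] by metis
  then show ?thesis
  proof cases
    case 2
    have s: "sgD r P' = - sgD r P" using DP.nb_sg[OF P 2(1)] 2 by simp
    have sw: "sgD r P' * ht w = 2 * ht (mid r k) - sgD r P * ht z"
      using DP.sg_sq[OF P] by (simp add: s 2(4) DP.opp_def ht_simps algebra_simps)
    have "sgD r P *\<^sub>R z \<in> side r k" using DP.regular_mem[OF reg] 2(2)
      by (simp add: side_tight[OF r0 2(1)] DP.mem_polygon_pentagon[OF P] DP.tight_def)
    then obtain u where u: "0 \<le> u" "u \<le> 1" "sgD r P *\<^sub>R z = (1 - u) *\<^sub>R (mid r k - half_side r k) + u *\<^sub>R (mid r k + half_side r k)"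
      unfolding side_mid in_segment by blast
    have "sgD r P * ht z = ht (sgD r P *\<^sub>R z)" by (simp add: ht_simps)
    also have "\<dots> = ht (mid r k) + (2 * u - 1) * ht (half_side r k)" unfolding u(3) by (simp only: ht_simps) (simp add: algebra_simps)
    finally have e: "sgD r P * ht z - ht (mid r k) = (2 * u - 1) * ht (half_side r k)" by simp
    have "\<bar>2 * u - 1\<bar> * \<bar>ht (half_side r k)\<bar> \<le> 1 * \<bar>ht (half_side r k)\<bar>" using u by (intro mult_right_mono) auto
    then have "\<bar>sgD r P * ht z - ht (mid r k)\<bar> \<le> \<bar>ht (half_side r k)\<bar>" unfolding e by (simp add: abs_mult)
    then show ?thesis unfolding lev_def sw using level_symmetric[OF 2(1)] by simp
  qed simp
qed

definition Lev :: "(complex set \<times> complex) set \<Rightarrow> real" where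
  "Lev c = (case SOME x. x \<in> c of (P, z) \<Rightarrow> lev P z)"

lemma Lev_cls:
  assumes "regular (double_pentagon r) P z" shows "Lev (DP.cls P z) = lev P z"
proof -
  obtain P' w where w: "(SOME x. x \<in> DP.cls P z) = (P', w)" by (cases "SOME x. x \<in> DP.cls P z")
  have "(SOME x. x \<in> DP.cls P z) \<in> DP.cls P z" by (rule someI[where x = "(P, z)"]) simp
  then have "DP.cls P z = DP.cls P' w" unfolding w by (simp add: surface_point_mem)
  then have "lev P z = lev P' w" by (rule lev_cong[OF assms])
  then show ?thesis unfolding Lev_def w by simp
qed

lemma Lev_straight:
  assumes "straight_on (double_pentagon r) v UNIV \<gamma>"
  shows "Lev (\<gamma> t) = Lev (\<gamma> u)"
proof (rule locally_constant_interval[where I = UNIV and f = "\<lambda>t. Lev (\<gamma> t)"])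
  fix t :: real
  have one: "\<exists>\<epsilon>>0. \<forall>s. 0 < s \<and> s < \<epsilon> \<longrightarrow> Lev (\<gamma>' s) = Lev (\<gamma>' 0)" if rr: "ray (double_pentagon r) w \<gamma>'" "ht w = 0" for w \<gamma>'
  proof -
    obtain P z \<epsilon> where e: "\<epsilon> > 0" "\<And>s. s \<in> {0..\<epsilon>} \<Longrightarrow> regular (double_pentagon r) P (z + s *\<^sub>R w) \<and> \<gamma>' s = DP.cls P (z + s *\<^sub>R w)"
      using rr(1) unfolding ray_def by blast
    have "Lev (\<gamma>' s) = lev P z" if "s \<in> {0..\<epsilon>}" for s
      using e(2)[OF that] rr(2) by (simp add: Lev_cls lev_def ht_simps)
    then show ?thesis using e(1) by (intro exI[of _ \<epsilon>]) simp
  qed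
  have r: "ray (double_pentagon r) v (\<lambda>s. \<gamma> (t + s))" "ray (double_pentagon r) (- v) (\<lambda>s. \<gamma> (t - s))"
    using assms unfolding straight_on_ray by auto
  obtain \<epsilon>1 where "\<epsilon>1 > 0" "\<forall>s. 0 < s \<and> s < \<epsilon>1 \<longrightarrow> Lev (\<gamma> (t + s)) = Lev (\<gamma> t)" using one[OF r(1)] by (auto simp: ht_simps)
  moreover obtain \<epsilon>2 where "\<epsilon>2 > 0" "\<forall>s. 0 < s \<and> s < \<epsilon>2 \<longrightarrow> Lev (\<gamma> (t - s)) = Lev (\<gamma> t)" using one[OF r(2)] by (auto simp: ht_simps)
  ultimately show "\<exists>\<epsilon>>0. \<forall>s. 0 < s \<and> s < \<epsilon> \<longrightarrow> (t + s \<in> UNIV \<longrightarrow> Lev (\<gamma> (t + s)) = Lev (\<gamma> t)) \<and> (t - s \<in> UNIV \<longrightarrow> Lev (\<gamma> (t - s)) = Lev (\<gamma> t))"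
    by (intro exI[of _ "min \<epsilon>1 \<epsilon>2"]) auto
qed auto

text \<open>Off the level \<open>base\<close> the signed height keeps a distance
  \<open>\<delta>\<close> from all vertex heights. Heights are 1-Lipschitz, so the point keeps that
  distance from the vertices.\<close>

lemma charts_off_base:
  "\<exists>\<rho>>0. \<forall>P z. regular (double_pentagon r) P z \<and> lev P z \<noteq> base \<longrightarrow> (\<exists>\<Psi>. chart (double_pentagon r) \<rho> \<Psi> \<and> \<Psi> 0 = DP.cls P z)"
proof -
  obtain \<delta> where d: "\<delta> > 0" "\<And>k y. \<bar>y - ht (vertex r k)\<bar> < \<delta> \<Longrightarrow> level y = base" using level_near_vertex by blast
  obtain \<rho> where rho: "\<rho> > 0" "\<forall>P\<in>labels (double_pentagon r). \<forall>z\<in>polygon (double_pentagon r) P.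
     (\<forall>k. dist (sgD r P *\<^sub>R z) (vertex r k) \<ge> \<delta>) \<longrightarrow> (\<exists>\<Psi>. chart (double_pentagon r) \<rho> \<Psi> \<and> \<Psi> 0 = DP.cls P z)"
    using DP.uniform_charts[OF d(1)] by (elim exE conjE)
  have "\<exists>\<Psi>. chart (double_pentagon r) \<rho> \<Psi> \<and> \<Psi> 0 = DP.cls P z" if reg: "regular (double_pentagon r) P z" and ne: "lev P z \<noteq> base" for P z
  proof (rule rho(2)[THEN bspec, OF DP.regular_label[OF reg], THEN bspec, OF DP.regular_mem[OF reg], THEN mp], rule allI)
    fix k
    have "\<bar>ht (sgD r P *\<^sub>R z - vertex r k)\<bar> \<le> norm (sgD r P *\<^sub>R z - vertex r k) * norm (\<i> * v)"
      unfolding ht_def by (rule Cauchy_Schwarz_ineq2)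
    then have "\<bar>sgD r P * ht z - ht (vertex r k)\<bar> \<le> dist (sgD r P *\<^sub>R z) (vertex r k)"
      using v by (simp add: ht_simps norm_mult dist_norm)
    moreover have "\<not> \<bar>sgD r P * ht z - ht (vertex r k)\<bar> < \<delta>" using d(2)[of "sgD r P * ht z" k] ne by (auto simp: lev_def)
    ultimately show "dist (sgD r P *\<^sub>R z) (vertex r k) \<ge> \<delta>" by linarith
  qed
  then show ?thesis using rho(1) by blast
qed

text \<open>As \<open>F s\<close> avoids the image of \<open>p\<close>, the only chord that can be
  met is one of \<open>p\<close>. In \<open>Q\<close> the signed height grows and this chord counts
  positively; in \<open>Q'\<close> the signed height falls and it counts negatively. So the level
  rises in both.\<close>

lemma Lev_step:
  assumes fam: "parallel_family (double_pentagon r) v a b F" and s: "s \<in> {a<..<b}"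
    and disj: "\<And>t t'. F s t \<noteq> iota (p t')"
  shows "\<exists>\<epsilon>>0. \<forall>h. 0 < h \<and> h < \<epsilon> \<longrightarrow> Lev (F s 0) \<le> Lev (F (s + h) 0) \<and> Lev (F (s - h) 0) \<le> Lev (F s 0) \<and>
     (F s 0 \<in> range p \<longrightarrow> Lev (F s 0) < Lev (F (s + h) 0) \<and> Lev (F (s - h) 0) < Lev (F s 0))"
proof -
  have strF: "straight_on (double_pentagon r) v UNIV (F s)"
    using fam s by (auto simp: parallel_family_def periodic_trajectory_def trajectory_def)
  have r: "ray (double_pentagon r) (\<i> * v) (\<lambda>h. F (s + h) 0)" "ray (double_pentagon r) (- (\<i> * v)) (\<lambda>h. F (s - h) 0)"
    using fam s unfolding parallel_family_def straight_on_ray by auto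
  have one: "\<exists>\<epsilon>>0. \<forall>h. 0 < h \<and> h < \<epsilon> \<longrightarrow> \<sigma> * (Lev (\<gamma> h) - Lev (F s 0)) \<ge> 0 \<and> (F s 0 \<in> range p \<longrightarrow> \<sigma> * (Lev (\<gamma> h) - Lev (F s 0)) > 0)"
    if rr: "ray (double_pentagon r) (\<sigma> *\<^sub>R (\<i> * v)) \<gamma>" "\<gamma> 0 = F s 0" and sigma: "\<sigma> = 1 \<or> \<sigma> = -1" for \<sigma> \<gamma>
  proof -
    obtain P z \<epsilon> where e: "\<epsilon> > 0" "\<And>h. h \<in> {0..\<epsilon>} \<Longrightarrow> regular (double_pentagon r) P (z + h *\<^sub>R (\<sigma> *\<^sub>R (\<i> * v))) \<and> \<gamma> h = DP.cls P (z + h *\<^sub>R (\<sigma> *\<^sub>R (\<i> * v)))"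
      using rr(1) unfolding ray_def by blast
    have reg: "regular (double_pentagon r) P z" and F0: "F s 0 = DP.cls P z" using e(2)[of 0] e(1) rr(2) by auto
    have zP: "z \<in> P" and P: "P \<in> {Q, Q'}" using traj_mem[OF strF F0] by auto
    \<comment> \<open>A height in the excluded set would put a chord of the image of
      \<open>p\<close> at the height of \<open>z\<close>, and by \<open>chord_in\<close> it would be
      the chord of \<open>F s\<close>.\<close>
    have no: "sgD r P * ht z \<notin> (if P = Q then HQ' else HQ)"
    proof
      assume a: "sgD r P * ht z \<in> (if P = Q then HQ' else HQ)"
      have "\<exists>w t'. p t' = DP.cls (uminus ` P) w \<and> ht (- w) = ht z"
      proof (cases "P = Q")
        case True
        then show ?thesis using a by (auto simp: HQ'_def ht_simps) metis
      next
        case False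
        then have "P = Q'" using P by blast
        have "uminus ` P = Q" using \<open>P = Q'\<close> by (simp add: image_image)
        moreover have "- ht z \<in> HQ" using a False \<open>P = Q'\<close> by simp
        then obtain w t' where "- ht z = ht w" "p t' = DP.cls Q w" by (auto simp: HQ_def)
        ultimately show ?thesis by (intro exI[of _ w] exI[of _ t']) (simp add: ht_simps)
      qed
      then obtain w t' where w: "p t' = DP.cls (uminus ` P) w" "ht z = ht (- w)" by metis
      have wr: "regular (double_pentagon r) (uminus ` P) w" "w \<in> uminus ` P" using traj_mem[OF str w(1)] by auto
      then have "iota (p t') = DP.cls P (- w)" unfolding w(1) by (simp add: iota_cls image_image)
      moreover have "DP.cls P (- w) \<in> range (F s)"
        by (rule chord_in(1)[OF strF F0 P zP _ w(2)]) (use wr(2) in auto)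
      ultimately show False using disj by (metis imageE)
    qed
    have yes: "sgD r P * ht z \<in> (if P = Q then HQ else HQ')" if "F s 0 \<in> range p"
    proof -
      have "DP.cls P z \<in> range p" using that F0 by simp
      then show ?thesis using P by (auto simp: HQ_def HQ'_def)
    qed
    define y where "y = sgD r P * ht z"
    obtain \<epsilon>1 where e1: "\<epsilon>1 > 0" "\<And>h. 0 < h \<Longrightarrow> h < \<epsilon>1 \<Longrightarrow>
        (\<Sum>x\<in>HQ. sgn (y + h - x)) = (\<Sum>x\<in>HQ. sgn (y - x)) + (if y \<in> HQ then 1 else 0) \<and>
        (\<Sum>x\<in>HQ. sgn (y - h - x)) = (\<Sum>x\<in>HQ. sgn (y - x)) - (if y \<in> HQ then 1 else 0)"
      using sgn_sum_step[OF finite_H(1), of y] by blast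
    obtain \<epsilon>2 where e2: "\<epsilon>2 > 0" "\<And>h. 0 < h \<Longrightarrow> h < \<epsilon>2 \<Longrightarrow>
        (\<Sum>x\<in>HQ'. sgn (y + h - x)) = (\<Sum>x\<in>HQ'. sgn (y - x)) + (if y \<in> HQ' then 1 else 0) \<and>
        (\<Sum>x\<in>HQ'. sgn (y - h - x)) = (\<Sum>x\<in>HQ'. sgn (y - x)) - (if y \<in> HQ' then 1 else 0)"
      using sgn_sum_step[OF finite_H(2), of y] by blast
    show ?thesis
    proof (intro exI[of _ "min \<epsilon> (min \<epsilon>1 \<epsilon>2)"] conjI allI impI)
      fix h assume h: "0 < h \<and> h < min \<epsilon> (min \<epsilon>1 \<epsilon>2)"
      have "regular (double_pentagon r) P (z + h *\<^sub>R (\<sigma> *\<^sub>R (\<i> * v)))" "\<gamma> h = DP.cls P (z + h *\<^sub>R (\<sigma> *\<^sub>R (\<i> * v)))" using e(2)[of h] h by auto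
      then have Lh: "Lev (\<gamma> h) = level (y + sgD r P * \<sigma> * h)"
        by (simp add: Lev_cls lev_def ht_simps ht_iv y_def algebra_simps)
      have L0: "Lev (F s 0) = level y" by (simp add: F0 Lev_cls[OF reg] lev_def y_def)
      have s1: "level (y + h) - level y = (if y \<in> HQ then 1 else 0) - (if y \<in> HQ' then 1 else 0)"
        "level (y - h) - level y = (if y \<in> HQ' then 1 else 0) - (if y \<in> HQ then 1 else 0)"
        using e1(2)[of h] e2(2)[of h] h by (auto simp: level_def)
      have "\<sigma> * (Lev (\<gamma> h) - Lev (F s 0)) = (if P = Q then if y \<in> HQ then 1 else 0 else if y \<in> HQ' then 1 else 0)"
      proof (cases "P = Q")
        case True
        then have "y \<notin> HQ'" using no by (simp add: y_def)
        then show ?thesis using s1 sigma True unfolding Lh L0 by auto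
      next
        case False
        then have "P = Q'" "y \<notin> HQ" using no P by (auto simp: y_def)
        then show ?thesis using s1 sigma False unfolding Lh L0 by auto
      qed
      then show "\<sigma> * (Lev (\<gamma> h) - Lev (F s 0)) \<ge> 0" "F s 0 \<in> range p \<Longrightarrow> \<sigma> * (Lev (\<gamma> h) - Lev (F s 0)) > 0"
        using yes by (auto simp: y_def split: if_splits)
    qed (use e e1 e2 in auto)
  qed
  obtain \<epsilon>1 where e1: "\<epsilon>1 > 0" "\<And>h. 0 < h \<Longrightarrow> h < \<epsilon>1 \<Longrightarrow> Lev (F (s + h) 0) - Lev (F s 0) \<ge> 0 \<and> (F s 0 \<in> range p \<longrightarrow> Lev (F (s + h) 0) - Lev (F s 0) > 0)"
    using one[of 1 "\<lambda>h. F (s + h) 0"] r(1) by auto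
  obtain \<epsilon>2 where e2: "\<epsilon>2 > 0" "\<And>h. 0 < h \<Longrightarrow> h < \<epsilon>2 \<Longrightarrow> - (Lev (F (s - h) 0) - Lev (F s 0)) \<ge> 0 \<and> (F s 0 \<in> range p \<longrightarrow> - (Lev (F (s - h) 0) - Lev (F s 0)) > 0)"
    using one[of "- 1" "\<lambda>h. F (s - h) 0"] r(2) by auto
  show ?thesis
  proof (intro exI[of _ "min \<epsilon>1 \<epsilon>2"] conjI allI impI)
    fix h assume h: "0 < h \<and> h < min \<epsilon>1 \<epsilon>2"
    then have "0 < h" "h < \<epsilon>1" "h < \<epsilon>2" by auto
    note q = e1(2)[OF this(1,2)] e2(2)[OF this(1,3)]
    show "Lev (F s 0) \<le> Lev (F (s + h) 0)" "Lev (F (s - h) 0) \<le> Lev (F s 0)" using q by auto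
    show "Lev (F s 0) < Lev (F (s + h) 0)" "Lev (F (s - h) 0) < Lev (F s 0)" if "F s 0 \<in> range p" using q that by auto
  qed (use e1 e2 in auto)
qed

lemma cylinder_meets_image:
  assumes cyl: "cylinder (double_pentagon r) v a b F" and s0: "s0 \<in> {a<..<b}" "F s0 = p"
  shows "\<exists>s\<in>{a<..<b}. \<exists>t t'. F s t = iota (p t')"
proof (rule ccontr)
  assume "\<not> ?thesis"
  then have disj: "F s t \<noteq> iota (p t')" if "s \<in> {a<..<b}" for s t t' using that by blast
  have fam: "parallel_family (double_pentagon r) v a b F" using cyl by (simp add: cylinder_def)
  have strF: "straight_on (double_pentagon r) v UNIV (F s)" if "s \<in> {a<..<b}" for s
    using fam that by (auto simp: parallel_family_def periodic_trajectory_def trajectory_def)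
  define g where "g s = Lev (F s 0)" for s
  have step: "\<exists>\<epsilon>>0. \<forall>h. 0 < h \<and> h < \<epsilon> \<longrightarrow> g s \<le> g (s + h) \<and> g (s - h) \<le> g s \<and>
     (F s 0 \<in> range p \<longrightarrow> g s < g (s + h) \<and> g (s - h) < g s)" if "s \<in> {a<..<b}" for s
    unfolding g_def using Lev_step[OF fam that] disj[OF that] by blast
  have mono: "g s \<le> g t" if "a < s" "s \<le> t" "t < b" for s t
  proof (rule locally_mono_imp_mono[of a b g])
    fix s assume "a < s" "s < b"
    then show "\<exists>\<epsilon>>0. \<forall>h. 0 < h \<and> h < \<epsilon> \<longrightarrow> g s \<le> g (s + h) \<and> g (s - h) \<le> g s" using step[of s] by fastforce
  qed (use that in auto)
  obtain \<epsilon> where e: "\<epsilon> > 0" "\<And>h. 0 < h \<Longrightarrow> h < \<epsilon> \<Longrightarrow> g s0 < g (s0 + h) \<and> g (s0 - h) < g s0"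
    using step[OF s0(1)] s0(2) by auto
  have up: "g s0 < g s" if "s0 < s" "s < b" for s
  proof -
    define h where "h = min (\<epsilon> / 2) (s - s0)"
    have h: "0 < h" "h < \<epsilon>" "s0 + h \<le> s" using e(1) that by (auto simp: h_def)
    then show ?thesis using e(2)[of h] mono[of "s0 + h" s] s0(1) that by force
  qed
  have down: "g s < g s0" if "a < s" "s < s0" for s
  proof -
    define h where "h = min (\<epsilon> / 2) (s0 - s)"
    have h: "0 < h" "h < \<epsilon>" "s \<le> s0 - h" using e(1) that by (auto simp: h_def)
    then show ?thesis using e(2)[of h] mono[of s "s0 - h"] s0(1) that by force
  qed
  obtain \<rho> where rho: "\<rho> > 0" "\<forall>P z. regular (double_pentagon r) P z \<and> lev P z \<noteq> base \<longrightarrow> (\<exists>\<Psi>. chart (double_pentagon r) \<rho> \<Psi> \<and> \<Psi> 0 = DP.cls P z)"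
    using charts_off_base by (elim exE conjE)
  have strip: "a \<le> s - \<rho> \<and> s + \<rho> \<le> b" if s: "s \<in> {a<..<b}" "g s \<noteq> base" for s
  proof (rule DP.cylinder_contains_chart_strip[OF cyl s(1) rho(1)])
    fix t
    obtain P z where z: "regular (double_pentagon r) P z" "F s t = DP.cls P z"
      using DP.straight_on_regular[OF strF[OF s(1)], of t] by auto
    have "lev P z = g s" using Lev_straight[OF strF[OF s(1)], of t 0] z by (simp add: Lev_cls g_def)
    then show "\<exists>\<Psi>. chart (double_pentagon r) \<rho> \<Psi> \<and> \<Psi> 0 = F s t" using rho(2)[rule_format, of P z] z s(2) by simp
  qed
  \<comment> \<open>On one whole side of \<open>s0\<close> the level differs from
    \<open>base\<close>. A parameter within \<open>\<rho> / 2\<close> of that end of the cylinder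
    contradicts \<open>strip\<close>.\<close>
  show False
  proof (cases "base \<le> g s0")
    case True
    define s where "s = max ((s0 + b) / 2) (b - \<rho> / 2)"
    have "s0 < s" "s < b" "s + \<rho> > b" using s0(1) rho(1) by (auto simp: s_def less_max_iff_disj)
    then show False using strip[of s] up[of s] True s0(1) by auto
  next
    case False
    define s where "s = min ((s0 + a) / 2) (a + \<rho> / 2)"
    have "s < s0" "a < s" "s - \<rho> < a" using s0(1) rho(1) by (auto simp: s_def min_less_iff_disj)
    then show False using strip[of s] down[of s] False s0(1) by auto
  qed
qed

end

section \<open>The symmetry of core curves\<close>

context pentagon_surfaces
begin

lemma core_curve_symmetric:
  assumes "core_curve (double_pentagon r) p"
  shows "\<exists>v T \<tau>. norm v = 1 \<and> straight_on (double_pentagon r) v UNIV p \<and> T > 0 \<and> (\<forall>t. p (t + T) = p t) \<and>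
    (\<forall>t. p (t + \<tau>) = iota (p (- t)))"
proof -
  obtain v a b F where cyl: "cylinder (double_pentagon r) v a b F" and p: "p = F ((a + b) / 2)"
    using assms unfolding core_curve_def by blast
  define s0 where "s0 = (a + b) / 2"
  have fam: "parallel_family (double_pentagon r) v a b F" using cyl by (simp add: cylinder_def)
  then have "a < b" by (simp add: parallel_family_def)
  then have s0: "s0 \<in> {a<..<b}" by (simp add: s0_def)
  have perF: "periodic_trajectory (double_pentagon r) v (F s)" if "s \<in> {a<..<b}" for s
    using fam that by (simp add: parallel_family_def)
  have pF: "p = F s0" by (simp add: p s0_def)
  obtain T where period: "T > 0" "\<And>t. p (t + T) = p t" using perF[OF s0] by (auto simp: periodic_trajectory_def pF)
  have v: "norm v = 1" and str: "straight_on (double_pentagon r) v UNIV p"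
    using perF[OF s0] by (auto simp: periodic_trajectory_def trajectory_def pF)
  interpret closed_geodesic r p v T by unfold_locales (use v str period in auto)
  obtain s2 t t' where s2: "s2 \<in> {a<..<b}" "F s2 t = iota (p t')"
    using cylinder_meets_image[OF cyl s0] pF by auto
  define c where "c = t + t'"
  \<comment> \<open>The image cylinder in the parametrisation of the original: \<open>iota\<close>
    reverses both \<open>v\<close> and \<open>\<i> * v\<close>, so time and transverse parameter run
    backwards. The constants make \<open>G s2\<close> and \<open>F s2\<close> meet at time
    \<open>t\<close>.\<close>
  define G where "G s u = iota (F (s0 + s2 - s) (c - u))" for s u
  have inI: "s0 + s2 - s \<in> {a<..<b}" if "s \<in> {s0 + s2 - b<..<s0 + s2 - a}" for s using that by auto
  have famG: "parallel_family (double_pentagon r) v (s0 + s2 - b) (s0 + s2 - a) G"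
    unfolding parallel_family_def
  proof (intro conjI ballI allI)
    show "s0 + s2 - b < s0 + s2 - a" using \<open>a < b\<close> by simp
    fix s assume "s \<in> {s0 + s2 - b<..<s0 + s2 - a}"
    note P = perF[OF inI[OF this]]
    have "straight_on (double_pentagon r) (- v) {u. c - u \<in> UNIV} (\<lambda>u. F (s0 + s2 - s) (c - u))"
      by (rule straight_on_reverse) (use P in \<open>simp add: periodic_trajectory_def trajectory_def\<close>)
    then have "straight_on (double_pentagon r) v UNIV (G s)" unfolding G_def using iota_straight by fastforce
    moreover obtain T' where T': "T' > 0" "\<And>t. F (s0 + s2 - s) (t + T') = F (s0 + s2 - s) t"
      using P by (auto simp: periodic_trajectory_def)
    have "G s (u + T') = G s u" for u using T'(2)[of "c - u - T'"] by (simp add: G_def algebra_simps)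
    ultimately show "periodic_trajectory (double_pentagon r) v (G s)"
      unfolding periodic_trajectory_def trajectory_def using T'(1) v by blast
  next
    fix u
    have "straight_on (double_pentagon r) (\<i> * v) {a<..<b} (\<lambda>s. F s (c - u))" using fam by (simp add: parallel_family_def)
    from iota_straight[OF straight_on_reverse[OF this, of "s0 + s2"]]
    have "straight_on (double_pentagon r) (\<i> * v) {s. s0 + s2 - s \<in> {a<..<b}} (\<lambda>s. G s u)" by (simp add: G_def)
    then show "straight_on (double_pentagon r) (\<i> * v) {s0 + s2 - b<..<s0 + s2 - a} (\<lambda>s. G s u)"
      by (rule straight_on_subset) auto
  qed
  have s2G: "s2 \<in> {s0 + s2 - b<..<s0 + s2 - a}" using s0 by auto
  have strG: "straight_on (double_pentagon r) v UNIV (G s2)" "straight_on (double_pentagon r) v UNIV (F s2)"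
    using famG s2G perF[OF s2(1)] by (auto simp: parallel_family_def periodic_trajectory_def trajectory_def)
  have eq: "F s2 u = G s2 u" for u
    by (rule DP.unique_continuation[OF strG(2,1), of t]) (use s2(2) in \<open>auto simp: G_def c_def pF\<close>)
  \<comment> \<open>The parameter intervals have the same length, so containment makes them equal.
    As \<open>s0\<close> is the centre, \<open>s2 = s0\<close> follows; this is the only use of the
    curve being central.\<close>
  have "a \<le> s0 + s2 - b \<and> s0 + s2 - a \<le> b" by (rule DP.cylinder_contains_family[OF cyl famG s2(1) s2G eq])
  then have "s2 = s0" by (simp add: s0_def field_simps)
  then have "p (u + c) = iota (p (- u))" for u using eq[of "u + c"] by (simp add: G_def pF)
  then show ?thesis using v str period by blast
qed

end

section \<open>Lifting to the necklace\<close>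

text \<open>As 5 is prime, a nontrivial fifth root of unity generates all of them; \<open>m\<close>
  inverts the exponent \<open>j\<close> modulo 5.\<close>

lemma unity_generated:
  fixes u w :: complex
  assumes "u ^ 5 = 1" "u \<noteq> 1"
  shows "w ^ 5 = 1 \<Longrightarrow> \<exists>n. w = u ^ n" and "u ^ n = 1 \<Longrightarrow> 5 dvd n"
proof -
  obtain j where j: "j < 5" "u = omega ^ j" using assms(1) unity5 by blast
  have "j \<noteq> 0" using assms(2) j(2) by (intro notI) simp
  then have "j = 1 \<or> j = 2 \<or> j = 3 \<or> j = 4" using j(1) by linarith
  then have "\<exists>m q. j * m = 1 + 5 * q"
  proof (elim disjE)
    assume "j = 1" then show ?thesis by (intro exI[of _ 1] exI[of _ 0]) simp
  next
    assume "j = 2" then show ?thesis by (intro exI[of _ 3] exI[of _ 1]) simp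
  next
    assume "j = 3" then show ?thesis by (intro exI[of _ 2] exI[of _ 1]) simp
  next
    assume "j = 4" then show ?thesis by (intro exI[of _ 4] exI[of _ 3]) simp
  qed
  then obtain m q where m: "j * m = 1 + 5 * q" by blast
  have "omega ^ (j * m) = omega ^ 1" by (rule omega_pow_cong[of _ 0 _ q]) (simp add: m)
  then have om: "u ^ m = omega" unfolding j(2) power_mult[symmetric] by simp
  show "\<exists>n. w = u ^ n" if w: "w ^ 5 = 1"
  proof -
    obtain i where "w = omega ^ i" using w unity5 by blast
    then have "w = u ^ (m * i)" unfolding om[symmetric] power_mult[symmetric] .
    then show ?thesis by blast
  qed
  show "5 dvd n" if n: "u ^ n = 1"
  proof -
    have "omega ^ n = (u ^ n) ^ m" unfolding om[symmetric] power_mult[symmetric] by (simp add: mult.commute)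
    then show ?thesis using n by (simp add: omega_power_eq_1)
  qed
qed

section \<open>Returns, minimal periods and parallel components\<close>

context pent
begin

lemma piece_straight:
  assumes "\<And>s. s \<in> {0..\<epsilon>} \<Longrightarrow> regular S i (z + s *\<^sub>R w)" "\<And>s. s \<in> {0..\<epsilon>} \<Longrightarrow> \<gamma> s = cls i (z + s *\<^sub>R w)"
  shows "straight_on S w {0<..<\<epsilon>} \<gamma>"
  unfolding straight_on_ray ray_def
proof (intro ballI conjI)
  fix t assume t: "t \<in> {0<..<\<epsilon>}"
  show "\<exists>i z. \<exists>\<epsilon>>0. \<forall>s\<in>{0..\<epsilon>}. regular S i (z + s *\<^sub>R w) \<and> \<gamma> (t + s) = cls i (z + s *\<^sub>R w)"
  proof (intro exI[of _ i] exI[of _ "z + t *\<^sub>R w"] exI[of _ "\<epsilon> - t"] conjI ballI)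
    fix s assume "s \<in> {0..\<epsilon> - t}"
    then have s: "t + s \<in> {0..\<epsilon>}" using t by auto
    have e: "z + t *\<^sub>R w + s *\<^sub>R w = z + (t + s) *\<^sub>R w" by (simp add: scaleR_add_left)
    show "regular S i (z + t *\<^sub>R w + s *\<^sub>R w)" "\<gamma> (t + s) = cls i (z + t *\<^sub>R w + s *\<^sub>R w)"
      unfolding e using assms s by auto
  qed (use t in auto)
  show "\<exists>i z. \<exists>\<epsilon>>0. \<forall>s\<in>{0..\<epsilon>}. regular S i (z + s *\<^sub>R - w) \<and> \<gamma> (t - s) = cls i (z + s *\<^sub>R - w)"
  proof (intro exI[of _ i] exI[of _ "z + t *\<^sub>R w"] exI[of _ t] conjI ballI)
    fix s assume "s \<in> {0..t}"
    then have s: "t - s \<in> {0..\<epsilon>}" using t by auto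
    have e: "z + t *\<^sub>R w + s *\<^sub>R - w = z + (t - s) *\<^sub>R w" by (simp add: scaleR_diff_left)
    show "regular S i (z + t *\<^sub>R w + s *\<^sub>R - w)" "\<gamma> (t - s) = cls i (z + t *\<^sub>R w + s *\<^sub>R - w)"
      unfolding e using assms s by auto
  qed (use t in auto)
qed

lemma return_imp_period:
  assumes "straight_on S v UNIV \<gamma>" "\<gamma> t = \<gamma> t'"
  shows "\<gamma> (s + (t' - t)) = \<gamma> s"
proof -
  have "straight_on S v UNIV (\<lambda>s. \<gamma> (s + (t' - t)))" using straight_on_shift[OF assms(1), of "t' - t"] by simp
  from unique_continuation[OF this assms(1), of t s] show ?thesis using assms(2) by simp
qed

text \<open>The points of one straight piece of length \<open>\<epsilon>\<close> are distinct, so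
  every positive period exceeds \<open>\<epsilon>\<close>. Were the infimum not attained, two
  periods would differ by less than \<open>\<epsilon>\<close>, and their difference is a
  period.\<close>

lemma minimal_period:
  assumes str: "straight_on S v UNIV \<gamma>" and "v \<noteq> 0" and "T1 > 0" "\<And>t. \<gamma> (t + T1) = \<gamma> t"
  shows "\<exists>T>0. (\<forall>t. \<gamma> (t + T) = \<gamma> t) \<and> (\<forall>T'. (\<forall>t. \<gamma> (t + T') = \<gamma> t) \<longrightarrow> (\<exists>n::int. T' = of_int n * T))"
proof -
  define P where "P = {T. 0 < T \<and> (\<forall>t. \<gamma> (t + T) = \<gamma> t)}"
  have "ray S v (\<lambda>s. \<gamma> (0 + s))" using str unfolding straight_on_ray by blast
  then obtain i z \<epsilon> where e: "\<epsilon> > 0" "\<And>s. s \<in> {0..\<epsilon>} \<Longrightarrow> regular S i (z + s *\<^sub>R v) \<and> \<gamma> (0 + s) = cls i (z + s *\<^sub>R v)"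
    unfolding ray_def by blast
  have big: "\<epsilon> < T" if "T \<in> P" for T
  proof (rule ccontr)
    assume "\<not> \<epsilon> < T"
    then have T: "0 < T" "T \<in> {0..\<epsilon>}" using that by (auto simp: P_def)
    have "\<gamma> (0 + T) = \<gamma> 0" using that unfolding P_def by blast
    then have "cls i (z + 0 *\<^sub>R v) = cls i (z + T *\<^sub>R v)" using e(2)[of T] e(2)[of 0] T e(1) by simp
    moreover have "regular S i (z + 0 *\<^sub>R v)" using e(2)[of 0] e(1) by simp
    ultimately have "z + T *\<^sub>R v = z + 0 *\<^sub>R v" using cls_same_label by blast
    then show False using T(1) assms(2) by simp
  qed
  define T where "T = Inf P"
  have ne: "T1 \<in> P" using assms by (simp add: P_def)
  have bdd: "bdd_below P" by (rule bdd_belowI[of _ 0]) (auto simp: P_def)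
  have diff: "t - t' \<in> P" if "t \<in> P" "t' \<in> P" "t' < t" for t t'
  proof -
    have "\<gamma> (u + (t - t')) = \<gamma> u" for u
    proof -
      have a: "\<gamma> (w + t') = \<gamma> w" "\<gamma> (w + t) = \<gamma> w" for w using that(1,2) unfolding P_def by blast+
      have "\<gamma> (u + (t - t')) = \<gamma> (u + (t - t') + t')" by (rule a(1)[symmetric])
      also have "u + (t - t') + t' = u + t" by simp
      also have "\<gamma> (u + t) = \<gamma> u" by (rule a(2))
      finally show ?thesis .
    qed
    then show ?thesis using that by (simp add: P_def)
  qed
  have low: "T \<le> t" if "t \<in> P" for t unfolding T_def by (rule cInf_lower[OF that bdd])
  have "\<epsilon> \<le> T" unfolding T_def by (rule cInf_greatest) (use ne big in \<open>auto intro: less_imp_le\<close>)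
  have TP: "T \<in> P"
  proof (rule ccontr)
    assume n: "T \<notin> P"
    obtain t where t: "t \<in> P" "t < T + \<epsilon>" using cInf_lessD[of P "T + \<epsilon>"] ne e(1) unfolding T_def by auto
    have "T < t" using low[OF t(1)] t(1) n by (cases "t = T") auto
    then obtain t' where t': "t' \<in> P" "t' < t" using cInf_lessD[of P t] ne unfolding T_def by auto
    show False using big[OF diff[OF t(1) t'(1) t'(2)]] low[OF t'(1)] t(2) by simp
  qed
  have T0: "T > 0" "\<And>t. \<gamma> (t + T) = \<gamma> t" using TP by (auto simp: P_def)
  have "\<exists>n::int. T' = of_int n * T" if T': "\<And>t. \<gamma> (t + T') = \<gamma> t" for T'
  proof -
    define n where "n = \<lfloor>T' / T\<rfloor>"
    define d where "d = T' - of_int n * T"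
    have "of_int n \<le> T' / T" "T' / T < of_int n + 1" by (auto simp: n_def)
    then have d: "0 \<le> d" "d < T" using T0(1) by (auto simp: d_def field_simps)
    have "\<gamma> (t + d) = \<gamma> t" for t
    proof -
      have "\<gamma> (t + d) = \<gamma> (t + d + of_int n * T)" using periodic_int[of \<gamma> T "t + d" n] T0(2) by simp
      also have "\<dots> = \<gamma> t" using T'[of t] by (simp add: d_def)
      finally show ?thesis .
    qed
    then have "d = 0" using d low[of d] by (cases "d = 0") (auto simp: P_def)
    then show ?thesis by (auto simp: d_def)
  qed
  then show ?thesis using T0 by blast
qed

text \<open>A trajectory meets a periodic one of a different direction only finitely often in a short time,
  since the heights of the latter within one polygon form a finite set.\<close>

lemma parallel_component:
  assumes J: "finite J" "\<And>j. j \<in> J \<Longrightarrow> norm (w j) = 1 \<and> straight_on S (w j) UNIV (\<gamma> j) \<and> (\<exists>T>0. \<forall>t. \<gamma> j (t + T) = \<gamma> j t)"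
    and q: "norm v = 1" "straight_on S v UNIV q" "\<And>t. \<exists>j\<in>J. q t \<in> range (\<gamma> j)"
  shows "\<exists>j\<in>J. (v = w j \<or> v = - w j) \<and> range q = range (\<gamma> j)"
proof -
  have "\<exists>j\<in>J. (v = w j \<or> v = - w j) \<and> (\<exists>t. q t \<in> range (\<gamma> j))"
  proof (rule ccontr)
    assume no: "\<not> ?thesis"
    define K where "K = {j \<in> J. \<not> (v = w j \<or> v = - w j)}"
    have qK: "\<exists>j\<in>K. q t \<in> range (\<gamma> j)" for t using q(3)[of t] no unfolding K_def by blast
    have "ray S v (\<lambda>s. q (0 + s))" using q(2) unfolding straight_on_ray by blast
    then obtain i z \<epsilon> where e: "\<epsilon> > 0" "\<And>s. s \<in> {0..\<epsilon>} \<Longrightarrow> regular S i (z + s *\<^sub>R v) \<and> q (0 + s) = cls i (z + s *\<^sub>R v)"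
      unfolding ray_def by blast
    define A where "A j = {s. cls i (z + s *\<^sub>R v) \<in> range (\<gamma> j)}" for j
    have "finite (A j)" if j: "j \<in> K" for j
    proof -
      have jJ: "j \<in> J" using j by (simp add: K_def)
      then obtain T where T: "T > 0" "\<And>t. \<gamma> j (t + T) = \<gamma> j t" using J(2) by blast
      have fin: "finite {y \<bullet> (\<i> * w j) | y. cls i y \<in> range (\<gamma> j)}"
        by (rule finite_heights[of "w j" "\<gamma> j" T]) (use J(2)[OF jJ] T in auto)
      \<comment> \<open>Unit vectors of different directions, even up to sign: the height with
        respect to \<open>w j\<close> is then injective along \<open>q\<close>.\<close>
      have nz: "v \<bullet> (\<i> * w j) \<noteq> 0"
      proof
        assume z0: "v \<bullet> (\<i> * w j) = 0"
        have nw: "norm (w j) = 1" using J(2)[OF jJ] by simp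
        have vw: "v = (v \<bullet> w j) *\<^sub>R w j" using orthonormal_expansion[OF nw, of v] z0 by simp
        then have "norm v = \<bar>v \<bullet> w j\<bar> * norm (w j)" by (metis norm_scaleR)
        then have "\<bar>v \<bullet> w j\<bar> = 1" using q(1) nw by simp
        then have "v \<bullet> w j = 1 \<or> v \<bullet> w j = - 1" by linarith
        then have "v = w j \<or> v = - w j" using vw by (metis scaleR_minus1_left scaleR_one)
        then show False using j by (simp add: K_def)
      qed
      have "inj_on (\<lambda>s. (z + s *\<^sub>R v) \<bullet> (\<i> * w j)) (A j)" using nz by (auto simp: inj_on_def inner_add_left)
      moreover have "(\<lambda>s. (z + s *\<^sub>R v) \<bullet> (\<i> * w j)) ` A j \<subseteq> {y \<bullet> (\<i> * w j) | y. cls i y \<in> range (\<gamma> j)}"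
        unfolding A_def by blast
      ultimately show ?thesis using fin finite_imageD finite_subset by blast
    qed
    moreover have "finite K" using J(1) by (simp add: K_def)
    ultimately have "finite (\<Union>j\<in>K. A j)" by blast
    moreover have "{0..\<epsilon>} \<subseteq> (\<Union>j\<in>K. A j)"
    proof
      fix s assume "s \<in> {0..\<epsilon>}"
      then have "q (0 + s) = cls i (z + s *\<^sub>R v)" using e(2) by blast
      then show "s \<in> (\<Union>j\<in>K. A j)" using qK[of "0 + s"] by (auto simp: A_def)
    qed
    ultimately have "finite {0..\<epsilon>}" using finite_subset by blast
    then show False using e(1) infinite_Icc by blast
  qed
  then obtain j t u where j: "j \<in> J" "v = w j \<or> v = - w j" "q t = \<gamma> j u" by auto
  have gj: "straight_on S (w j) UNIV (\<gamma> j)" using J(2) j by blast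
  have "range q = range (\<gamma> j)"
    using j(2)
  proof
    assume vw: "v = w j"
    have "straight_on S v UNIV (\<lambda>s. \<gamma> j (s + (u - t)))" using straight_on_shift[OF gj, of "u - t"] vw by simp
    from unique_continuation[OF q(2) this, of t] have e: "q s = \<gamma> j (s + (u - t))" for s using j(3) by simp
    then have f: "\<gamma> j s = q (s - (u - t))" for s by simp
    have "q s \<in> range (\<gamma> j)" for s unfolding e by (rule rangeI)
    moreover have "\<gamma> j s \<in> range q" for s unfolding f by (rule rangeI)
    ultimately show ?thesis by blast
  next
    assume vw: "v = - w j"
    have "straight_on S v UNIV (\<lambda>s. \<gamma> j ((u + t) - s))" using straight_on_reverse[OF gj, of "u + t"] vw by simp
    from unique_continuation[OF q(2) this, of t] have e: "q s = \<gamma> j ((u + t) - s)" for s using j(3) by simp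
    then have f: "\<gamma> j s = q ((u + t) - s)" for s by simp
    have "q s \<in> range (\<gamma> j)" for s unfolding e by (rule rangeI)
    moreover have "\<gamma> j s \<in> range q" for s unfolding f by (rule rangeI)
    ultimately show ?thesis by blast
  qed
  then show ?thesis using j by blast
qed

end

section \<open>Path lifting to the necklace\<close>

context pentagon_surfaces
begin

lemma regular_lift: "g \<in> dihedral r \<Longrightarrow> regular (double_pentagon r) (g ` pentagon r) z \<Longrightarrow> regular (necklace r) g z"
  by (simp add: regular_def polygon_DP polygon_N labels_N)

lemma fibre_rep:
  assumes "regular (necklace r) g z" "covering r (N.cls g z) = DP.cls P w"
  shows "\<exists>g'. g' ` pentagon r = P \<and> regular (necklace r) g' w \<and> N.cls g' w = N.cls g z"
proof -
  have "(P, w) \<in> covering r (N.cls g z)" using assms(2) by simp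
  then obtain g' where g': "(g', w) \<in> N.cls g z" "g' ` pentagon r = P" by (auto simp: covering_def)
  then have "N.cls g z = N.cls g' w" by (simp add: surface_point_mem)
  then show ?thesis using g'(2) N.regular_cong[OF assms(1)] by metis
qed

definition lifts_along :: "complex \<Rightarrow> (real \<Rightarrow> (complex set \<times> complex) set) \<Rightarrow> real set \<Rightarrow> (real \<Rightarrow> ((complex \<Rightarrow> complex) \<times> complex) set) \<Rightarrow> bool" where
  "lifts_along v p I q \<longleftrightarrow> straight_on (necklace r) v I q \<and> (\<forall>t\<in>I. covering r (q t) = p t)"

text \<open>\<open>covering\<close> is an image map on arbitrary sets, so it is recorded that
  \<open>y\<close> is the class of a regular point.\<close>

definition over :: "(complex set \<times> complex) set \<Rightarrow> ((complex \<Rightarrow> complex) \<times> complex) set \<Rightarrow> bool" where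
  "over x y \<longleftrightarrow> (\<exists>g z. regular (necklace r) g z \<and> y = N.cls g z) \<and> covering r y = x"

lemma lifts_along_over: "lifts_along v p I q \<Longrightarrow> t \<in> I \<Longrightarrow> over (p t) (q t)"
  unfolding lifts_along_def over_def using N.straight_on_regular by metis

text \<open>A label for the piece lifts all of it at once. Thus the lift may be prescribed at any
  parameter \<open>c\<close> of the piece, which is needed when pieces are joined.\<close>

lemma ray_lift:
  assumes "ray (double_pentagon r) w \<gamma>"
  shows "\<exists>\<epsilon>>0. \<forall>c\<in>{0..\<epsilon>}. \<forall>y. over (\<gamma> c) y \<longrightarrow> (\<exists>g z. N.cls g (z + c *\<^sub>R w) = y \<and>
    (\<forall>s\<in>{0..\<epsilon>}. regular (necklace r) g (z + s *\<^sub>R w) \<and> covering r (N.cls g (z + s *\<^sub>R w)) = \<gamma> s))"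
proof -
  obtain P z \<epsilon> where e: "\<epsilon> > 0" "\<And>s. s \<in> {0..\<epsilon>} \<Longrightarrow> regular (double_pentagon r) P (z + s *\<^sub>R w) \<and> \<gamma> s = DP.cls P (z + s *\<^sub>R w)"
    using assms unfolding ray_def by blast
  show ?thesis
  proof (intro exI[of _ \<epsilon>] conjI ballI allI impI)
    fix c y assume c: "c \<in> {0..\<epsilon>}" and y: "over (\<gamma> c) y"
    then obtain g' z' where g': "regular (necklace r) g' z'" "y = N.cls g' z'" "covering r (N.cls g' z') = DP.cls P (z + c *\<^sub>R w)"
      using e(2)[OF c] by (auto simp: over_def)
    from fibre_rep[OF g'(1,3)] obtain g where g: "g ` pentagon r = P" "regular (necklace r) g (z + c *\<^sub>R w)" "N.cls g (z + c *\<^sub>R w) = y"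
      using g'(2) by auto
    have gd: "g \<in> dihedral r" using N.regular_label[OF g(2)] by (simp add: labels_N)
    have "regular (necklace r) g (z + s *\<^sub>R w) \<and> covering r (N.cls g (z + s *\<^sub>R w)) = \<gamma> s" if s: "s \<in> {0..\<epsilon>}" for s
    proof -
      have "regular (necklace r) g (z + s *\<^sub>R w)" using e(2)[OF s] g(1) gd by (auto intro: regular_lift)
      then show ?thesis using e(2)[OF s] g(1) covering_cls by metis
    qed
    then show "\<exists>g z. N.cls g (z + c *\<^sub>R w) = y \<and>
      (\<forall>s\<in>{0..\<epsilon>}. regular (necklace r) g (z + s *\<^sub>R w) \<and> covering r (N.cls g (z + s *\<^sub>R w)) = \<gamma> s)"
      using g(3) by blast
  qed (fact e(1))
qed

text \<open>The pieces before and after \<open>x\<close> may lie in different copies. The one that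
  contains \<open>c\<close> is lifted through \<open>y\<close>, the other one through the point just
  obtained above \<open>x\<close>.\<close>

lemma local_lift:
  assumes str: "straight_on (double_pentagon r) v UNIV p"
  shows "\<exists>\<eta>>0. \<forall>c\<in>{x-\<eta><..<x+\<eta>}. \<forall>y. over (p c) y \<longrightarrow> (\<exists>q. q c = y \<and> lifts_along v p {x-\<eta><..<x+\<eta>} q)"
proof -
  have r: "ray (double_pentagon r) v (\<lambda>s. p (x + s))" "ray (double_pentagon r) (- v) (\<lambda>s. p (x - s))"
    using str unfolding straight_on_ray by auto
  let ?ok = "\<lambda>\<epsilon> w g z f. \<forall>s\<in>{0..\<epsilon>}. regular (necklace r) g (z + s *\<^sub>R w) \<and> covering r (N.cls g (z + s *\<^sub>R w)) = f s"
  obtain \<epsilon>1 where e1: "\<epsilon>1 > 0" "\<forall>c\<in>{0..\<epsilon>1}. \<forall>y. over (p (x + c)) y \<longrightarrow> (\<exists>g z. N.cls g (z + c *\<^sub>R v) = y \<and> ?ok \<epsilon>1 v g z (\<lambda>s. p (x + s)))"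
    using ray_lift[OF r(1)] by (elim exE conjE)
  obtain \<epsilon>2 where e2: "\<epsilon>2 > 0" "\<forall>c\<in>{0..\<epsilon>2}. \<forall>y. over (p (x - c)) y \<longrightarrow> (\<exists>g z. N.cls g (z + c *\<^sub>R - v) = y \<and> ?ok \<epsilon>2 (- v) g z (\<lambda>s. p (x - s)))"
    using ray_lift[OF r(2)] by (elim exE conjE)
  define \<eta> where "\<eta> = min \<epsilon>1 \<epsilon>2"
  have eta: "\<eta> > 0" "\<eta> \<le> \<epsilon>1" "\<eta> \<le> \<epsilon>2" using e1 e2 by (auto simp: \<eta>_def)
  have ov: "over (f 0) (N.cls g z)" if "?ok \<epsilon> w g z f" "\<epsilon> > 0" for \<epsilon> w g z f
  proof -
    have "regular (necklace r) g z \<and> covering r (N.cls g z) = f 0" using bspec[OF that(1), of 0] that(2) by simp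
    then show ?thesis unfolding over_def by blast
  qed
  show ?thesis
  proof (intro exI[of _ \<eta>] conjI ballI allI impI)
    fix c y assume c: "c \<in> {x-\<eta><..<x+\<eta>}" and y: "over (p c) y"
    have "\<exists>g1 z1 g2 z2. N.cls g1 z1 = N.cls g2 z2 \<and> ?ok \<epsilon>1 v g1 z1 (\<lambda>s. p (x + s)) \<and> ?ok \<epsilon>2 (- v) g2 z2 (\<lambda>s. p (x - s)) \<and>
      (if c \<ge> x then N.cls g1 (z1 + (c - x) *\<^sub>R v) = y else N.cls g2 (z2 + (x - c) *\<^sub>R - v) = y)"
    proof (cases "c \<ge> x")
      case True
      have "c - x \<in> {0..\<epsilon>1}" "over (p (x + (c - x))) y" using True c eta y by auto
      then obtain g1 z1 where 1: "N.cls g1 (z1 + (c - x) *\<^sub>R v) = y" "?ok \<epsilon>1 v g1 z1 (\<lambda>s. p (x + s))" using e1(2) by blast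
      have "over (p (x - 0)) (N.cls g1 z1)" using ov[OF 1(2) e1(1)] by simp
      moreover have "0 \<in> {0..\<epsilon>2}" using e2(1) by simp
      ultimately obtain g2 z2 where 2: "N.cls g2 (z2 + 0 *\<^sub>R - v) = N.cls g1 z1" "?ok \<epsilon>2 (- v) g2 z2 (\<lambda>s. p (x - s))" using e2(2) by blast
      have "N.cls g1 z1 = N.cls g2 z2" using 2(1) by simp
      then show ?thesis using 1 2(2) True by (intro exI[of _ g1] exI[of _ z1] exI[of _ g2] exI[of _ z2]) simp
    next
      case False
      have "x - c \<in> {0..\<epsilon>2}" "over (p (x - (x - c))) y" using False c eta y by auto
      then obtain g2 z2 where 2: "N.cls g2 (z2 + (x - c) *\<^sub>R - v) = y" "?ok \<epsilon>2 (- v) g2 z2 (\<lambda>s. p (x - s))" using e2(2) by blast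
      have "over (p (x + 0)) (N.cls g2 z2)" using ov[OF 2(2) e2(1)] by simp
      moreover have "0 \<in> {0..\<epsilon>1}" using e1(1) by simp
      ultimately obtain g1 z1 where 1: "N.cls g1 (z1 + 0 *\<^sub>R v) = N.cls g2 z2" "?ok \<epsilon>1 v g1 z1 (\<lambda>s. p (x + s))" using e1(2) by blast
      have "N.cls g1 z1 = N.cls g2 z2" using 1(1) by simp
      then show ?thesis using 1(2) 2 False by (intro exI[of _ g1] exI[of _ z1] exI[of _ g2] exI[of _ z2]) simp
    qed
    then obtain g1 z1 g2 z2 where eq: "N.cls g1 z1 = N.cls g2 z2" and ok1: "?ok \<epsilon>1 v g1 z1 (\<lambda>s. p (x + s))"
      and ok2: "?ok \<epsilon>2 (- v) g2 z2 (\<lambda>s. p (x - s))"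
      and qc: "if c \<ge> x then N.cls g1 (z1 + (c - x) *\<^sub>R v) = y else N.cls g2 (z2 + (x - c) *\<^sub>R - v) = y" by blast
    define q where "q t = (if t \<ge> x then N.cls g1 (z1 + (t - x) *\<^sub>R v) else N.cls g2 (z2 + (x - t) *\<^sub>R - v))" for t
    have q1: "q (x + s) = N.cls g1 (z1 + s *\<^sub>R v)" if "s \<ge> 0" for s using that by (simp add: q_def)
    have q2: "q (x - s) = N.cls g2 (z2 + s *\<^sub>R - v)" if "s \<ge> 0" for s using that eq by (auto simp: q_def)
    have s1: "straight_on (necklace r) v {0<..<\<epsilon>1} (\<lambda>s. q (x + s))"
      by (rule N.piece_straight[of \<epsilon>1 g1 z1]) (use ok1 q1 in auto)
    have s2: "straight_on (necklace r) (- v) {0<..<\<epsilon>2} (\<lambda>s. q (x - s))"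
      by (rule N.piece_straight[of \<epsilon>2 g2 z2]) (use ok2 q2 in auto)
    have r1: "ray (necklace r) v (\<lambda>s. q (x + s))" unfolding ray_def
      by (rule exI[of _ g1], rule exI[of _ z1], rule exI[of _ \<epsilon>1]) (use ok1 q1 e1 in auto)
    have r2: "ray (necklace r) (- v) (\<lambda>s. q (x - s))" unfolding ray_def
      by (rule exI[of _ g2], rule exI[of _ z2], rule exI[of _ \<epsilon>2]) (use ok2 q2 e2 in auto)
    have "straight_on (necklace r) v {x-\<eta><..<x+\<eta>} q" unfolding straight_on_ray
    proof
      fix t assume t: "t \<in> {x-\<eta><..<x+\<eta>}"
      consider "t = x" | "t > x" | "t < x" by linarith
      then show "ray (necklace r) v (\<lambda>s. q (t + s)) \<and> ray (necklace r) (- v) (\<lambda>s. q (t - s))"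
      proof cases
        case 1 then show ?thesis using r1 r2 by simp
      next
        case 2
        have "t - x \<in> {0<..<\<epsilon>1}" using 2 t eta by auto
        then have "ray (necklace r) v (\<lambda>s. q (x + (t - x + s))) \<and> ray (necklace r) (- v) (\<lambda>s. q (x + (t - x - s)))"
          using s1 unfolding straight_on_ray by blast
        then show ?thesis by (simp add: algebra_simps)
      next
        case 3
        have "x - t \<in> {0<..<\<epsilon>2}" using 3 t eta by auto
        then have "ray (necklace r) (- v) (\<lambda>s. q (x - (x - t + s))) \<and> ray (necklace r) (- (- v)) (\<lambda>s. q (x - (x - t - s)))"
          using s2 unfolding straight_on_ray by blast
        then show ?thesis by (simp add: algebra_simps)
      qed
    qed
    moreover have "covering r (q t) = p t" if t: "t \<in> {x-\<eta><..<x+\<eta>}" for t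
    proof (cases "t \<ge> x")
      case True
      have "t - x \<in> {0..\<epsilon>1}" using True t eta by auto
      then show ?thesis using ok1 True by (auto simp: q_def)
    next
      case False
      have "x - t \<in> {0..\<epsilon>2}" using False t eta by auto
      then show ?thesis using ok2 False by (auto simp: q_def)
    qed
    moreover have "q c = y" using qc by (auto simp: q_def)
    ultimately show "\<exists>q. q c = y \<and> lifts_along v p {x-\<eta><..<x+\<eta>} q" unfolding lifts_along_def by blast
  qed (fact eta(1))
qed

text \<open>Bisection. The open margins \<open>\<delta>\<close> make neighbouring lifts overlap,
  where unique continuation identifies them; the arbitrary base time \<open>c\<close> allows either
  half to be lifted first.\<close>

lemma interval_lift:
  assumes str: "straight_on (double_pentagon r) v UNIV p" and "a \<le> b"
  shows "\<forall>c\<in>{a..b}. \<forall>y. over (p c) y \<longrightarrow> (\<exists>q \<delta>. \<delta> > 0 \<and> q c = y \<and> lifts_along v p {a-\<delta><..<b+\<delta>} q)"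
proof (rule Bolzano[OF assms(2), where P = "\<lambda>a b. \<forall>c\<in>{a..b}. \<forall>y. over (p c) y \<longrightarrow> (\<exists>q \<delta>. \<delta> > 0 \<and> q c = y \<and> lifts_along v p {a-\<delta><..<b+\<delta>} q)"])
  fix a b d :: real
  assume ab: "\<forall>c\<in>{a..b}. \<forall>y. over (p c) y \<longrightarrow> (\<exists>q \<delta>. \<delta> > 0 \<and> q c = y \<and> lifts_along v p {a-\<delta><..<b+\<delta>} q)"
    and bd: "\<forall>c\<in>{b..d}. \<forall>y. over (p c) y \<longrightarrow> (\<exists>q \<delta>. \<delta> > 0 \<and> q c = y \<and> lifts_along v p {b-\<delta><..<d+\<delta>} q)"
    and le: "a \<le> b" "b \<le> d"
  show "\<forall>c\<in>{a..d}. \<forall>y. over (p c) y \<longrightarrow> (\<exists>q \<delta>. \<delta> > 0 \<and> q c = y \<and> lifts_along v p {a-\<delta><..<d+\<delta>} q)"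
  proof (intro ballI allI impI)
    fix c y assume c: "c \<in> {a..d}" and y: "over (p c) y"
    have "\<exists>q1 \<delta>1 q2 \<delta>2. \<delta>1 > 0 \<and> \<delta>2 > 0 \<and> lifts_along v p {a-\<delta>1<..<b+\<delta>1} q1 \<and> lifts_along v p {b-\<delta>2<..<d+\<delta>2} q2 \<and> q1 b = q2 b \<and>
      (if c \<le> b then q1 c = y else q2 c = y)"
    proof (cases "c \<le> b")
      case True
      obtain q1 \<delta>1 where 1: "\<delta>1 > 0" "q1 c = y" "lifts_along v p {a-\<delta>1<..<b+\<delta>1} q1" using ab True c y by (meson atLeastAtMost_iff)
      have "over (p b) (q1 b)" by (rule lifts_along_over[OF 1(3)]) (use le 1 in auto)
      then obtain q2 \<delta>2 where 2: "\<delta>2 > 0" "q2 b = q1 b" "lifts_along v p {b-\<delta>2<..<d+\<delta>2} q2"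
        using bd le by (meson atLeastAtMost_iff order_refl)
      show ?thesis using 1 2 True by (intro exI[of _ q1] exI[of _ \<delta>1] exI[of _ q2] exI[of _ \<delta>2]) simp
    next
      case False
      then have "c \<in> {b..d}" using c by simp
      then obtain q2 \<delta>2 where 2: "\<delta>2 > 0" "q2 c = y" "lifts_along v p {b-\<delta>2<..<d+\<delta>2} q2" using bd y by meson
      have "over (p b) (q2 b)" by (rule lifts_along_over[OF 2(3)]) (use le 2 in auto)
      then obtain q1 \<delta>1 where 1: "\<delta>1 > 0" "q1 b = q2 b" "lifts_along v p {a-\<delta>1<..<b+\<delta>1} q1"
        using ab le by (meson atLeastAtMost_iff order_refl)
      show ?thesis using 1 2 False by (intro exI[of _ q1] exI[of _ \<delta>1] exI[of _ q2] exI[of _ \<delta>2]) simp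
    qed
    then obtain q1 \<delta>1 q2 \<delta>2 where d: "\<delta>1 > 0" "\<delta>2 > 0" and l1: "lifts_along v p {a-\<delta>1<..<b+\<delta>1} q1"
      and l2: "lifts_along v p {b-\<delta>2<..<d+\<delta>2} q2" and b: "q1 b = q2 b" and cy: "if c \<le> b then q1 c = y else q2 c = y" by blast
    define \<delta> where "\<delta> = min \<delta>1 \<delta>2"
    have de: "\<delta> > 0" "\<delta> \<le> \<delta>1" "\<delta> \<le> \<delta>2" using d by (auto simp: \<delta>_def)
    have agree: "q1 t = q2 t" if t: "t \<in> {b-\<delta><..<b+\<delta>}" for t
    proof (rule N.unique_continuation[where I = "{b-\<delta><..<b+\<delta>}" and t = b and u = t])
      show "straight_on (necklace r) v {b-\<delta><..<b+\<delta>} q1" "straight_on (necklace r) v {b-\<delta><..<b+\<delta>} q2"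
        using l1 l2 de le unfolding lifts_along_def by (auto elim!: straight_on_subset)
    qed (use t de b in auto)
    define q where "q t = (if t \<le> b then q1 t else q2 t)" for t
    have eq1: "q t = q1 t" if "t < b + \<delta>" for t using agree[of t] that de by (auto simp: q_def)
    have eq2: "q t = q2 t" if "t > b - \<delta>" for t using agree[of t] that de by (auto simp: q_def)
    have "straight_on (necklace r) v {a-\<delta><..<b+\<delta>} q"
    proof (rule straight_on_cong)
      show "straight_on (necklace r) v {a-\<delta><..<b+\<delta>} q1"
        using l1 de le unfolding lifts_along_def by (auto elim!: straight_on_subset)
    qed (use eq1 in auto)
    moreover have "straight_on (necklace r) v {b-\<delta><..<d+\<delta>} q"
    proof (rule straight_on_cong)
      show "straight_on (necklace r) v {b-\<delta><..<d+\<delta>} q2"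
        using l2 de le unfolding lifts_along_def by (auto elim!: straight_on_subset)
    qed (use eq2 in auto)
    moreover have un: "{a-\<delta><..<d+\<delta>} = {a-\<delta><..<b+\<delta>} \<union> {b-\<delta><..<d+\<delta>}" using le de by auto
    ultimately have "straight_on (necklace r) v {a-\<delta><..<d+\<delta>} q" unfolding un unfolding straight_on_ray by blast
    moreover have "covering r (q t) = p t" if t: "t \<in> {a-\<delta><..<d+\<delta>}" for t
      using l1 l2 t de le unfolding lifts_along_def by (auto simp: q_def)
    moreover have "q c = y" using cy by (auto simp: q_def)
    ultimately show "\<exists>q \<delta>. \<delta> > 0 \<and> q c = y \<and> lifts_along v p {a-\<delta><..<d+\<delta>} q"
      using de(1) unfolding lifts_along_def by blast
  qed
next
  fix x assume "a \<le> x" "x \<le> b"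
  obtain \<eta> where eta: "\<eta> > 0" "\<forall>c\<in>{x-\<eta><..<x+\<eta>}. \<forall>y. over (p c) y \<longrightarrow> (\<exists>q. q c = y \<and> lifts_along v p {x-\<eta><..<x+\<eta>} q)"
    using local_lift[OF str, of x] by (elim exE conjE)
  show "\<exists>d>0. \<forall>a b. a \<le> x \<and> x \<le> b \<and> b - a < d \<longrightarrow>
    (\<forall>c\<in>{a..b}. \<forall>y. over (p c) y \<longrightarrow> (\<exists>q \<delta>. \<delta> > 0 \<and> q c = y \<and> lifts_along v p {a-\<delta><..<b+\<delta>} q))"
  proof (intro exI[of _ \<eta>] conjI allI impI ballI)
    fix a b c y assume ab: "a \<le> x \<and> x \<le> b \<and> b - a < \<eta>" and c: "c \<in> {a..b}" and y: "over (p c) y"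
    have "c \<in> {x-\<eta><..<x+\<eta>}" using ab c by auto
    then obtain q where q: "q c = y" "lifts_along v p {x-\<eta><..<x+\<eta>} q" using eta(2) y by blast
    define \<delta> where "\<delta> = min (a - (x - \<eta>)) (x + \<eta> - b)"
    have "\<delta> > 0" using ab by (auto simp: \<delta>_def)
    have "{a-\<delta><..<b+\<delta>} \<subseteq> {x-\<eta><..<x+\<eta>}" by (auto simp: \<delta>_def)
    then have "lifts_along v p {a-\<delta><..<b+\<delta>} q" using q(2) unfolding lifts_along_def by (auto elim!: straight_on_subset)
    then show "\<exists>q \<delta>. \<delta> > 0 \<and> q c = y \<and> lifts_along v p {a-\<delta><..<b+\<delta>} q" using q(1) \<open>\<delta> > 0\<close> by blast
  qed (fact eta(1))
qed

lemma lift_exists: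
  assumes str: "straight_on (double_pentagon r) v UNIV p"
  shows "\<exists>q. lifts_along v p UNIV q"
proof -
  obtain P z where z: "regular (double_pentagon r) P z" "p 0 = DP.cls P z" using DP.straight_on_regular[OF str, of 0] by auto
  have "\<exists>g\<in>dihedral r. g ` pentagon r = P"
  proof -
    have "P = pentagon r \<or> P = uminus ` pentagon r" using z(1) by (simp add: regular_def labels_DP)
    then show ?thesis
    proof
      assume "P = pentagon r" then show ?thesis using dihedral.id by (intro bexI[of _ id]) auto
    next
      have "rfl 1 ` pentagon r = uminus ` pentagon r" using dihedral_pentagon[OF r0 rfl_dihedral[OF r0, of 1]] by simp
      moreover assume "P = uminus ` pentagon r"
      ultimately show ?thesis using rfl_dihedral[OF r0, of 1] by (intro bexI[of _ "rfl 1"]) auto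
    qed
  qed
  then obtain g where g: "g \<in> dihedral r" "g ` pentagon r = P" by blast
  have reg: "regular (necklace r) g z" using regular_lift[OF g(1)] z(1) g(2) by simp
  define y where "y = N.cls g z"
  have y: "over (p 0) y" unfolding over_def y_def using reg covering_cls[OF reg] g(2) z(2) by auto
  have "\<exists>q. q 0 = y \<and> lifts_along v p {- real n<..<real n} q" for n
  proof -
    have "0 \<in> {- real n..real n}" and le: "- real n \<le> real n" by simp_all
    then obtain q \<delta> where q: "\<delta> > 0" "q 0 = y" "lifts_along v p {- real n-\<delta><..<real n+\<delta>} q"
      using interval_lift[OF str le, THEN bspec, OF \<open>0 \<in> {- real n..real n}\<close>, THEN spec, THEN mp, OF y]
      by (elim exE conjE) simp_all
    then have "lifts_along v p {- real n<..<real n} q" unfolding lifts_along_def by (auto elim!: straight_on_subset)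
    then show ?thesis using q by blast
  qed
  then obtain Q where Q: "\<And>n. Q n 0 = y" "\<And>n. lifts_along v p {- real n<..<real n} (Q n)" by metis
  have agree: "Q n t = Q m t" if t: "\<bar>t\<bar> < real n" "n \<le> m" for n m t
  proof (rule N.unique_continuation[where I = "{- real n<..<real n}" and t = 0 and u = t])
    show "straight_on (necklace r) v {- real n<..<real n} (Q n)" "straight_on (necklace r) v {- real n<..<real n} (Q m)"
      using Q(2)[of n] Q(2)[of m] t(2) unfolding lifts_along_def by (auto elim!: straight_on_subset)
  qed (use t Q(1) in auto)
  \<comment> \<open>Stage \<open>n\<close> lifts over the open interval from \<open>-n\<close> to
    \<open>n\<close>; \<open>Suc\<close> keeps \<open>t\<close> strictly inside.\<close>
  define q where "q t = Q (Suc (nat \<lceil>\<bar>t\<bar>\<rceil>)) t" for t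
  have qQ: "q t = Q n t" if t: "\<bar>t\<bar> < real n" for t n
  proof -
    have b: "\<bar>t\<bar> < real (Suc (nat \<lceil>\<bar>t\<bar>\<rceil>))" by linarith
    show ?thesis unfolding q_def using agree[OF t, of "Suc (nat \<lceil>\<bar>t\<bar>\<rceil>)"] agree[OF b, of n] by (metis nat_le_linear)
  qed
  have strn: "straight_on (necklace r) v {- real n<..<real n} q" for n
  proof (rule straight_on_cong)
    show "straight_on (necklace r) v {- real n<..<real n} (Q n)" using Q(2) by (simp add: lifts_along_def)
    fix t assume "t \<in> {- real n<..<real n}"
    then show "q t = Q n t" by (intro qQ) auto
  qed auto
  have inn: "t \<in> {- real (Suc (nat \<lceil>\<bar>t\<bar>\<rceil>))<..<real (Suc (nat \<lceil>\<bar>t\<bar>\<rceil>))}" for t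
  proof -
    have "\<bar>t\<bar> < real (Suc (nat \<lceil>\<bar>t\<bar>\<rceil>))" by linarith
    then show ?thesis by auto
  qed
  have "straight_on (necklace r) v UNIV q" unfolding straight_on_ray
  proof
    fix t show "ray (necklace r) v (\<lambda>s. q (t + s)) \<and> ray (necklace r) (- v) (\<lambda>s. q (t - s))"
      using strn inn[of t] unfolding straight_on_ray by blast
  qed
  moreover have "covering r (q t) = p t" for t
    unfolding q_def using Q(2) inn[of t] unfolding lifts_along_def by blast
  ultimately show ?thesis unfolding lifts_along_def by blast
qed

section \<open>The deck group on fibres\<close>

lemma dihedral_same_orient:
  assumes "g \<in> dihedral r" "g' \<in> dihedral r" "orient g' = orient g"
  shows "\<exists>u. u ^ 5 = 1 \<and> g' = g \<circ> rot u"
proof -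
  obtain a b where ab: "a ^ 5 = 1" "g = rot a \<or> g = rfl a" "b ^ 5 = 1" "g' = rot b \<or> g' = rfl b"
    using assms dihedral_eq[OF r0] by metis
  have c: "a * (cnj a * b) = b" "a * cnj (a * cnj b) = b" using ab(1) by (simp_all add: mult.assoc[symmetric] unity_cnj)
  have u: "(cnj a * b) ^ 5 = 1" "(a * cnj b) ^ 5 = 1" using ab by (simp_all del: power_mult_distrib)
  show ?thesis
  proof (cases "g = rot a")
    case True
    then have "g' = rot b" using ab assms(3) by auto
    then show ?thesis using True u(1) by (intro exI[of _ "cnj a * b"]) (simp only: rot_rot c simp_thms)
  next
    case False
    then have "g = rfl a" "g' = rfl b" using ab assms(3) by auto
    then show ?thesis using u(2) by (intro exI[of _ "a * cnj b"]) (simp only: rfl_rot c simp_thms)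
  qed
qed

lemma dihedral_opposite_orient:
  assumes "g \<in> dihedral r" "g' \<in> dihedral r" "orient g' = - orient g"
  shows "\<exists>u. u ^ 5 = 1 \<and> g' = g \<circ> rfl u"
proof -
  have one: "rfl 1 \<in> dihedral r" by (simp add: rfl_dihedral[OF r0])
  have "orient (g' \<circ> rfl 1) = orient g" using orient_comp[OF r0 assms(2) one] assms(3) by simp
  then obtain u where u: "u ^ 5 = 1" "g' \<circ> rfl 1 = g \<circ> rot u"
    using dihedral_same_orient[OF assms(1) dihedral_comp[OF r0 assms(2) one]] by blast
  have "rfl 1 \<circ> rfl 1 = id" by (simp add: rfl_rfl)
  then have "g' = g \<circ> rot u \<circ> rfl 1" unfolding u(2)[symmetric] comp_assoc by simp
  then show ?thesis using u(1) by (auto simp: comp_assoc rot_rfl)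
qed

text \<open>Copies over the same pentagon have the same orientation, so their labels differ by a
  rotation on the right.\<close>

lemma fibre_transitive:
  assumes "over x y" "over x y'"
  shows "\<exists>u. u ^ 5 = 1 \<and> y' = deck u y"
proof -
  obtain g z where g: "regular (necklace r) g z" "y = N.cls g z" using assms(1) by (auto simp: over_def)
  obtain g' z' where g': "regular (necklace r) g' z'" "y' = N.cls g' z'" using assms(2) by (auto simp: over_def)
  have "covering r (N.cls g' z') = DP.cls (g ` pentagon r) z"
    using assms covering_cls[OF g(1)] g(2) g'(2) by (simp add: over_def)
  from fibre_rep[OF g'(1) this] obtain h where h: "h ` pentagon r = g ` pentagon r" "regular (necklace r) h z" "N.cls h z = y'"
    using g'(2) by auto
  have d: "g \<in> dihedral r" "h \<in> dihedral r" using N.regular_label[OF g(1)] N.regular_label[OF h(2)] by (auto simp: labels_N)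
  have "orient h = orient g" using sgD_image[OF d(1)] sgD_image[OF d(2)] h(1) by simp
  then obtain u where "u ^ 5 = 1" "h = g \<circ> rot u" using dihedral_same_orient[OF d] by blast
  then show ?thesis using deck_cls[OF _ g(1)] h(3) g(2) by auto
qed

lemma deck_over:
  assumes "u ^ 5 = 1" "over x y" shows "over x (deck u y)"
proof -
  obtain g z where g: "regular (necklace r) g z" "y = N.cls g z" "covering r y = x" using assms(2) by (auto simp: over_def)
  have d: "g \<in> dihedral r" using N.regular_label[OF g(1)] by (simp add: labels_N)
  have reg: "regular (necklace r) (g \<circ> rot u) z" using deck_regular[OF assms(1) g(1)] .
  have ru: "rot u \<in> dihedral r" by (rule rot_dihedral[OF r0 assms(1)])
  have "(g \<circ> rot u) ` pentagon r = g ` pentagon r"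
    using dihedral_pentagon[OF r0 dihedral_comp[OF r0 d ru]] dihedral_pentagon[OF r0 d] orient_comp[OF r0 d ru] assms(1) by simp
  then have "covering r (deck u y) = x" using covering_cls[OF reg] covering_cls[OF g(1)] g deck_cls[OF assms(1) g(1)] by simp
  then show ?thesis unfolding over_def using reg deck_cls[OF assms(1) g(1)] g(2) by auto
qed

text \<open>A fixed class would either keep its label, which forces \<open>u = 1\<close>, or
  exchange it with the neighbour across a side, whose orientation is opposite.\<close>

lemma deck_free:
  assumes "u ^ 5 = 1" "over x y" "deck u y = y" shows "u = 1"
proof -
  obtain g z where g: "regular (necklace r) g z" "y = N.cls g z" using assms(2) by (auto simp: over_def)
  have d: "g \<in> labels (necklace r)" using N.regular_label[OF g(1)] .
  have "N.cls g z = N.cls (g \<circ> rot u) z" using assms(3) g deck_cls[OF assms(1) g(1)] by simp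
  then consider "g \<circ> rot u = g" | k where "k < 5" "g \<circ> rot u = nbN r g k" using N.cls_eq_iff[OF g(1)] by metis
  then show ?thesis
  proof cases
    case 1
    have "g (rot u 1) = g 1" using fun_cong[OF 1, of 1] by simp
    then have "rot u 1 = 1" using dihedral_bij[OF r0, of g] d by (simp add: labels_N bij_def inj_eq)
    then show ?thesis by (simp add: rot_def)
  next
    case 2
    have "orient (g \<circ> rot u) = orient g" using orient_comp[OF r0 _ rot_dihedral[OF r0 assms(1)], of g] d assms(1) by (simp add: labels_N)
    then show ?thesis using N.nb_sg[OF d 2(1)] N.sg[OF d] 2(2) by auto
  qed
qed

end

section \<open>Monodromy and symmetry of the lifts\<close>

lemma trajectory_length_eq:
  assumes "T > 0" "\<And>t. \<gamma> (t + T) = \<gamma> t" "\<And>T'. T' > 0 \<Longrightarrow> (\<And>t. \<gamma> (t + T') = \<gamma> t) \<Longrightarrow> T \<le> T'"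
  shows "trajectory_length \<gamma> = T"
  unfolding trajectory_length_def by (rule cInf_eq_minimum) (use assms in auto)

context pent
begin

text \<open>A trajectory that touched a side in parallel would run along it into its end vertex
  \<open>w\<close>, against \<open>chord_regular\<close>.\<close>

lemma transversal:
  assumes str: "straight_on S v UNIV \<gamma>" and v: "norm v = 1" and g: "\<gamma> t = cls i z" "regular S i z"
    and k: "k < 5" "tight i k z"
  shows "mid r k \<bullet> v \<noteq> 0"
proof
  assume mv: "mid r k \<bullet> v = 0"
  have i: "i \<in> labels S" using g(2) by (rule regular_label)
  define w where "w = sg i *\<^sub>R vertex r k"
  have sw: "sg i *\<^sub>R w = vertex r k" using sg_sq[OF i] by (simp add: w_def)
  have wP: "w \<in> polygon S i" using vertex_in_pentagon by (simp add: mem_polygon_pentagon[OF i] sw)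
  have wn: "\<not> regular S i w" by (simp add: regular_def extreme_polygon[OF i] sw vertex_extreme)
  have "mid r k \<bullet> vertex r k = apo r" using mid_vertex_eq[OF k(1) r0, of k] k(1) by simp
  then have "sg i * (mid r k \<bullet> w) = sg i * (mid r k \<bullet> z)" using k(2) unfolding sw[symmetric] by (simp add: tight_def)
  then have d: "(w - z) \<bullet> mid r k = 0" using sg[OF i] by (auto simp: inner_diff_left inner_commute)
  have m0: "mid r k \<noteq> 0" using mid_self[OF k(1)] apo_pos[OF r0] by auto
  have m: "mid r k = (mid r k \<bullet> (\<i> * v)) *\<^sub>R (\<i> * v)" using orthonormal_expansion[OF v, of "mid r k"] mv by simp
  have "(w - z) \<bullet> mid r k = (mid r k \<bullet> (\<i> * v)) * ((w - z) \<bullet> (\<i> * v))" by (subst m) simp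
  moreover have "mid r k \<bullet> (\<i> * v) \<noteq> 0" using m m0 by auto
  ultimately have "(w - z) \<bullet> (\<i> * v) = 0" using d by simp
  then obtain \<tau> where w: "w = z + \<tau> *\<^sub>R v" using same_height[OF v, of z w] by (auto simp: inner_diff_left)
  have "regular S i (z + \<tau> *\<^sub>R v)"
    by (rule chord_regular[OF str g(1) i regular_mem[OF g(2)]]) (use wP w in simp)
  then show False using wn w by simp
qed

text \<open>Along the piece the linear function of side \<open>k\<close> is affine and bounded by
  \<open>apo r\<close>. If it attained this bound at an inner time, it would be constant, against
  \<open>transversal\<close>.\<close>

lemma no_side_inside:
  assumes "straight_on S v UNIV \<gamma>" "norm v = 1" "\<gamma> t = cls i (z + s *\<^sub>R w)" "w = v \<or> w = - v"
    and reg: "\<And>s. s \<in> {0..\<epsilon>} \<Longrightarrow> regular S i (z + s *\<^sub>R w)" and s: "0 < s" "s < \<epsilon>" and k: "k < 5"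
  shows "\<not> tight i k (z + s *\<^sub>R w)"
proof
  assume t: "tight i k (z + s *\<^sub>R w)"
  have rs: "regular S i (z + s *\<^sub>R w)" using reg s by simp
  have i: "i \<in> labels S" using rs by (rule regular_label)
  have nz: "mid r k \<bullet> v \<noteq> 0" by (rule transversal[OF assms(1,2,3) rs k t])
  define c where "c = sg i * (mid r k \<bullet> z)"
  define d where "d = sg i * (mid r k \<bullet> w)"
  have val: "sg i * (mid r k \<bullet> (z + s *\<^sub>R w)) = c + s * d" for s by (simp add: c_def d_def inner_add_right algebra_simps)
  have le: "c + s * d \<le> apo r" if "s \<in> {0..\<epsilon>}" for s
    using regular_mem[OF reg[OF that]] k unfolding mem_polygon[OF i] val[symmetric] by blast
  have eq: "c + s * d = apo r" using t unfolding tight_def val .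
  have "c \<le> apo r" "c + \<epsilon> * d \<le> apo r" using le[of 0] le[of \<epsilon>] s by auto
  then have "s * d \<ge> 0" "(\<epsilon> - s) * d \<le> 0" using eq by (auto simp: algebra_simps)
  then have "d = 0" using s by (simp add: zero_le_mult_iff mult_le_0_iff)
  then show False using nz assms(4) sg[OF i] by (auto simp: d_def)
qed

end

section \<open>Folding the necklace onto the table\<close>

context pentagon_surfaces
begin

text \<open>A point on a side and its partner have the same component along the side and opposite
  normal components, and the linear reflection exchanges such points.\<close>

lemma side_reflection_opp:
  assumes "regular (necklace r) g z" "k < 5" "N.tight g k z"
  shows "side_reflection r k (N.opp g k z) = z"
proof -
  have g: "g \<in> labels (necklace r)" using assms(1) by (rule N.regular_label)
  have lin: "linear (side_reflection r k)"
    using dihedral_orthogonal[OF r0 side_reflection_dihedral[OF assms(2)]] by (simp add: orthogonal_transformation_def)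
  have "orient g *\<^sub>R z \<in> side r k" using N.regular_mem[OF assms(1)] assms(3)
    by (simp add: side_tight[OF r0 assms(2)] N.mem_polygon_pentagon[OF g] N.tight_def)
  then obtain u where u: "orient g *\<^sub>R z = (1 - u) *\<^sub>R (mid r k - half_side r k) + u *\<^sub>R (mid r k + half_side r k)"
    unfolding side_mid in_segment by blast
  define \<mu> where "\<mu> = 2 * u - 1"
  have e: "orient g *\<^sub>R z = mid r k + \<mu> *\<^sub>R half_side r k" unfolding u \<mu>_def by (simp add: complex_eq_iff algebra_simps)
  have z: "z = orient g *\<^sub>R (mid r k + \<mu> *\<^sub>R half_side r k)" unfolding e[symmetric] using N.sg_sq[OF g] by simp
  have o: "N.opp g k z = orient g *\<^sub>R (- mid r k + \<mu> *\<^sub>R half_side r k)"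
    unfolding N.opp_def by (subst z) (simp add: complex_eq_iff algebra_simps)
  show ?thesis unfolding o
    by (subst z) (simp add: linear_cmul[OF lin] linear_add[OF lin] linear_diff[OF lin] linear_neg[OF lin] side_reflection_mid[OF r0] side_reflection_half_side[OF r0])
qed

text \<open>Crossing side \<open>k\<close> multiplies the label by its reflection on the left, and
  by \<open>side_reflection_opp\<close> the same reflection takes the partner back. So both
  representatives fold to one point.\<close>

lemma fold_cls:
  assumes "regular (necklace r) g z"
  shows "fold_point (N.cls g z) = inv g z"
proof -
  have "g \<in> dihedral r" using N.regular_label[OF assms] by (simp add: labels_N)
  then have b: "bij g" by (rule dihedral_bij[OF r0])
  have const: "(case y of (g, z) \<Rightarrow> inv g z) = inv g z" if "y \<in> N.cls g z" for y
  proof -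
    from that consider "y = (g, z)" | k where "k < 5" "N.tight g k z" "y = (nbN r g k, N.opp g k z)"
      unfolding N.cls_regular[OF assms] by blast
    then show ?thesis
    proof cases
      case 2
      have bs: "bij (side_reflection r k)" by (rule dihedral_bij[OF r0 side_reflection_dihedral[OF 2(1)]])
      have "inv (nbN r g k) = inv g \<circ> side_reflection r k"
        unfolding nbN_def o_inv_distrib[OF bs b] using inv_unique_comp[OF side_reflection_involution[OF r0] side_reflection_involution[OF r0]] by simp
      then show ?thesis using side_reflection_opp[OF assms 2(1,2)] 2(3) by simp
    qed simp
  qed
  have "(\<lambda>(g, z). inv g z) ` N.cls g z = (\<lambda>_. inv g z) ` N.cls g z" by (rule image_cong[OF refl const])
  also have "\<dots> = {inv g z}" using surface_point_refl[of "(g, z)" "necklace r"] by (auto simp only: image_constant_conv empty_iff split: if_splits)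
  finally have "(\<lambda>(g, z). inv g z) ` N.cls g z = {inv g z}" .
  then show ?thesis unfolding fold_point_def by simp
qed

lemma fold_mem: "regular (necklace r) g z \<Longrightarrow> z = g (inv g z)"
  using dihedral_bij[OF r0] N.regular_label[of g z] by (simp add: labels_N bij_is_surj surj_f_inv_f)

lemma inv_rot: "u ^ 5 = 1 \<Longrightarrow> inv (rot u) = rot (cnj u)"
  by (rule inv_unique_comp) (simp_all add: rot_rot unity_cnj)

lemma inv_rfl: "u ^ 5 = 1 \<Longrightarrow> inv (rfl u) = rfl u"
  by (rule inv_unique_comp) (simp_all add: rfl_rfl unity_cnj)

lemma fold_deck:
  assumes "u ^ 5 = 1" "over x y" shows "fold_point (deck u y) = cnj u * fold_point y"
proof -
  obtain g z where g: "regular (necklace r) g z" "y = N.cls g z" using assms(2) by (auto simp: over_def)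
  have b: "bij g" "bij (rot u)" using dihedral_bij[OF r0] N.regular_label[OF g(1)] rot_dihedral[OF r0 assms(1)] by (auto simp: labels_N)
  have "inv (g \<circ> rot u) z = cnj u * inv g z" unfolding o_inv_distrib[OF b] inv_rot[OF assms(1)] by (simp add: rot_def)
  then show ?thesis using fold_cls[OF g(1)] fold_cls[OF deck_regular[OF assms(1) g(1)]] deck_cls[OF assms(1) g(1)] g(2) by simp
qed

lemma flip_regular: "u ^ 5 = 1 \<Longrightarrow> regular (necklace r) g z \<Longrightarrow> regular (necklace r) (g \<circ> rfl u) (- z)"
  using pent_morphism.morphism(1)[OF flip_morphism] by simp

lemma fold_flip:
  assumes "u ^ 5 = 1" "over x y" shows "fold_point (flip u y) = - (u * cnj (fold_point y))"
proof -
  obtain g z where g: "regular (necklace r) g z" "y = N.cls g z" using assms(2) by (auto simp: over_def)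
  have gd: "g \<in> dihedral r" using N.regular_label[OF g(1)] by (simp add: labels_N)
  have b: "bij g" "bij (rfl u)" using dihedral_bij[OF r0] gd rfl_dihedral[OF r0 assms(1)] by auto
  have lin: "linear g" using dihedral_orthogonal[OF r0 gd] by (simp add: orthogonal_transformation_def)
  have "inv g (- z) = - inv g z"
  proof -
    have "g (- inv g z) = - z" using fold_mem[OF g(1)] by (simp add: linear_neg[OF lin])
    then show ?thesis using b(1) by (metis bij_inv_eq_iff)
  qed
  then have "inv (g \<circ> rfl u) (- z) = - (u * cnj (inv g z))" unfolding o_inv_distrib[OF b] inv_rfl[OF assms(1)] by (simp add: rfl_def)
  then show ?thesis using fold_cls[OF g(1)] fold_cls[OF flip_regular[OF assms(1) g(1)]] flip_cls[OF assms(1) g(1)] g(2) by simp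
qed

lemma bounce_iff:
  assumes "regular (necklace r) g z"
  shows "fold_point (N.cls g z) \<in> (\<Union>k<5. side r k) \<longleftrightarrow> (\<exists>k<5. N.tight g k z)"
proof -
  have gl: "g \<in> labels (necklace r)" using N.regular_label[OF assms] .
  then have gd: "g \<in> dihedral r" by (simp add: labels_N)
  define y where "y = inv g z"
  have z: "z = g y" using fold_mem[OF assms] by (simp add: y_def)
  have "y \<in> pentagon r"
  proof -
    have "g y \<in> g ` pentagon r" using N.regular_mem[OF assms] z by (simp add: polygon_N)
    then show ?thesis using dihedral_bij[OF r0 gd] by (simp add: inj_image_mem_iff bij_is_inj)
  qed
  then have s: "y \<in> side r k \<longleftrightarrow> mid r k \<bullet> y = apo r" if "k < 5" for k using side_tight[OF r0 that] by auto
  have key: "mid r k \<bullet> y = orient g * (mid r l \<bullet> z)" if "g (mid r k) = orient g *\<^sub>R mid r l" for k l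
  proof -
    have "mid r k \<bullet> y = g (mid r k) \<bullet> g y" using dihedral_orthogonal[OF r0 gd] by (simp add: orthogonal_transformation_def)
    then show ?thesis using that z by simp
  qed
  have "(\<exists>k<5. mid r k \<bullet> y = apo r) \<longleftrightarrow> (\<exists>k<5. N.tight g k z)"
  proof
    assume "\<exists>k<5. mid r k \<bullet> y = apo r"
    then obtain k where k: "k < 5" "mid r k \<bullet> y = apo r" by blast
    then show "\<exists>k<5. N.tight g k z" using dihedral_side(1)[OF r0 gd k(1)] key unfolding N.tight_def by metis
  next
    assume "\<exists>k<5. N.tight g k z"
    then obtain k where k: "k < 5" "N.tight g k z" by blast
    then show "\<exists>k<5. mid r k \<bullet> y = apo r" using dihedral_side(2)[OF r0 gd k(1)] key unfolding N.tight_def by metis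
  qed
  then show ?thesis unfolding fold_cls[OF assms] y_def[symmetric] using s by auto
qed

text \<open>The element is \<open>g \<circ> inv g'\<close>: it takes one copy to the other and, as
  the folded points agree, also the one point to the other.\<close>

lemma fold_eq_imp_act:
  assumes "over x y" "over x' y'" "fold_point y = fold_point y'"
  shows "\<exists>h\<in>dihedral r. y = act h y'"
proof -
  obtain g z where g: "regular (necklace r) g z" "y = N.cls g z" using assms(1) by (auto simp: over_def)
  obtain g' z' where g': "regular (necklace r) g' z'" "y' = N.cls g' z'" using assms(2) by (auto simp: over_def)
  have gd: "g \<in> dihedral r" "g' \<in> dihedral r" using N.regular_label[OF g(1)] N.regular_label[OF g'(1)] by (auto simp: labels_N)
  have e: "inv g z = inv g' z'" using assms(3) fold_cls g g' by simp
  have inv_d: "inv g' \<in> dihedral r"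
  proof -
    obtain u where u: "u ^ 5 = 1" "g' = rot u \<or> g' = rfl u" using gd(2) dihedral_eq[OF r0] by blast
    have "rot (cnj u) \<in> dihedral r" "rfl u \<in> dihedral r" using u(1) by (simp_all add: rot_dihedral[OF r0] rfl_dihedral[OF r0])
    then show ?thesis using u inv_rot inv_rfl by auto
  qed
  define h where "h = g \<circ> inv g'"
  have h: "h \<in> dihedral r" unfolding h_def by (rule dihedral_comp[OF r0 gd(1) inv_d])
  have "h \<circ> g' = g" unfolding h_def comp_assoc using dihedral_bij[OF r0 gd(2)] by (simp add: bij_is_inj)
  moreover have "h z' = z" using fold_mem[OF g(1)] e by (simp add: h_def)
  ultimately show ?thesis using act_cls[OF h g'(1)] g(2) g'(2) h by auto
qed

lemma act_deck_commute: "act h (deck u y) = deck u (act h y)"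
  by (simp add: act_def deck_def image_image map_prod_def case_prod_unfold comp_assoc)

lemma act_act: "act h (act h' y) = act (h \<circ> h') y"
  by (simp add: act_def image_image map_prod_def case_prod_unfold comp_assoc)

lemma act_id [simp]: "act id y = y"
  by (simp add: act_def map_prod_def case_prod_unfold)

lemma finite_dihedral: "finite (dihedral r)"
proof -
  have "finite {u::complex. u ^ 5 = 1}" using card_roots_unity_eq[of 5] by (metis card.infinite zero_less_numeral zero_neq_numeral)
  moreover have "dihedral r = rot ` {u. u ^ 5 = 1} \<union> rfl ` {u. u ^ 5 = 1}" using dihedral_eq[OF r0] by auto
  ultimately show ?thesis by simp
qed

end

section \<open>The monodromy of a lift\<close>

locale lifted_geodesic = pentagon_surfaces +
  fixes p :: "real \<Rightarrow> (complex set \<times> complex) set" and v :: complex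
    and q :: "real \<Rightarrow> ((complex \<Rightarrow> complex) \<times> complex) set" and T :: real
  assumes v: "norm v = 1" and lift: "lifts_along v p UNIV q"
    and T: "T > 0" and per: "\<And>t. p (t + T) = p t"
    and min_per: "\<And>T'. (\<And>t. p (t + T') = p t) \<Longrightarrow> \<exists>n::int. T' = of_int n * T"
begin

lemma strq: "straight_on (necklace r) v UNIV q" and cov: "covering r (q t) = p t"
  using lift by (auto simp: lifts_along_def)

lemma strp: "straight_on (double_pentagon r) v UNIV p"
  using covering_straight[OF strq] cov by simp

lemma over_q: "over (p t) (q t)"
  by (rule lifts_along_over[OF lift]) simp

text \<open>\<open>q T\<close> and \<open>q 0\<close> lie over one point, so a deck transformation
  relates them. It preserves directions, hence the relation continues to all times.\<close>

lemma ex_monodromy: "\<exists>u. u ^ 5 = 1 \<and> (\<forall>t. q (t + T) = deck u (q t))"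
proof -
  have "over (p 0) (q T)" using over_q[of T] per[of 0] by simp
  then obtain u where u: "u ^ 5 = 1" "q T = deck u (q 0)" using fibre_transitive[OF over_q[of 0]] by blast
  have "straight_on (necklace r) v UNIV (\<lambda>t. q (t + T))" using straight_on_shift[OF strq, of T] by simp
  from N.unique_continuation[OF this deck_straight[OF u(1) strq], of 0] u(2) have "q (t + T) = deck u (q t)" for t by simp
  then show ?thesis using u(1) by blast
qed

definition mon :: complex where "mon = (SOME u. u ^ 5 = 1 \<and> (\<forall>t. q (t + T) = deck u (q t)))"

lemma mon: "mon ^ 5 = 1" "q (t + T) = deck mon (q t)"
proof -
  have "mon ^ 5 = 1 \<and> (\<forall>t. q (t + T) = deck mon (q t))" unfolding mon_def by (rule someI_ex[OF ex_monodromy])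
  then show "mon ^ 5 = 1" "q (t + T) = deck mon (q t)" by blast+
qed

lemma mon_pow: "(mon ^ n) ^ 5 = 1"
  using mon(1) by (metis power_mult mult.commute power_one)

lemma q_mult: "q (t + real n * T) = deck (mon ^ n) (q t)"
proof (induction n)
  case (Suc n)
  have "q (t + real (Suc n) * T) = q ((t + real n * T) + T)" by (simp add: algebra_simps)
  also have "\<dots> = deck (mon ^ Suc n) (q t)" unfolding mon(2) Suc deck_deck by (simp add: mult.commute)
  finally show ?case .
qed simp

lemma q_5T: "q (t + 5 * T) = q t"
  using q_mult[of t 5] mon(1) by simp

lemma deck_q_straight: "u ^ 5 = 1 \<Longrightarrow> straight_on (necklace r) v UNIV (\<lambda>t. deck u (q t))"
  by (rule deck_straight[OF _ strq])

lemma cov_deck: "u ^ 5 = 1 \<Longrightarrow> covering r (deck u (q t)) = p t"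
  using deck_over[OF _ over_q] by (simp add: over_def)

lemma p_eq: assumes "p t = p t'" shows "\<exists>n::int. t' - t = of_int n * T"
  by (rule min_per) (rule DP.return_imp_period[OF strp assms])

lemma length_p: "trajectory_length p = T"
proof (rule trajectory_length_eq[where \<gamma> = p and T = T, OF T per])
  fix T' assume T': "T' > 0" "\<And>t. p (t + T') = p t"
  obtain n :: int where n: "T' = of_int n * T" using min_per[OF T'(2)] by blast
  then have "n > 0" using T'(1) T by (simp add: zero_less_mult_iff)
  then have "1 * T \<le> of_int n * T" using T by (intro mult_right_mono) auto
  then show "T \<le> T'" using n by simp
qed

lemma q_period:
  assumes "T' > 0" "\<And>t. q (t + T') = q t"
  shows "\<exists>n>0. T' = real n * T \<and> mon ^ n = 1"
proof -
  have "p (t + T') = p t" for t using assms(2) cov by metis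
  then obtain m :: int where m: "T' = of_int m * T" using min_per by blast
  then have m0: "m > 0" using assms(1) T by (simp add: zero_less_mult_iff)
  define n where "n = nat m"
  have n: "T' = real n * T" "n > 0" using m m0 by (auto simp: n_def)
  have "deck (mon ^ n) (q 0) = q 0" using q_mult[of 0 n] assms(2)[of 0] n by simp
  then have "mon ^ n = 1" by (rule deck_free[OF mon_pow over_q])
  then show ?thesis using n by blast
qed

lemma length_q: "trajectory_length q = (if mon = 1 then T else 5 * T)"
proof (cases "mon = 1")
  case True
  have "trajectory_length q = T"
  proof (rule trajectory_length_eq[OF T])
    show "q (t + T) = q t" for t using mon(2) True by simp
    fix T' assume T': "T' > 0" "\<And>t. q (t + T') = q t"
    obtain n where n: "n > 0" "T' = real n * T" using q_period[OF T'] by blast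
    then have "1 * T \<le> real n * T" using T by (intro mult_right_mono) auto
    then show "T \<le> T'" using n by simp
  qed
  then show ?thesis using True by simp
next
  case False
  have "trajectory_length q = 5 * T"
  proof (rule trajectory_length_eq[where \<gamma> = q and T = "5 * T", OF _ q_5T])
    show "5 * T > 0" using T by simp
    fix T' assume T': "T' > 0" "\<And>t. q (t + T') = q t"
    obtain n where n: "n > 0" "T' = real n * T" "mon ^ n = 1" using q_period[OF T'] by blast
    have "5 \<le> n" using unity_generated(2)[OF mon(1) False n(3)] n(1) dvd_imp_le by blast
    then have "5 * T \<le> real n * T" using T by (intro mult_right_mono) auto
    then show "5 * T \<le> T'" using n by simp
  qed
  then show ?thesis using False by simp
qed

lemma preimage_eq: "necklace_preimage r p = {deck u (q t) | u t. u ^ 5 = 1}"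
proof
  show "necklace_preimage r p \<subseteq> {deck u (q t) | u t. u ^ 5 = 1}"
  proof
    fix y assume "y \<in> necklace_preimage r p"
    then obtain g z t where y: "y = N.cls g z" "g \<in> dihedral r" "covering r y = p t"
      by (auto simp: necklace_preimage_def surface_def labels_N)
    have "(g ` pentagon r, z) \<in> p t" unfolding y(3)[symmetric] y(1) covering_def using surface_point_refl by force
    moreover obtain P w where w: "regular (double_pentagon r) P w" "p t = DP.cls P w" using DP.straight_on_regular[OF strp, of t] by auto
    ultimately have "DP.cls P w = DP.cls (g ` pentagon r) z" by (simp add: surface_point_mem)
    then have "regular (double_pentagon r) (g ` pentagon r) z" by (rule DP.regular_cong[OF w(1)])
    then have "regular (necklace r) g z" by (rule regular_lift[OF y(2)])
    then have "over (p t) y" using y by (auto simp: over_def)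
    then show "y \<in> {deck u (q t) | u t. u ^ 5 = 1}" using fibre_transitive[OF over_q] by blast
  qed
  show "{deck u (q t) | u t. u ^ 5 = 1} \<subseteq> necklace_preimage r p"
  proof
    fix y assume "y \<in> {deck u (q t) | u t. u ^ 5 = 1}"
    then obtain u t where u: "y = deck u (q t)" "u ^ 5 = 1" by blast
    have "over (p t) y" unfolding u(1) by (rule deck_over[OF u(2) over_q])
    then obtain g z where g: "regular (necklace r) g z" "y = N.cls g z" "covering r y = p t" by (auto simp: over_def)
    then show "y \<in> necklace_preimage r p" using N.regular_label[OF g(1)] N.regular_mem[OF g(1)]
      by (auto simp: necklace_preimage_def surface_def)
  qed
qed

text \<open>Equal points lie over one point of \<open>p\<close>, so the times differ by a multiple
  of \<open>T\<close>, which is a period of \<open>q\<close> here. Freeness then identifies the deck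
  transformations.\<close>

lemma sheets_disjoint:
  assumes "mon = 1" "u ^ 5 = 1" "w ^ 5 = 1" "deck u (q t) = deck w (q t')"
  shows "u = w" "q t = q t'"
proof -
  have "p t = p t'" using assms cov_deck by metis
  then obtain n :: int where n: "t' - t = of_int n * T" using p_eq by blast
  have "q (t + of_int n * T) = q t" by (rule periodic_int) (use mon(2) assms(1) in simp)
  then show q: "q t = q t'" using n by (simp add: algebra_simps)
  have c: "w * cnj w = 1" "cnj w * w = 1" using unity_cnj[OF assms(3)] by auto
  have "deck (cnj w) (deck u (q t)) = deck (cnj w) (deck w (q t))" using assms(4) q by simp
  then have "deck (u * cnj w) (q t) = q t" unfolding deck_deck by (simp add: c)
  then have "u * cnj w = 1" by (rule deck_free[OF _ over_q, rotated]) (use assms in simp)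
  then have "u * cnj w * w = w" by simp
  then show "u = w" by (simp add: mult.assoc c)
qed

lemma periodic_deck: "u ^ 5 = 1 \<Longrightarrow> periodic_trajectory (necklace r) v (\<lambda>t. deck u (q t))"
  unfolding periodic_trajectory_def trajectory_def using v deck_q_straight q_5T T
  by (auto intro!: exI[of _ "5 * T"])

lemma card_unity: "card {u::complex. u ^ 5 = 1} = 5"
  using card_roots_unity_eq[of 5] by simp

lemma five_of_trivial:
  assumes m: "mon = 1" shows "lifts_to_five r p"
proof -
  define D where "D u = range (\<lambda>t. deck u (q t))" for u
  define \<C> where "\<C> = D ` {u. u ^ 5 = 1}"
  have disj: "D u \<inter> D w = {}" if "u ^ 5 = 1" "w ^ 5 = 1" "u \<noteq> w" for u w
    using sheets_disjoint(1)[OF m that(1,2)] that(3) by (auto simp: D_def)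
  have ne: "D u \<noteq> {}" for u by (simp add: D_def)
  have "inj_on D {u. u ^ 5 = 1}"
  proof (rule inj_onI)
    fix u w assume "u \<in> {u. u ^ 5 = 1}" "w \<in> {u. u ^ 5 = 1}" "D u = D w"
    then show "u = w" using disj[of u w] ne[of u] by auto
  qed
  then have "card \<C> = 5" unfolding \<C>_def using card_image card_unity by metis
  moreover have "disjoint \<C>" unfolding \<C>_def disjoint_def using disj by blast
  moreover have "necklace_preimage r p = \<Union>\<C>" unfolding preimage_eq \<C>_def D_def by blast
  moreover have "(\<exists>v q. periodic_trajectory (necklace r) v q \<and> C = range q) \<and> bij_betw (covering r) C (range p)" if C: "C \<in> \<C>" for C
  proof -
    obtain u where u: "u ^ 5 = 1" "C = D u" using C by (auto simp: \<C>_def)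
    have "inj_on (covering r) C"
    proof (rule inj_onI)
      fix a b assume "a \<in> C" "b \<in> C" "covering r a = covering r b"
      then obtain t t' where t: "a = deck u (q t)" "b = deck u (q t')" "p t = p t'" using u by (auto simp: D_def cov_deck)
      obtain n :: int where n: "t' - t = of_int n * T" using p_eq[OF t(3)] by blast
      have "q (t + of_int n * T) = q t" by (rule periodic_int) (use mon(2) m in simp)
      then have "q t = q t'" using n by (simp add: algebra_simps)
      then show "a = b" using t by simp
    qed
    moreover have "covering r ` C = range p" using u by (auto simp: D_def cov_deck image_image)
    ultimately have "bij_betw (covering r) C (range p)" by (simp add: bij_betw_def)
    then show ?thesis using periodic_deck[OF u(1)] u(2) unfolding D_def by blast
  qed
  ultimately show ?thesis unfolding lifts_to_five_def by blast
qed

lemma range_q_of_nontrivial: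
  assumes m: "mon \<noteq> 1" and u: "u ^ 5 = 1"
  shows "deck u (q t) \<in> range q"
proof -
  obtain n where "u = mon ^ n" using unity_generated(1)[OF mon(1) m u] by blast
  then have "deck u (q t) = q (t + real n * T)" by (simp add: q_mult)
  then show ?thesis by simp
qed

lemma one_of_nontrivial:
  assumes m: "mon \<noteq> 1" shows "lifts_to_one r p"
proof -
  have "necklace_preimage r p = range q"
  proof
    show "necklace_preimage r p \<subseteq> range q" unfolding preimage_eq using range_q_of_nontrivial[OF m] by auto
    show "range q \<subseteq> necklace_preimage r p"
    proof
      fix y assume "y \<in> range q"
      then obtain t where "y = deck 1 (q t)" by auto
      then show "y \<in> necklace_preimage r p" unfolding preimage_eq by (intro CollectI exI[of _ 1] exI[of _ t]) simp
    qed
  qed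
  moreover have "periodic_trajectory (necklace r) v q" using periodic_deck[of 1] by simp
  ultimately show ?thesis unfolding lifts_to_one_def using length_q length_p m by auto
qed

text \<open>By \<open>parallel_component\<close> a periodic trajectory in the preimage would have
  range \<open>range q\<close>, where the covering is not injective: \<open>q 0\<close> and
  \<open>q T\<close> are different points over \<open>p 0\<close>.\<close>

lemma not_five_of_nontrivial:
  assumes m: "mon \<noteq> 1" shows "\<not> lifts_to_five r p"
proof
  assume "lifts_to_five r p"
  then obtain \<C> where C: "card \<C> = 5" "necklace_preimage r p = \<Union>\<C>"
    "\<forall>C\<in>\<C>. (\<exists>v q. periodic_trajectory (necklace r) v q \<and> C = range q) \<and> bij_betw (covering r) C (range p)"
    unfolding lifts_to_five_def by blast
  have "\<C> \<noteq> {}" using C(1) by auto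
  then obtain X where X: "X \<in> \<C>" by blast
  from bspec[OF C(3) X] obtain v' q' where q': "periodic_trajectory (necklace r) v' q'" "X = range q'" "bij_betw (covering r) X (range p)"
    by (elim conjE exE)
  have "range q' \<subseteq> range q"
  proof -
    have "range q' \<subseteq> necklace_preimage r p" using X C(2) q'(2) by (simp add: Union_upper)
    also have "\<dots> \<subseteq> range q" unfolding preimage_eq using range_q_of_nontrivial[OF m] by auto
    finally show ?thesis .
  qed
  then have "\<exists>j\<in>{()}. (v' = v \<or> v' = - v) \<and> range q' = range q"
    using q'(1) v strq q_5T T
    by (intro N.parallel_component[where J = "{()}" and w = "\<lambda>_. v" and \<gamma> = "\<lambda>_. q"])
      (auto simp: periodic_trajectory_def trajectory_def intro!: exI[of _ "5 * T"])
  then have "inj_on (covering r) (range q)" using q'(2,3) by (simp add: bij_betw_def)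
  moreover have "covering r (q T) = covering r (q 0)" using per[of 0] by (simp add: cov)
  ultimately have "q T = q 0" by (auto dest: inj_onD)
  then have "deck mon (q 0) = q 0" using mon(2)[of 0] by simp
  then show False using deck_free[OF mon(1) over_q] m by blast
qed

text \<open>A single periodic trajectory that covers the preimage would have the range of one sheet,
  and the sheet shifted by \<open>omega\<close> is disjoint from it.\<close>

lemma not_one_of_trivial:
  assumes m: "mon = 1" shows "\<not> lifts_to_one r p"
proof
  assume "lifts_to_one r p"
  then obtain v' q' where q': "periodic_trajectory (necklace r) v' q'" "necklace_preimage r p = range q'"
    unfolding lifts_to_one_def by blast
  have fin: "finite {u::complex. u ^ 5 = 1}" using card_unity by (intro card_ge_0_finite) simp
  have "\<exists>u\<in>{u. u ^ 5 = 1}. (v' = v \<or> v' = - v) \<and> range q' = range (\<lambda>t. deck u (q t))"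
  proof (rule N.parallel_component[where w = "\<lambda>_. v" and \<gamma> = "\<lambda>u t. deck u (q t)", OF fin])
    show "norm v = 1 \<and> straight_on (necklace r) v UNIV (\<lambda>t. deck u (q t)) \<and> (\<exists>T>0. \<forall>t. deck u (q (t + T)) = deck u (q t))"
      if "u \<in> {u. u ^ 5 = 1}" for u using periodic_deck[of u] that by (auto simp: periodic_trajectory_def trajectory_def)
    show "norm v' = 1" "straight_on (necklace r) v' UNIV q'" using q'(1) by (auto simp: periodic_trajectory_def trajectory_def)
    show "\<exists>u\<in>{u. u ^ 5 = 1}. q' t \<in> range (\<lambda>t. deck u (q t))" for t
    proof -
      have "q' t \<in> necklace_preimage r p" using q'(2) by simp
      then show ?thesis unfolding preimage_eq by blast
    qed
  qed
  then obtain u where u: "u ^ 5 = 1" "range q' = range (\<lambda>t. deck u (q t))" by blast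
  have uo: "(u * omega) ^ 5 = 1" using u(1) by simp
  then have "deck (u * omega) (q 0) \<in> necklace_preimage r p" unfolding preimage_eq by blast
  then obtain t where "deck (u * omega) (q 0) = deck u (q t)" using q'(2) u(2) by auto
  then have "u * omega = u" using sheets_disjoint(1)[OF m uo u(1)] by blast
  moreover have "u \<noteq> 0" using u(1) by auto
  ultimately show False using omega_ne_1 by simp
qed

section \<open>Symmetries of the folded trajectory\<close>

abbreviation x :: "real \<Rightarrow> complex" where "x \<equiv> fold_point \<circ> q"

lemma rotation_symmetric_of_nontrivial:
  assumes m: "mon \<noteq> 1" shows "rotation_symmetric x"
proof -
  have om: "cis (2 * pi / 5) = omega" by (simp add: omega_def)
  have mem: "cnj u * x t \<in> range x" if u: "u ^ 5 = 1" for u t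
  proof -
    have "cnj u * x t = fold_point (deck u (q t))" using fold_deck[OF u over_q] by simp
    moreover obtain s where "deck u (q t) = q s" using range_q_of_nontrivial[OF m u, of t] by blast
    ultimately show ?thesis by simp
  qed
  have "(\<lambda>z. omega * z) ` range x = range x"
  proof
    have "(cnj omega) ^ 5 = 1" by simp
    from mem[OF this] show "(\<lambda>z. omega * z) ` range x \<subseteq> range x" by auto
    show "range x \<subseteq> (\<lambda>z. omega * z) ` range x"
    proof
      fix y assume "y \<in> range x"
      then obtain t where t: "y = x t" by blast
      have "y = omega * (cnj omega * x t)" by (simp add: t mult.assoc[symmetric] unity_cnj[OF omega_pow5])
      then show "y \<in> (\<lambda>z. omega * z) ` range x" using mem[OF omega_pow5, of t] by blast
    qed
  qed
  then show ?thesis unfolding rotation_symmetric_def om .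
qed

lemma not_rotation_symmetric_of_trivial:
  assumes m: "mon = 1" shows "\<not> rotation_symmetric x"
proof
  assume "rotation_symmetric x"
  then have sym: "(\<lambda>z. omega * z) ` range x = range x" unfolding rotation_symmetric_def omega_def .
  define c where "c = cnj omega"
  have c: "c ^ 5 = 1" by (simp add: c_def)
  \<comment> \<open>The rotated path is the folding of \<open>deck c (q t)\<close>. Each of its
    points folds like some point of \<open>q\<close>, so it lies on a curve
    \<open>act h (q t)\<close>. There are finitely many such curves, hence one of them is the entire
    deck translate.\<close>
  have "\<exists>h\<in>dihedral r. (v = h v \<or> v = - h v) \<and> range (\<lambda>t. deck c (q t)) = range (\<lambda>t. act h (q t))"
  proof (rule N.parallel_component[where w = "\<lambda>h. h v" and \<gamma> = "\<lambda>h t. act h (q t)", OF finite_dihedral])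
    fix h assume h: "h \<in> dihedral r"
    have "norm (h v) = 1" using dihedral_orthogonal[OF r0 h] v by (simp add: orthogonal_transformation)
    moreover have "\<exists>T>0. \<forall>t. act h (q (t + T)) = act h (q t)" using q_5T T by (intro exI[of _ "5 * T"]) simp
    ultimately show "norm (h v) = 1 \<and> straight_on (necklace r) (h v) UNIV (\<lambda>t. act h (q t)) \<and> (\<exists>T>0. \<forall>t. act h (q (t + T)) = act h (q t))"
      using act_straight[OF h strq] by blast
  next
    fix t
    have "fold_point (deck c (q t)) = omega * x t" using fold_deck[OF c over_q] by (simp add: c_def)
    also have "\<dots> \<in> range x" using sym by blast
    finally obtain t' where t': "fold_point (deck c (q t)) = fold_point (q t')" by auto
    obtain h where "h \<in> dihedral r" "deck c (q t) = act h (q t')"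
      using fold_eq_imp_act[OF deck_over[OF c over_q] over_q t'] by blast
    then show "\<exists>h\<in>dihedral r. deck c (q t) \<in> range (\<lambda>t. act h (q t))" by blast
  qed (use v deck_q_straight[OF c] in auto)
  then obtain h where h: "h \<in> dihedral r" "v = h v \<or> v = - h v" "range (\<lambda>t. deck c (q t)) = range (\<lambda>t. act h (q t))" by blast
  \<comment> \<open>A rotation that preserves \<open>v\<close> up to sign is the identity, since
    \<open>-1\<close> is not a fifth root of unity; reflections are involutions anyway.\<close>
  have hh: "h \<circ> h = id"
  proof -
    obtain u where u: "u ^ 5 = 1" "h = rot u \<or> h = rfl u" using h(1) dihedral_eq[OF r0] by blast
    from u(2) show ?thesis
    proof
      assume hu: "h = rot u"
      have "v \<noteq> 0" using v by auto
      then have "u = 1 \<or> u = - 1" using h(2) by (auto simp: hu rot_def) (metis minus_minus mult_cancel_right1 mult_minus_left)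
      then have "u = 1" using u(1) by auto
      then show ?thesis using hu by simp
    next
      assume "h = rfl u"
      then show ?thesis using u(1) by (simp add: rfl_rfl unity_cnj)
    qed
  qed
  obtain t1 where t1: "deck c (q 0) = act h (q t1)" using h(3) by (metis (no_types, lifting) rangeE rangeI)
  obtain t2 where t2: "deck c (q t1) = act h (q t2)" using h(3) by (metis (no_types, lifting) rangeE rangeI)
  have "deck c (deck c (q 0)) = act h (deck c (q t1))" unfolding t1 act_deck_commute ..
  also have "\<dots> = q t2" unfolding t2 act_act hh by simp
  finally have "deck (c * c) (q 0) = deck 1 (q t2)" by (simp add: deck_deck)
  then have "c * c = 1" using sheets_disjoint(1)[OF m, of "c * c" 1] c by simp
  then have "cnj (c * c) = 1" by simp
  then have "omega ^ 2 = 1" by (simp add: c_def power2_eq_square)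
  then show False using omega_power_eq_1[of 2] by simp
qed

lemma reflection_symmetric:
  assumes sym: "\<And>t. p (t + \<tau>) = iota (p (- t))"
  shows "reflection_symmetric r x"
proof -
  \<comment> \<open>Halfway along the shift \<open>\<tau>\<close> the curve meets its own image at
    the same point.\<close>
  define c where "c = \<tau> / 2"
  have "p c = iota (p c)" using sym[of "- c"] by (simp add: c_def)
  obtain g z where g: "regular (necklace r) g z" "q c = N.cls g z" using N.straight_on_regular[OF strq, of c] by auto
  have gd: "g \<in> dihedral r" using N.regular_label[OF g(1)] by (simp add: labels_N)
  let ?P = "g ` pentagon r"
  have pc: "p c = DP.cls ?P z" "regular (double_pentagon r) ?P z" using covering_cls[OF g(1)] covering_regular[OF g(1)] cov[of c] g(2) by auto
  have lab: "?P \<in> labels (double_pentagon r)" by (rule image_label[OF gd])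
  have "DP.cls ?P z = DP.cls (uminus ` ?P) (- z)" using \<open>p c = iota (p c)\<close> pc(1) iota_cls[OF pc(2)] by simp
  moreover have "uminus ` ?P \<noteq> ?P" using DP.nb_neq[OF lab, of 0] by (simp add: nbD_def)
  \<comment> \<open>The involution exchanges the two pentagons, so a fixed point has two
    representatives: it lies on a side and is opposite to itself, that is, the midpoint.\<close>
  ultimately obtain k where k: "k < 5" "DP.tight ?P k z" "- z = DP.opp ?P k z"
    using DP.cls_eq_iff[OF pc(2)] by metis
  have kN: "N.tight g k z" "- z = N.opp g k z"
    using k(2,3) sgD_image[OF gd] by (simp_all add: N.tight_def DP.tight_def N.opp_def DP.opp_def)
  have lab': "g \<in> labels (necklace r)" using gd by (simp add: labels_N)
  \<comment> \<open>Among the lifts of the involution this one takes the copy \<open>g\<close> to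
    its neighbour across that side, and therefore fixes \<open>q c\<close>.\<close>
  obtain u where u: "u ^ 5 = 1" "nbN r g k = g \<circ> rfl u"
    using dihedral_opposite_orient[OF gd, of "nbN r g k"] N.nb_labels[OF lab' k(1)] N.nb_sg[OF lab' k(1)] by (auto simp: labels_N)
  have "flip u (q c) = N.cls (nbN r g k) (N.opp g k z)" unfolding g(2) flip_cls[OF u(1) g(1)] u(2) kN(2) ..
  then have fc: "flip u (q c) = q c" using N.cls_partner[OF g(1) k(1) kN(1)] g(2) by simp
  have "straight_on (necklace r) (- (- v)) UNIV (\<lambda>t. flip u (q (2 * c - t)))"
    using flip_straight[OF u(1) straight_on_reverse[OF strq, of "2 * c"]] by simp
  then have "straight_on (necklace r) v UNIV (\<lambda>t. flip u (q (2 * c - t)))" by simp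
  note cont = N.unique_continuation[OF strq this connected_UNIV UNIV_I UNIV_I]
  have eq: "q t = flip u (q (2 * c - t))" for t
    by (rule cont[of c]) (simp add: fc)
  have xt: "x t = - (u * cnj (x (2 * c - t)))" for t
  proof -
    have "fold_point (q t) = fold_point (flip u (q (2 * c - t)))" by (rule arg_cong[OF eq])
    then show ?thesis unfolding fold_flip[OF u(1) over_q] comp_def .
  qed
  \<comment> \<open>The axis is spanned by \<open>\<i>\<close> times a square root of
    \<open>u\<close>, for which \<open>w / cnj w = - u\<close>.\<close>
  define \<eta> where "\<eta> = csqrt u"
  have eta: "\<eta> * \<eta> = u" by (simp add: \<eta>_def flip: power2_eq_square)
  have "norm \<eta> * norm \<eta> = 1" using unity_norm[OF u(1)] by (simp flip: norm_mult add: eta)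
  then have "norm \<eta> = 1" by (metis abs_norm_cancel abs_1 real_sqrt_abs2 real_sqrt_one)
  then have etac: "\<eta> * cnj \<eta> = 1" by (simp add: complex_norm_square[symmetric])
  define w where "w = \<i> * \<eta>"
  have w0: "w \<noteq> 0" using etac by (auto simp: w_def)
  have "w = - u * cnj w" using etac by (simp add: w_def eta[symmetric] mult.assoc)
  then have "w / cnj w = - u" using w0 by (simp add: field_simps)
  then have M: "line_reflection w z = - (rfl u z)" for z by (simp add: line_reflection_def rfl_def)
  have "line_reflection w ` pentagon r = uminus ` rfl u ` pentagon r" by (simp add: M image_image)
  also have "\<dots> = pentagon r" using dihedral_pentagon[OF r0 rfl_dihedral[OF r0 u(1)]] u(1) by (simp add: image_image)
  finally have 1: "line_reflection w ` pentagon r = pentagon r" .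
  have xM: "line_reflection w (x t) = x (2 * c - t)" for t using xt[of "2 * c - t"] by (simp add: M rfl_def)
  have 2: "line_reflection w ` range x = range x"
  proof
    show "line_reflection w ` range x \<subseteq> range x" using xM by auto
    show "range x \<subseteq> line_reflection w ` range x"
    proof
      fix y assume "y \<in> range x"
      then obtain t where "y = x t" by blast
      then have "y = line_reflection w (x (2 * c - t))" using xM[of "2 * c - t"] by simp
      then show "y \<in> line_reflection w ` range x" by blast
    qed
  qed
  show ?thesis unfolding reflection_symmetric_def using w0 1 2 by blast
qed

end

section \<open>Bounces and the length of billiard trajectories\<close>

context lifted_geodesic
begin

text \<open>The germ of \<open>q\<close> after \<open>t\<close> for \<open>\<sigma> = 1\<close> and
  before \<open>t\<close> for \<open>\<sigma> = -1\<close>, with its copy made explicit.\<close>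

definition piece :: "real \<Rightarrow> real \<Rightarrow> (complex \<Rightarrow> complex) \<Rightarrow> complex \<Rightarrow> real \<Rightarrow> bool" where
  "piece \<sigma> t g z \<epsilon> \<longleftrightarrow> \<epsilon> > 0 \<and> (\<forall>s\<in>{0..\<epsilon>}. regular (necklace r) g (z + s *\<^sub>R (\<sigma> *\<^sub>R v)) \<and>
     q (t + \<sigma> * s) = N.cls g (z + s *\<^sub>R (\<sigma> *\<^sub>R v)))"

definition bounce :: "real \<Rightarrow> bool" where
  "bounce t \<longleftrightarrow> x t \<in> (\<Union>k<5. side r k)"

text \<open>The orientation of the copy just before \<open>t\<close>, well defined by
  \<open>piece_unique\<close>; a value from the left, also at a bounce.\<close>

definition side_before :: "real \<Rightarrow> real" where
  "side_before t = orient (SOME g. \<exists>z \<epsilon>. piece (-1) t g z \<epsilon>)"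

lemma piece_exists:
  assumes "\<sigma> = 1 \<or> \<sigma> = -1" obtains g z \<epsilon> where "piece \<sigma> t g z \<epsilon>"
proof -
  have "ray (necklace r) (\<sigma> *\<^sub>R v) (\<lambda>s. q (t + \<sigma> * s))"
    using strq assms unfolding straight_on_ray by auto
  then show ?thesis unfolding ray_def piece_def[symmetric] using that by (auto simp: piece_def)
qed

lemma pieceD:
  assumes "piece \<sigma> t g z \<epsilon>" "s \<in> {0..\<epsilon>}"
  shows "regular (necklace r) g (z + s *\<^sub>R (\<sigma> *\<^sub>R v))" "q (t + \<sigma> * s) = N.cls g (z + s *\<^sub>R (\<sigma> *\<^sub>R v))"
  using assms unfolding piece_def by auto

lemma piece0:
  assumes "piece \<sigma> t g z \<epsilon>"
  shows "regular (necklace r) g z" "q t = N.cls g z"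
  using pieceD[OF assms, of 0] assms unfolding piece_def by auto

lemma piece_label: "piece \<sigma> t g z \<epsilon> \<Longrightarrow> g \<in> dihedral r"
  using N.regular_label[OF piece0(1)] by (simp add: labels_N)

lemma piece_inside:
  assumes "\<sigma> = 1 \<or> \<sigma> = -1" "piece \<sigma> t g z \<epsilon>" "0 < s" "s < \<epsilon>"
  shows "\<not> bounce (t + \<sigma> * s)" and "N.cls g (z + s *\<^sub>R (\<sigma> *\<^sub>R v)) = {(g, z + s *\<^sub>R (\<sigma> *\<^sub>R v))}"
proof -
  have s: "s \<in> {0..\<epsilon>}" using assms by simp
  note d = pieceD[OF assms(2) s]
  have nt: "\<not> N.tight g k (z + s *\<^sub>R (\<sigma> *\<^sub>R v))" if "k < 5" for k
  proof (rule N.no_side_inside[OF strq v d(2)])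
    show "\<sigma> *\<^sub>R v = v \<or> \<sigma> *\<^sub>R v = - v" using assms(1) by auto
    show "0 < s" "s < \<epsilon>" "k < 5" by fact+
    show "regular (necklace r) g (z + s' *\<^sub>R (\<sigma> *\<^sub>R v))" if "s' \<in> {0..\<epsilon>}" for s'
      using pieceD(1)[OF assms(2) that] .
  qed
  show "\<not> bounce (t + \<sigma> * s)" unfolding bounce_def comp_def d(2) bounce_iff[OF d(1)] using nt by blast
  show "N.cls g (z + s *\<^sub>R (\<sigma> *\<^sub>R v)) = {(g, z + s *\<^sub>R (\<sigma> *\<^sub>R v))}" unfolding N.cls_regular[OF d(1)] using nt by blast
qed

text \<open>Inner points of a piece lie on no side, so their class has one element and shows the
  label.\<close>

lemma piece_unique:
  assumes "\<sigma> = 1 \<or> \<sigma> = -1" "piece \<sigma> t g z \<epsilon>" "piece \<sigma> t g' z' \<epsilon>'"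
  shows "g = g'"
proof -
  define s where "s = min \<epsilon> \<epsilon>' / 2"
  have s: "0 < s" "s < \<epsilon>" "s < \<epsilon>'" using assms(2,3) by (auto simp: s_def piece_def)
  have "N.cls g (z + s *\<^sub>R (\<sigma> *\<^sub>R v)) = N.cls g' (z' + s *\<^sub>R (\<sigma> *\<^sub>R v))"
    using pieceD(2)[OF assms(2), of s] pieceD(2)[OF assms(3), of s] s by auto
  then show ?thesis using piece_inside(2)[OF assms(1,2) s(1,2)] piece_inside(2)[OF assms(1,3) s(1,3)] by simp
qed

lemma side_before_eq: "piece (-1) t g z \<epsilon> \<Longrightarrow> side_before t = orient g"
  unfolding side_before_def by (rule arg_cong[of _ _ orient], rule some_equality) (auto intro: piece_unique[of "-1" t])

lemma piece_shift:
  assumes s: "\<sigma> = 1 \<or> \<sigma> = -1" and p: "piece \<sigma> t g z \<epsilon>" and u: "0 < u" "u < \<epsilon>"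
  shows "\<exists>z' \<epsilon>'. piece (-1) (t + \<sigma> * u) g z' \<epsilon>'"
proof -
  define z' where "z' = z + u *\<^sub>R (\<sigma> *\<^sub>R v)"
  define \<epsilon>' where "\<epsilon>' = min u (\<epsilon> - u)"
  have "piece (-1) (t + \<sigma> * u) g z' \<epsilon>'"
    unfolding piece_def
  proof (intro conjI ballI)
    show "\<epsilon>' > 0" using u by (simp add: \<epsilon>'_def)
    fix a assume a: "a \<in> {0..\<epsilon>'}"
    define b where "b = u - \<sigma> * a"
    have b: "b \<in> {0..\<epsilon>}" using a s u by (auto simp: b_def \<epsilon>'_def)
    have e: "z' + a *\<^sub>R (-1 *\<^sub>R v) = z + b *\<^sub>R (\<sigma> *\<^sub>R v)" using s by (auto simp: z'_def b_def algebra_simps)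
    have t: "t + \<sigma> * u + -1 * a = t + \<sigma> * b" using s by (auto simp: b_def)
    show "regular (necklace r) g (z' + a *\<^sub>R (-1 *\<^sub>R v))" "q (t + \<sigma> * u + -1 * a) = N.cls g (z' + a *\<^sub>R (-1 *\<^sub>R v))"
      unfolding e t using pieceD[OF p b] by auto
  qed
  then show ?thesis by blast
qed

text \<open>A bounce exchanges the copies of the two orientations: if both pieces at a side lay in the same
  copy, the trajectory would be parallel to that side.\<close>

lemma bounce_orient:
  assumes b: "piece (-1) t g z \<epsilon>" and f: "piece 1 t g' z' \<epsilon>'"
  shows "orient g' = (if bounce t then - orient g else orient g)"
proof -
  note b0 = piece0[OF b] and f0 = piece0[OF f]
  have bt: "bounce t \<longleftrightarrow> (\<exists>k<5. N.tight g k z)" unfolding bounce_def comp_def b0(2) bounce_iff[OF b0(1)] ..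
  have gl: "g \<in> labels (necklace r)" using N.regular_label[OF b0(1)] .
  have "N.cls g z = N.cls g' z'" using b0 f0 by simp
  then consider "g' = g" "z' = z" | k where "k < 5" "N.tight g k z" "g' = nbN r g k" using N.cls_eq_iff[OF b0(1)] by metis
  then show ?thesis
  proof cases
    case 1
    have "\<not> bounce t"
    proof
      assume "bounce t"
      then obtain k where k: "k < 5" "N.tight g k z" using bt by blast
      have nz: "mid r k \<bullet> v \<noteq> 0" by (rule N.transversal[OF strq v b0(2,1) k])
      define s where "s = min \<epsilon> \<epsilon>'"
      have s: "0 < s" "s \<in> {0..\<epsilon>}" "s \<in> {0..\<epsilon>'}" using b f by (auto simp: s_def piece_def)
      have "orient g * (mid r k \<bullet> (z + s *\<^sub>R (-1 *\<^sub>R v))) \<le> apo r" "orient g * (mid r k \<bullet> (z + s *\<^sub>R (1 *\<^sub>R v))) \<le> apo r"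
        using N.regular_mem[OF pieceD(1)[OF b s(2)]] N.regular_mem[OF pieceD(1)[OF f s(3)]] k(1)
        unfolding 1 N.mem_polygon[OF gl] by blast+
      moreover have "orient g * (mid r k \<bullet> z) = apo r" using k(2) by (simp add: N.tight_def)
      ultimately have "s * (orient g * (mid r k \<bullet> v)) \<le> 0" "s * (orient g * (mid r k \<bullet> v)) \<ge> 0"
        by (simp_all add: inner_add_right inner_diff_right algebra_simps)
      then have "s * (orient g * (mid r k \<bullet> v)) = 0" by linarith
      then show False using s(1) nz N.sg[OF gl] by auto
    qed
    then show ?thesis using 1 by simp
  next
    case 2
    then show ?thesis using bt N.nb_sg[OF gl 2(1)] by auto
  qed
qed

text \<open>The half-open count fits the left-sided \<open>side_before\<close>: a bounce at
  \<open>a\<close> is still to come for \<open>side_before a\<close>, and one at \<open>b\<close> is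
  not yet seen by \<open>side_before b\<close>. Bisection reduces the claim to short
  intervals.\<close>

lemma bounce_parity:
  assumes "a \<le> b"
  shows "finite {t. a \<le> t \<and> t < b \<and> bounce t} \<and> side_before b = side_before a * (-1) ^ card {t. a \<le> t \<and> t < b \<and> bounce t}"
proof (rule Bolzano[OF assms, where P = "\<lambda>a b. finite {t. a \<le> t \<and> t < b \<and> bounce t} \<and>
    side_before b = side_before a * (-1) ^ card {t. a \<le> t \<and> t < b \<and> bounce t}"])
  fix a b c :: real
  let ?C = "\<lambda>a b. {t. a \<le> t \<and> t < b \<and> bounce t}"
  assume ab: "finite (?C a b) \<and> side_before b = side_before a * (-1) ^ card (?C a b)"
    and bc: "finite (?C b c) \<and> side_before c = side_before b * (-1) ^ card (?C b c)" and le: "a \<le> b" "b \<le> c"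
  have un: "?C a c = ?C a b \<union> ?C b c" and dis: "?C a b \<inter> ?C b c = {}" using le by auto
  have "card (?C a c) = card (?C a b) + card (?C b c)" unfolding un using ab bc dis by (intro card_Un_disjoint) auto
  moreover have "finite (?C a c)" unfolding un using ab bc by blast
  ultimately show "finite (?C a c) \<and> side_before c = side_before a * (-1) ^ card (?C a c)"
    using ab bc by (simp add: power_add)
next
  fix x0 :: real
  let ?C = "\<lambda>a b. {t. a \<le> t \<and> t < b \<and> bounce t}"
  obtain g1 z1 \<epsilon>1 where f: "piece 1 x0 g1 z1 \<epsilon>1" by (rule piece_exists[of 1]) simp_all
  obtain g2 z2 \<epsilon>2 where b: "piece (-1) x0 g2 z2 \<epsilon>2" by (rule piece_exists[of "-1"]) simp_all
  have e: "\<epsilon>1 > 0" "\<epsilon>2 > 0" using f b by (auto simp: piece_def)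
  have nb1: "\<not> bounce t" if "x0 < t" "t < x0 + \<epsilon>1" for t using piece_inside(1)[OF _ f, of "t - x0"] that by simp
  have nb2: "\<not> bounce t" if "x0 - \<epsilon>2 < t" "t < x0" for t using piece_inside(1)[OF _ b, of "x0 - t"] that by simp
  have L1: "side_before t = orient g1" if t: "x0 < t" "t < x0 + \<epsilon>1" for t
  proof -
    obtain z' \<epsilon>' where "piece (-1) (x0 + 1 * (t - x0)) g1 z' \<epsilon>'" using piece_shift[OF _ f, of "t - x0"] t by auto
    then show ?thesis using side_before_eq[of t] by simp
  qed
  have L2: "side_before t = orient g2" if t: "x0 - \<epsilon>2 < t" "t \<le> x0" for t
  proof (cases "t = x0")
    case True then show ?thesis using side_before_eq[OF b] by simp
  next
    case False
    obtain z' \<epsilon>' where "piece (-1) (x0 + -1 * (x0 - t)) g2 z' \<epsilon>'" using piece_shift[OF _ b, of "x0 - t"] t False by auto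
    then show ?thesis using side_before_eq[of t] by simp
  qed
  show "\<exists>d>0. \<forall>a b. a \<le> x0 \<and> x0 \<le> b \<and> b - a < d \<longrightarrow> finite (?C a b) \<and> side_before b = side_before a * (-1) ^ card (?C a b)"
  proof (intro exI[of _ "min \<epsilon>1 \<epsilon>2"] allI impI conjI)
    fix a c assume ac: "a \<le> x0 \<and> x0 \<le> c \<and> c - a < min \<epsilon>1 \<epsilon>2"
    have sub: "t = x0" if "t \<in> ?C a c" for t
    proof (rule ccontr)
      assume "t \<noteq> x0"
      then consider "t < x0" | "x0 < t" by linarith
      then show False using nb1[of t] nb2[of t] that ac by cases auto
    qed
    \<comment> \<open>Near \<open>x0\<close> only \<open>x0\<close> itself can be a bounce, and it
      is counted only if the interval extends beyond it.\<close>
    have C: "?C a c = (if bounce x0 \<and> x0 < c then {x0} else {})" using sub ac by auto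
    show "finite (?C a c)" unfolding C by simp
    have La: "side_before a = orient g2" using L2[of a] ac by auto
    show "side_before c = side_before a * (-1) ^ card (?C a c)"
    proof (cases "x0 < c")
      case True
      then have "side_before c = orient g1" using L1[of c] ac by auto
      then show ?thesis unfolding C La using bounce_orient[OF b f] True by auto
    next
      case False
      then have "c = x0" using ac by simp
      then show ?thesis unfolding C La using L2[of x0] e by simp
    qed
  qed (use e in simp)
qed

lemma side_before_nonzero: "side_before t \<noteq> 0"
proof -
  obtain g z \<epsilon> where b: "piece (-1) t g z \<epsilon>" by (rule piece_exists[of "-1"]) simp_all
  show ?thesis using side_before_eq[OF b] orient_cases[OF r0 piece_label[OF b]] by auto
qed

text \<open>After an even number of bounces the copies at 0 and \<open>T'\<close> have the same
  orientation and differ by a rotation \<open>u\<close>. Folded positions agree along a short piece,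
  hence so do folded velocities; a rotation that fixes a nonzero velocity is trivial.\<close>

lemma billiard_period_iff:
  assumes T': "T' > 0"
  shows "(\<forall>t. x (t + T') = x t) \<and> even (card {t. 0 \<le> t \<and> t < T' \<and> x t \<in> (\<Union>k<5. side r k)}) \<longleftrightarrow> (\<forall>t. q (t + T') = q t)"
    (is "?P \<and> even ?n \<longleftrightarrow> _")
proof -
  have par: "side_before T' = side_before 0 * (-1) ^ ?n"
    using bounce_parity[of 0 T'] T' unfolding bounce_def by simp
  obtain g z \<epsilon> where b: "piece (-1) 0 g z \<epsilon>" by (rule piece_exists[of "-1"]) simp_all
  obtain g' z' \<epsilon>' where b': "piece (-1) T' g' z' \<epsilon>'" by (rule piece_exists[of "-1"]) simp_all
  have L: "side_before 0 = orient g" "side_before T' = orient g'" using side_before_eq b b' by auto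
  show ?thesis
  proof
    assume q: "\<forall>t. q (t + T') = q t"
    have "piece (-1) 0 g' z' \<epsilon>'"
      unfolding piece_def
    proof (intro conjI ballI)
      fix s assume s: "s \<in> {0..\<epsilon>'}"
      have "q (0 + -1 * s) = q (T' + -1 * s)" using q[rule_format, of "- s"] by (simp add: add.commute)
      then show "regular (necklace r) g' (z' + s *\<^sub>R (-1 *\<^sub>R v))" "q (0 + -1 * s) = N.cls g' (z' + s *\<^sub>R (-1 *\<^sub>R v))"
        using pieceD[OF b' s] by auto
    qed (use b' in \<open>simp add: piece_def\<close>)
    then have "g' = g" using piece_unique[of "-1" 0] b by simp
    then have "side_before 0 * (-1) ^ ?n = side_before 0" using par L by simp
    then have "(-1::real) ^ ?n = 1" using side_before_nonzero[of 0] by simp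
    then have "even ?n" by (cases "even ?n") simp_all
    then show "?P \<and> even ?n" using q by simp
  next
    assume a: "?P \<and> even ?n"
    then have "orient g' = orient g" using par L by simp
    then obtain u where u: "u ^ 5 = 1" "g' = g \<circ> rot u" using dihedral_same_orient piece_label b b' by blast
    have bj: "bij g" "bij g'" "bij (rot u)" using dihedral_bij[OF r0] piece_label[OF b] piece_label[OF b'] rot_dihedral[OF r0 u(1)] by auto
    define s where "s = min \<epsilon> \<epsilon>'"
    have s: "0 < s" "s \<in> {0..\<epsilon>}" "s \<in> {0..\<epsilon>'}" using b b' by (auto simp: s_def piece_def)
    have x0: "inv g' (z' + h *\<^sub>R (-1 *\<^sub>R v)) = inv g (z + h *\<^sub>R (-1 *\<^sub>R v))" if h: "h \<in> {0..\<epsilon>}" "h \<in> {0..\<epsilon>'}" for h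
    proof -
      have "x (T' + -1 * h) = x (0 + -1 * h)" using a by (metis add.commute add_0)
      then show ?thesis using fold_cls[OF pieceD(1)[OF b h(1)]] fold_cls[OF pieceD(1)[OF b' h(2)]] pieceD(2)[OF b h(1)] pieceD(2)[OF b' h(2)]
        by simp
    qed
    have ig: "inv g' w = cnj u * inv g w" for w unfolding u(2) o_inv_distrib[OF bj(1,3)] inv_rot[OF u(1)] by (simp add: rot_def)
    have lin: "linear (inv g)"
      using dihedral_orthogonal[OF r0 piece_label[OF b]] orthogonal_transformation_inv orthogonal_transformation_def by blast
    have e0: "cnj u * inv g z' = inv g z" using x0[of 0] s unfolding ig by auto
    have es: "cnj u * (inv g z' - s *\<^sub>R inv g v) = inv g z - s *\<^sub>R inv g v"
      using x0[OF s(2,3)] unfolding ig by (simp add: linear_diff[OF lin] linear_cmul[OF lin])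
    have "s *\<^sub>R (cnj u * inv g v) = s *\<^sub>R inv g v" using e0 es by (simp add: right_diff_distrib)
    then have "cnj u * inv g v = inv g v" using s(1) by simp
    moreover have "inv g v \<noteq> 0"
    proof
      assume "inv g v = 0"
      then have "v = g 0" using bj(1) by (metis bij_inv_eq_iff)
      then have "v = 0" using dihedral_orthogonal[OF r0 piece_label[OF b]] linear_0 by (auto simp: orthogonal_transformation_def)
      then show False using v by simp
    qed
    ultimately have "cnj u = 1" by simp
    then have u1: "u = 1" by (metis complex_cnj_cnj complex_cnj_one)
    then have "g' = g" using u(2) by simp
    moreover have "z' = z"
    proof -
      have "inv g z' = inv g z" using e0 u1 by simp
      then show ?thesis using bj(1) by (metis bij_inv_eq_iff)
    qed
    ultimately have q0: "q T' = q 0" using piece0(2)[OF b] piece0(2)[OF b'] by simp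
    have "straight_on (necklace r) v UNIV (\<lambda>t. q (t + T'))" using straight_on_shift[OF strq, of T'] by simp
    from N.unique_continuation[OF this strq connected_UNIV UNIV_I UNIV_I, of 0] q0 show "\<forall>t. q (t + T') = q t" by simp
  qed
qed

lemma billiard_length_eq: "billiard_length r x = trajectory_length q"
proof -
  have "{T'. 0 < T' \<and> (\<forall>t. x (t + T') = x t) \<and> even (card {t. 0 \<le> t \<and> t < T' \<and> x t \<in> (\<Union>k<5. side r k)})}
    = {T'. 0 < T' \<and> (\<forall>t. q (t + T') = q t)}"
    using billiard_period_iff by blast
  then show ?thesis unfolding billiard_length_def trajectory_length_def by simp
qed

lemma dichotomy:
  "lifts_to_five r p \<and> \<not> lifts_to_one r p \<and> billiard_length r x = trajectory_length p \<and> \<not> rotation_symmetric x \<or>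
   lifts_to_one r p \<and> \<not> lifts_to_five r p \<and> billiard_length r x = 5 * trajectory_length p \<and> rotation_symmetric x"
proof (cases "mon = 1")
  case True
  then show ?thesis
    using five_of_trivial not_one_of_trivial not_rotation_symmetric_of_trivial billiard_length_eq length_q length_p by simp
next
  case False
  then show ?thesis
    using one_of_nontrivial not_five_of_nontrivial rotation_symmetric_of_nontrivial billiard_length_eq length_q length_p by simp
qed

end

theorem theorem3p31:
  fixes r :: real and p :: "real \<Rightarrow> (complex set \<times> complex) set"
  assumes "r \<noteq> 0"
    and "core_curve (double_pentagon r) p"
  shows "(\<exists>x. billiard_trajectory_of r p x) \<and>
         (lifts_to_five r p \<or> lifts_to_one r p) \<and>
         (lifts_to_five r p \<longrightarrow>
            (\<forall>x. billiard_trajectory_of r p x \<longrightarrow>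
               billiard_length r x = trajectory_length p \<and>
               reflection_symmetric r x \<and> \<not> rotation_symmetric x)) \<and>
         (lifts_to_one r p \<longrightarrow>
            (\<forall>x. billiard_trajectory_of r p x \<longrightarrow>
               billiard_length r x = 5 * trajectory_length p \<and>
               reflection_symmetric r x \<and> rotation_symmetric x))"
proof -
  interpret pentagon_surfaces r by unfold_locales (fact assms(1))
  obtain v T0 \<tau> where v: "norm v = 1" "straight_on (double_pentagon r) v UNIV p" and T0: "T0 > 0" "\<And>t. p (t + T0) = p t"
    and sym: "\<And>t. p (t + \<tau>) = iota (p (- t))"
    using core_curve_symmetric[OF assms(2)] by blast
  have "v \<noteq> 0" using v(1) by auto
  \<comment> \<open>The period \<open>T0\<close> may be a proper multiple of the primitive one,
    which lengths and monodromy require.\<close>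
  from DP.minimal_period[OF v(2) this T0] obtain T where T: "T > 0" "\<And>t. p (t + T) = p t"
    "\<And>T'. (\<And>t. p (t + T') = p t) \<Longrightarrow> \<exists>n::int. T' = of_int n * T"
    by blast
  \<comment> \<open>The lift is arbitrary, including its direction \<open>v'\<close>, because the
    claim concerns every billiard trajectory of \<open>p\<close>.\<close>
  have main: "reflection_symmetric r x \<and>
    (lifts_to_five r p \<and> \<not> lifts_to_one r p \<and> billiard_length r x = trajectory_length p \<and> \<not> rotation_symmetric x \<or>
     lifts_to_one r p \<and> \<not> lifts_to_five r p \<and> billiard_length r x = 5 * trajectory_length p \<and> rotation_symmetric x)"
    if x: "billiard_trajectory_of r p x" for x
  proof -
    obtain v' q where q: "trajectory (necklace r) v' q" "\<And>t. covering r (q t) = p t" "x = fold_point \<circ> q"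
      using x unfolding billiard_trajectory_of_def by blast
    interpret lifted_geodesic r p v' q T
      by unfold_locales (use q T in \<open>auto simp: trajectory_def lifts_along_def\<close>)
    show ?thesis unfolding q(3) using reflection_symmetric[OF sym] dichotomy by blast
  qed
  obtain q where "lifts_along v p UNIV q" using lift_exists[OF v(2)] by blast
  then have ex: "billiard_trajectory_of r p (fold_point \<circ> q)"
    unfolding billiard_trajectory_of_def trajectory_def lifts_along_def using v(1) by blast
  show ?thesis using ex main by blast
qed

end
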